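(* Let $\beta\in\{1,2,4\}$, $\alpha\ge0$, and let $\sigma>0$ if $\alpha>0$, $\sigma\in\mathbb R$ if $\alpha=0$. Let $(\mu_n)$ be a sequence of positive reals with $\lim_{n\to\infty}\mu_n/n=\alpha$. For each $n$ let $\mathbb P_n$ be the probability measure on $[\sigma\sqrt n,+\infty[^n$ with density proportional to $$\prod_{i=1}^n|\lambda_i|^{\beta\mu_n}e^{-\frac\beta2\sum_i\lambda_i^2}\prod_{i<j}|\lambda_i-\lambda_j|^\beta$$ (the law of the eigenvalues of the generalized Gaussian ensemble conditioned to have all eigenvalues $\ge\sigma\sqrt n$), and let $\nu_n$ be the probability measure on $\mathbb R$ given by $\int\varphi\,d\nu_n=\mathbb E_{\mathbb P_n}\big[\frac1n\sum_{i=1}^n\varphi(\lambda_i/\sqrt n)\big]$. Then there exist unique $a=a(\sigma,\alpha)\ge\sigma$ and $b=b(\sigma,\alpha)>a$ such that $\nu_n$ converges in the tight topology (i.e. $\int\varphi\,d\nu_n\to\int\varphi\,d\nu^\sigma_\alpha$ for all bounded continuous $\varphi$) to the equilibrium measure $\nu^\sigma_\alpha$, which is supported on $[a,b]$.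
   Context: $\nu^\sigma_\alpha$ is the equilibrium measure of $(\Sigma_\sigma,Q_\alpha)$ with $\Sigma_\sigma=[\sigma,+\infty[$ and $Q_\alpha(x)=x^2+2\alpha\log\frac1{x}$ (for $\alpha=0$, $Q_0(x)=x^2$): the unique probability measure $\mu$ on $\Sigma_\sigma$ minimizing $\iint\log\frac1{|x-y|}\mu(dx)\mu(dy)+\int Q_\alpha\,d\mu$. *)

theory Defs
  imports "HOL-Probability.Probability"
begin

definition Qext :: "real \<Rightarrow> real \<Rightarrow> real" where
  "Qext \<alpha> x = x\<^sup>2 + 2 * \<alpha> * ln (1 / x)"

definition Sig :: "real \<Rightarrow> real set" where
  "Sig \<sigma> = {\<sigma>..}"

definition eq_kernel :: "real \<Rightarrow> real \<Rightarrow> real \<Rightarrow> ereal" where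
  "eq_kernel \<alpha> x y = (if x = y then \<infinity>
      else ereal (ln (1 / \<bar>x - y\<bar>) + (Qext \<alpha> x + Qext \<alpha> y) / 2))"

text \<open>Weighted logarithmic energy
  I(mu) = double integral of log(1/|x-y|) + integral of Q, written as the double integral
  of the symmetrised kernel (positive part minus negative part, in the extended reals).\<close>
definition log_energy :: "real \<Rightarrow> real measure \<Rightarrow> ereal" where
  "log_energy \<alpha> \<mu> =
     enn2ereal (\<integral>\<^sup>+ z. e2ennreal (max 0 (eq_kernel \<alpha> (fst z) (snd z))) \<partial>(\<mu> \<Otimes>\<^sub>M \<mu>))
   - enn2ereal (\<integral>\<^sup>+ z. e2ennreal (max 0 (- eq_kernel \<alpha> (fst z) (snd z))) \<partial>(\<mu> \<Otimes>\<^sub>M \<mu>))"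

definition prob_on :: "real \<Rightarrow> real measure \<Rightarrow> bool" where
  "prob_on \<sigma> \<mu> \<longleftrightarrow> prob_space \<mu> \<and> sets \<mu> = sets borel \<and> emeasure \<mu> (Sig \<sigma>) = 1"

definition is_equilibrium_measure :: "real \<Rightarrow> real \<Rightarrow> real measure \<Rightarrow> bool" where
  "is_equilibrium_measure \<sigma> \<alpha> \<nu> \<longleftrightarrow>
     prob_on \<sigma> \<nu> \<and> (\<forall>\<mu>. prob_on \<sigma> \<mu> \<longrightarrow> log_energy \<alpha> \<nu> \<le> log_energy \<alpha> \<mu>)"

definition msupport :: "real measure \<Rightarrow> real set" where
  "msupport \<nu> = {x. \<forall>e>0. emeasure \<nu> (ball x e) > 0}"

definition Leb_n :: "nat \<Rightarrow> (nat \<Rightarrow> real) measure" where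
  "Leb_n n = PiM {..<n} (\<lambda>_. lborel)"

definition gge_dens :: "real \<Rightarrow> real \<Rightarrow> real \<Rightarrow> nat \<Rightarrow> (nat \<Rightarrow> real) \<Rightarrow> real" where
  "gge_dens \<beta> m \<sigma> n x =
     indicator (PiE {..<n} (\<lambda>_. {\<sigma> * sqrt n..})) x
     * (\<Prod>i<n. \<bar>x i\<bar> powr (\<beta> * m))
     * exp (- (\<beta> / 2) * (\<Sum>i<n. (x i)\<^sup>2))
     * (\<Prod>p\<in>{(i, j). i < j \<and> j < n}. \<bar>x (fst p) - x (snd p)\<bar> powr \<beta>)"

definition gge_law :: "real \<Rightarrow> real \<Rightarrow> real \<Rightarrow> nat \<Rightarrow> (nat \<Rightarrow> real) measure" where
  "gge_law \<beta> m \<sigma> n =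
     density (Leb_n n) (\<lambda>x. ennreal (gge_dens \<beta> m \<sigma> n x
        / (\<integral>y. gge_dens \<beta> m \<sigma> n y \<partial>Leb_n n)))"

text \<open>Integral of phi against nu_n = E_{P_n}[(1/n) sum phi(lambda_i / sqrt n)].\<close>
definition emp_int :: "real \<Rightarrow> real \<Rightarrow> real \<Rightarrow> nat \<Rightarrow> (real \<Rightarrow> real) \<Rightarrow> real" where
  "emp_int \<beta> m \<sigma> n \<phi> =
     (\<integral>x. (1 / real n) * (\<Sum>i<n. \<phi> (x i / sqrt n)) \<partial>gge_law \<beta> m \<sigma> n)"

end

theory Submission
  imports Defs "HOL-Real_Asymp.Real_Asymp"
begin

text \<open>
  The weighted logarithmic energy is minimised by the direct method. Uniqueness comes from displacement
  convexity: writing two measures as laws of monotone quantile functions on $(0,1)$, the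
  energy of the law of the midpoint is strictly smaller, because $-\log$ is convex and
  the potential is strictly convex. The Euler--Lagrange inequality for mixtures bounds the potential of
  the minimiser from above on its support, and a gap in the support would make this potential,
  strictly convex across the gap, too small for the measure to be minimal.

  For the convergence, the configurations whose empirical measure is far from the minimiser have a
  discrete energy exceeding the minimum by a fixed amount (by compactness, with $\log$ regularised
  at scale $1/n$), so their density is smaller than $e^{-\beta n^2(\min+c)/2}$. The partition function
  is bounded below by Jensen's inequality for $n$ independent points $Y(w)+\delta w$, where $Y$ is the
  quantile function of the minimiser and $w$ is uniform: adding $\delta w$ spreads the points apart, which
  only lowers the logarithmic energy, and it makes the law of each point have density at most $1/\delta$.
\<close>

section \<open>The regularised kernel\<close>

text \<open>No formula for the equilibrium measure is used: beyond finite energy and bounded support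
  nothing is known about its regularity, which is why the lower bound for the partition function has
  to manufacture a bounded density. The energy is only lower semicontinuous under weak convergence,
  but two one-sided estimates suffice. Their quotient gains a factor exponentially small in
  \<open>n^2\<close>, while the losses (diagonal terms, Gaussian integrals, change to Lebesgue
  measure) cost at most order \<open>n ln n\<close> in the exponent; the scale 1/n of the
  regularisation keeps the diagonal at that order.

  A second difficulty is that \<open>\<mu> n / n\<close> merely tends to \<alpha>. For \<alpha> = 0
  the wall may be negative, and the finite systems then have a logarithmic singularity at 0 that the
  limit lacks. It only raises the energy, so it does no harm in the upper bound; in the lower bound
  it is integrated against a bounded density with a coefficient tending to 0.

  Energies are shifted by a constant that makes the kernels nonnegative, so that Tonelli and Fatou
  apply in \<open>ennreal\<close> without integrability conditions.\<close>

lemma ln_square: "x \<noteq> 0 \<Longrightarrow> ln (x\<^sup>2) = 2 * ln \<bar>x\<bar>" for x :: real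
  using ln_realpow[of "\<bar>x\<bar>" 2] by simp

text \<open>The tangent line of \<open>ln\<close> at \<open>c\<close>, with the constant -1 dropped.
  Its slope 1/c is free, so a logarithm can be absorbed by as small a fraction of the quadratic
  potential as needed.\<close>

lemma ln_one_plus_square_le:
  fixes c u :: real
  assumes "c > 0"
  shows "ln (1 + u\<^sup>2) \<le> (1 + u\<^sup>2) / c + ln c"
proof -
  have pos: "1 + u\<^sup>2 > 0" by (simp add: add_pos_nonneg)
  have "ln ((1 + u\<^sup>2) / c) \<le> (1 + u\<^sup>2) / c"
    using ln_le_minus_one[of "(1 + u\<^sup>2) / c"] divide_pos_pos[OF pos assms] by simp
  thus ?thesis using assms pos ln_divide_pos[of "1 + u\<^sup>2" c] by simp
qed

text \<open>The constant that makes the kernel below at least $(x^2+y^2)/8$.\<close>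

definition kern_shift :: "real \<Rightarrow> real" where
  "kern_shift A = ln 2 / 2 + 1 / 4 + (A + 1) * ln (4 * (A + 1))"

text \<open>
  The logarithm is regularised at scale \<open>\<epsilon>\<close>. For \<open>n\<close> particles \<open>a = \<mu> n / n\<close> is the
  current exponent, and \<open>\<theta> = 1 - 1 / n\<close> keeps one copy of the potential per particle aside
  to integrate the density.
\<close>

definition rkern :: "real \<Rightarrow> real \<Rightarrow> real \<Rightarrow> real \<Rightarrow> real \<Rightarrow> real \<Rightarrow> real" where
  "rkern A \<epsilon> a \<theta> x y = kern_shift A - ln ((x - y)\<^sup>2 + \<epsilon>\<^sup>2) / 2
     + \<theta> * ((x\<^sup>2 - a * ln (x\<^sup>2 + \<epsilon>\<^sup>2)) + (y\<^sup>2 - a * ln (y\<^sup>2 + \<epsilon>\<^sup>2))) / 2"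

text \<open>On the diagonal \<open>rkern\<close> with \<open>\<epsilon> = 0\<close> is finite, because \<open>ln 0 = 0\<close>.\<close>

definition ekern :: "real \<Rightarrow> real \<Rightarrow> real \<Rightarrow> real \<Rightarrow> ennreal" where
  "ekern A \<alpha> x y = (if x = y then \<infinity> else ennreal (rkern A 0 \<alpha> 1 x y))"

definition energy :: "real \<Rightarrow> real \<Rightarrow> real measure \<Rightarrow> ennreal" where
  "energy A \<alpha> \<mu> = (\<integral>\<^sup>+ z. ekern A \<alpha> (fst z) (snd z) \<partial>(\<mu> \<Otimes>\<^sub>M \<mu>))"

lemma rkern_measurable [measurable]:
  "(\<lambda>z. rkern A \<epsilon> a \<theta> (fst z) (snd z)) \<in> borel_measurable (borel \<Otimes>\<^sub>M borel)"
  unfolding rkern_def by measurable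

lemma ekern_measurable [measurable]:
  "(\<lambda>z. ekern A \<alpha> (fst z) (snd z)) \<in> borel_measurable (borel \<Otimes>\<^sub>M borel)"
  unfolding ekern_def by measurable

lemma rkern_commute: "rkern A \<epsilon> a \<theta> x y = rkern A \<epsilon> a \<theta> y x"
  by (simp add: rkern_def power2_commute[of x y] add.commute)

lemma ekern_commute: "ekern A \<alpha> x y = ekern A \<alpha> y x"
  by (simp add: ekern_def rkern_commute)

text \<open>Interaction and potential together cost at most (A + 1) / 2 times
  \<open>ln (1 + u\<^sup>2)\<close> per point, and the tangent bound with c = 4 (A + 1) turns this
  into \<open>(1 + u\<^sup>2) / 8\<close> plus a constant. As \<theta> is at least 1/2, the
  potential supplies \<open>u\<^sup>2 / 4\<close>, so half of that survives. The bound is uniform in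
  \<epsilon>, \<open>a\<close> and \<theta>; it yields both nonnegativity and tightness. The last
  two hypotheses exclude the convention \<open>ln 0 = 0\<close>.\<close>

lemma rkern_lower:
  assumes a: "0 \<le> a" "a \<le> A" and th: "1/2 \<le> \<theta>" "\<theta> \<le> 1" and e: "\<bar>\<epsilon>\<bar> \<le> 1"
    and d: "x \<noteq> y \<or> \<epsilon> \<noteq> 0" and z: "a = 0 \<or> \<epsilon> \<noteq> 0 \<or> (x \<noteq> 0 \<and> y \<noteq> 0)"
  shows "(x\<^sup>2 + y\<^sup>2) / 8 \<le> rkern A \<epsilon> a \<theta> x y"
proof -
  have e2: "\<epsilon>\<^sup>2 \<le> 1" using e by (simp add: abs_square_le_1)
  have lnb: "(A + 1) / 2 * ln (1 + u\<^sup>2) \<le> (1 + u\<^sup>2) / 8 + (A + 1) / 2 * ln (4 * (A + 1))" for u :: real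
  proof -
    have A: "A + 1 > 0" using a by simp
    have "ln (1 + u\<^sup>2) \<le> (1 + u\<^sup>2) / (4 * (A + 1)) + ln (4 * (A + 1))"
      using A by (intro ln_one_plus_square_le) simp
    hence "(A + 1) / 2 * ln (1 + u\<^sup>2) \<le> (A + 1) / 2 * ((1 + u\<^sup>2) / (4 * (A + 1)) + ln (4 * (A + 1)))"
      using A by (intro mult_left_mono) auto
    also have "\<dots> = (1 + u\<^sup>2) / 8 + (A + 1) / 2 * ln (4 * (A + 1))"
      using A by (simp add: field_simps)
    finally show ?thesis .
  qed
  have pos: "(x - y)\<^sup>2 + \<epsilon>\<^sup>2 > 0"
    using d by (auto simp: sum_power2_gt_zero_iff)
  \<comment> \<open>A product bound, so that the logarithm of the distance splits into one term per
    point.\<close>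
  have "(x - y)\<^sup>2 + \<epsilon>\<^sup>2 \<le> 2 * (1 + x\<^sup>2) * (1 + y\<^sup>2)"
  proof -
    have "(x - y)\<^sup>2 \<le> 2 * x\<^sup>2 + 2 * y\<^sup>2"
      using zero_le_power2[of "x + y"] by (simp add: power2_eq_square algebra_simps)
    moreover have "0 \<le> x\<^sup>2 * y\<^sup>2" by simp
    moreover have "2 * (1 + x\<^sup>2) * (1 + y\<^sup>2) = 2 + 2 * x\<^sup>2 + 2 * y\<^sup>2 + 2 * (x\<^sup>2 * y\<^sup>2)"
      by (simp add: algebra_simps)
    ultimately show ?thesis using e2 by linarith
  qed
  hence "ln ((x - y)\<^sup>2 + \<epsilon>\<^sup>2) \<le> ln (2 * (1 + x\<^sup>2) * (1 + y\<^sup>2))"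
    using pos by (subst ln_le_cancel_iff) (auto intro!: mult_pos_pos add_pos_nonneg)
  also have "\<dots> = ln 2 + ln (1 + x\<^sup>2) + ln (1 + y\<^sup>2)"
    by (subst ln_mult_pos ; (subst ln_mult_pos)?) (auto intro!: mult_pos_pos add_pos_nonneg)
  finally have l1: "ln ((x - y)\<^sup>2 + \<epsilon>\<^sup>2) / 2 \<le> ln 2 / 2 + ln (1 + x\<^sup>2) / 2 + ln (1 + y\<^sup>2) / 2"
    by simp
  have pot: "u\<^sup>2 / 4 - A / 2 * ln (1 + u\<^sup>2) \<le> \<theta> * (u\<^sup>2 - a * ln (u\<^sup>2 + \<epsilon>\<^sup>2)) / 2"
    if "a = 0 \<or> \<epsilon> \<noteq> 0 \<or> u \<noteq> 0" for u
  proof -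
    have L: "ln (1 + u\<^sup>2) \<ge> 0" by simp
    have "a * ln (u\<^sup>2 + \<epsilon>\<^sup>2) \<le> a * ln (1 + u\<^sup>2)"
    proof (cases "a = 0")
      case False
      hence "u\<^sup>2 + \<epsilon>\<^sup>2 > 0" using that by (auto simp: sum_power2_gt_zero_iff)
      hence "ln (u\<^sup>2 + \<epsilon>\<^sup>2) \<le> ln (1 + u\<^sup>2)" using e2 by (subst ln_le_cancel_iff) auto
      thus ?thesis using a by (intro mult_left_mono) auto
    qed auto
    hence "\<theta> * (u\<^sup>2 - a * ln (1 + u\<^sup>2)) \<le> \<theta> * (u\<^sup>2 - a * ln (u\<^sup>2 + \<epsilon>\<^sup>2))"
      using th by (intro mult_left_mono) auto
    moreover have "\<theta> * u\<^sup>2 \<ge> 1/2 * u\<^sup>2" using th by (intro mult_right_mono) auto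
    moreover have "\<theta> * (a * ln (1 + u\<^sup>2)) \<le> 1 * (A * ln (1 + u\<^sup>2))"
      using th a L by (intro mult_mono mult_right_mono) auto
    ultimately show ?thesis by (simp add: algebra_simps)
  qed
  have px: "x\<^sup>2 / 4 - A / 2 * ln (1 + x\<^sup>2) \<le> \<theta> * (x\<^sup>2 - a * ln (x\<^sup>2 + \<epsilon>\<^sup>2)) / 2"
    and py: "y\<^sup>2 / 4 - A / 2 * ln (1 + y\<^sup>2) \<le> \<theta> * (y\<^sup>2 - a * ln (y\<^sup>2 + \<epsilon>\<^sup>2)) / 2"
    using pot[of x] pot[of y] z by blast+
  have eq: "(A + 1) * ln (4 * (A + 1)) = 2 * ((A + 1) / 2 * ln (4 * (A + 1)))"
    by (simp add: field_simps)
  have *: "(A + 1) / 2 * L = A / 2 * L + L / 2" for L :: real by (simp add: field_simps)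
  have "\<theta> * (x\<^sup>2 - a * ln (x\<^sup>2 + \<epsilon>\<^sup>2) + (y\<^sup>2 - a * ln (y\<^sup>2 + \<epsilon>\<^sup>2))) / 2
     = \<theta> * (x\<^sup>2 - a * ln (x\<^sup>2 + \<epsilon>\<^sup>2)) / 2 + \<theta> * (y\<^sup>2 - a * ln (y\<^sup>2 + \<epsilon>\<^sup>2)) / 2"
    by (simp only: distrib_left add_divide_distrib)
  moreover have "(X + Y) / 8 \<le> c + 1 / 4 + 2 * W - L / 2 + S"
    if "S = p + q" "X / 4 - Ax \<le> p" "Y / 4 - Ay \<le> q" "L / 2 \<le> c + lx / 2 + ly / 2"
      "Ax + lx / 2 \<le> (1 + X) / 8 + W" "Ay + ly / 2 \<le> (1 + Y) / 8 + W"
    for X Y c W L S p q Ax Ay lx ly :: real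
    using that by (simp add: field_simps)
  ultimately show ?thesis using px py l1 lnb[of x, unfolded *[of "ln (1 + x\<^sup>2)"]] lnb[of y, unfolded *[of "ln (1 + y\<^sup>2)"]]
    unfolding rkern_def kern_shift_def eq by blast
qed

lemma rkern_nonneg:
  assumes "0 \<le> a" "a \<le> A" "1/2 \<le> \<theta>" "\<theta> \<le> 1" "\<bar>\<epsilon>\<bar> \<le> 1"
    and "x \<noteq> y \<or> \<epsilon> \<noteq> 0" "a = 0 \<or> \<epsilon> \<noteq> 0 \<or> (x \<noteq> 0 \<and> y \<noteq> 0)"
  shows "0 \<le> rkern A \<epsilon> a \<theta> x y"
proof -
  have "0 \<le> (x\<^sup>2 + y\<^sup>2) / 8" by simp
  also have "\<dots> \<le> rkern A \<epsilon> a \<theta> x y" by (rule rkern_lower) fact+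
  finally show ?thesis .
qed

lemma rkern_le_rkern_0:
  assumes a: "0 \<le> a" and th: "0 \<le> \<theta>" and d: "x \<noteq> y" and z: "a = 0 \<or> (x \<noteq> 0 \<and> y \<noteq> 0)"
  shows "rkern A \<epsilon> a \<theta> x y \<le> rkern A 0 a \<theta> x y"
proof -
  have 1: "ln ((x - y)\<^sup>2) \<le> ln ((x - y)\<^sup>2 + \<epsilon>\<^sup>2)"
    using d by (subst ln_le_cancel_iff) (auto intro: add_pos_nonneg)
  have pot: "a * ln (u\<^sup>2) \<le> a * ln (u\<^sup>2 + \<epsilon>\<^sup>2)" if "a = 0 \<or> u \<noteq> 0" for u
  proof (cases "a = 0")
    case False
    hence "ln (u\<^sup>2) \<le> ln (u\<^sup>2 + \<epsilon>\<^sup>2)"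
      using that by (subst ln_le_cancel_iff) (auto intro: add_pos_nonneg)
    thus ?thesis using a by (intro mult_left_mono) auto
  qed auto
  have 2: "\<theta> * ((x\<^sup>2 - a * ln (x\<^sup>2 + \<epsilon>\<^sup>2)) + (y\<^sup>2 - a * ln (y\<^sup>2 + \<epsilon>\<^sup>2)))
     \<le> \<theta> * ((x\<^sup>2 - a * ln (x\<^sup>2)) + (y\<^sup>2 - a * ln (y\<^sup>2)))"
    using pot[of x] pot[of y] z th by (intro mult_left_mono) auto
  show ?thesis unfolding rkern_def using 1 divide_right_mono[OF 2, of 2] by simp
qed

text \<open>\<open>A\<close> will bound the exponents of all finite systems as well as their limit,
  so that one shift of the kernel serves them all. The condition on \<sigma> keeps the singularity
  of the potential at 0 off the half-line as soon as \<alpha> > 0.\<close>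

locale gas =
  fixes \<sigma> \<alpha> A :: real
  assumes alpha: "0 \<le> \<alpha>" "\<alpha> \<le> A" and sigma: "\<alpha> > 0 \<longrightarrow> \<sigma> > 0"
begin

lemma alpha_0_or_nonzero: "\<sigma> \<le> x \<Longrightarrow> \<alpha> = 0 \<or> x \<noteq> 0"
  using alpha sigma by force

lemma ekern_lower:
  assumes "\<sigma> \<le> x" "\<sigma> \<le> y"
  shows "ennreal ((x\<^sup>2 + y\<^sup>2) / 8) \<le> ekern A \<alpha> x y"
  using rkern_lower[of \<alpha> A 1 0 x y] alpha alpha_0_or_nonzero[OF assms(1)] alpha_0_or_nonzero[OF assms(2)]
  by (auto simp: ekern_def intro!: ennreal_leI)

lemma rkern_le_ekern:
  assumes "\<sigma> \<le> x" "\<sigma> \<le> y"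
  shows "ennreal (rkern A \<epsilon> \<alpha> 1 x y) \<le> ekern A \<alpha> x y"
  using rkern_le_rkern_0[of \<alpha> 1 x y A \<epsilon>] alpha alpha_0_or_nonzero[OF assms(1)] alpha_0_or_nonzero[OF assms(2)]
  by (auto simp: ekern_def intro!: ennreal_leI)

text \<open>Lower semicontinuity jointly in the points and in all parameters, including the
  diagonal, where the limit kernel is infinite. This is the pointwise input for Fatou's
  lemma.\<close>

lemma liminf_rkern:
  assumes x: "x \<longlonglongrightarrow> x0" and y: "y \<longlonglongrightarrow> y0" and x0: "\<sigma> \<le> x0" and y0: "\<sigma> \<le> y0"
    and e: "\<epsilon> \<longlonglongrightarrow> 0" "\<And>n. \<epsilon> n > 0" and a: "a \<longlonglongrightarrow> \<alpha>" "\<And>n. a n \<ge> 0" and th: "\<theta> \<longlonglongrightarrow> 1"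
  shows "ekern A \<alpha> x0 y0 \<le> liminf (\<lambda>n. ennreal (rkern A (\<epsilon> n) (a n) (\<theta> n) (x n) (y n)))"
proof -
  have pot: "\<exists>l. l \<longlonglongrightarrow> \<alpha> * ln (u0\<^sup>2) \<and> (\<forall>\<^sub>F n in sequentially. a n * ln ((u n)\<^sup>2 + (\<epsilon> n)\<^sup>2) \<le> l n)"
    if u: "u \<longlonglongrightarrow> u0" and u0: "\<sigma> \<le> u0" for u u0
  proof (cases "u0 = 0")
    \<comment> \<open>At 0 the product of a vanishing exponent with a logarithm tending to minus
      infinity has no determined limit. The upper bound 0 is enough, because only a lower bound for
      the kernel is wanted.\<close>
    case True
    hence "\<alpha> = 0" using alpha_0_or_nonzero[OF u0] by auto
    have "(\<lambda>n. (u n)\<^sup>2 + (\<epsilon> n)\<^sup>2) \<longlonglongrightarrow> 0\<^sup>2 + 0\<^sup>2"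
      using u True e by (intro tendsto_intros) auto
    hence "\<forall>\<^sub>F n in sequentially. (u n)\<^sup>2 + (\<epsilon> n)\<^sup>2 < 1"
      by (intro order_tendstoD) auto
    hence "\<forall>\<^sub>F n in sequentially. a n * ln ((u n)\<^sup>2 + (\<epsilon> n)\<^sup>2) \<le> 0"
    proof eventually_elim
      case (elim n)
      moreover have "0 < (u n)\<^sup>2 + (\<epsilon> n)\<^sup>2" using e(2)[of n] by (auto simp: sum_power2_gt_zero_iff)
      ultimately have "ln ((u n)\<^sup>2 + (\<epsilon> n)\<^sup>2) \<le> 0" by (simp add: ln_le_zero_iff)
      thus ?case using a(2)[of n] by (simp add: mult_nonneg_nonpos)
    qed
    thus ?thesis using \<open>\<alpha> = 0\<close> by (intro exI[of _ "\<lambda>_. 0"]) auto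
  next
    case False
    have "(\<lambda>n. a n * ln ((u n)\<^sup>2 + (\<epsilon> n)\<^sup>2)) \<longlonglongrightarrow> \<alpha> * ln (u0\<^sup>2 + 0\<^sup>2)"
      using u e a False by (intro tendsto_intros) auto
    thus ?thesis by (intro exI[of _ "\<lambda>n. a n * ln ((u n)\<^sup>2 + (\<epsilon> n)\<^sup>2)"]) auto
  qed
  from pot[OF x x0] obtain l where l: "l \<longlonglongrightarrow> \<alpha> * ln (x0\<^sup>2)"
    "\<forall>\<^sub>F n in sequentially. a n * ln ((x n)\<^sup>2 + (\<epsilon> n)\<^sup>2) \<le> l n" by blast
  from pot[OF y y0] obtain m where m: "m \<longlonglongrightarrow> \<alpha> * ln (y0\<^sup>2)"
    "\<forall>\<^sub>F n in sequentially. a n * ln ((y n)\<^sup>2 + (\<epsilon> n)\<^sup>2) \<le> m n" by blast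
  define b where "b n = \<theta> n * (((x n)\<^sup>2 - l n) + ((y n)\<^sup>2 - m n)) / 2" for n
  have b: "b \<longlonglongrightarrow> 1 * ((x0\<^sup>2 - \<alpha> * ln (x0\<^sup>2)) + (y0\<^sup>2 - \<alpha> * ln (y0\<^sup>2))) / 2"
    unfolding b_def using x y l m th by (intro tendsto_intros) auto
  have thp: "\<forall>\<^sub>F n in sequentially. \<theta> n > 0" using th by (intro order_tendstoD) auto
  define c where "c n = kern_shift A - ln ((x n - y n)\<^sup>2 + (\<epsilon> n)\<^sup>2) / 2 + b n" for n
  have le: "\<forall>\<^sub>F n in sequentially. c n \<le> rkern A (\<epsilon> n) (a n) (\<theta> n) (x n) (y n)"
    using thp l(2) m(2)
  proof eventually_elim
    case (elim n)
    hence "\<theta> n * (((x n)\<^sup>2 - l n) + ((y n)\<^sup>2 - m n)) \<le> \<theta> n * (((x n)\<^sup>2 - a n * ln ((x n)\<^sup>2 + (\<epsilon> n)\<^sup>2))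
      + ((y n)\<^sup>2 - a n * ln ((y n)\<^sup>2 + (\<epsilon> n)\<^sup>2)))"
      by (intro mult_left_mono) auto
    from divide_right_mono[OF this, of 2] show ?case by (simp add: c_def b_def rkern_def)
  qed
  have lim: "(\<lambda>n. ennreal (c n)) \<longlonglongrightarrow> ekern A \<alpha> x0 y0"
  proof (cases "x0 = y0")
    case False
    have "c \<longlonglongrightarrow> kern_shift A - ln ((x0 - y0)\<^sup>2 + 0\<^sup>2) / 2
       + 1 * ((x0\<^sup>2 - \<alpha> * ln (x0\<^sup>2)) + (y0\<^sup>2 - \<alpha> * ln (y0\<^sup>2))) / 2"
      unfolding c_def using x y e b False by (intro tendsto_add tendsto_diff tendsto_divide tendsto_ln tendsto_power tendsto_const) auto
    thus ?thesis using False by (simp add: ekern_def rkern_def tendsto_ennrealI)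
  next
    \<comment> \<open>Since \<epsilon> is positive, the argument of the logarithm stays positive
      while it tends to 0, so the interaction tends to infinity and the convention
      \<open>ln 0 = 0\<close> never enters.\<close>
    case True
    have "(\<lambda>n. (x n - y n)\<^sup>2 + (\<epsilon> n)\<^sup>2) \<longlonglongrightarrow> (x0 - y0)\<^sup>2 + 0\<^sup>2"
      using x y e by (intro tendsto_intros) auto
    hence "(\<lambda>n. (x n - y n)\<^sup>2 + (\<epsilon> n)\<^sup>2) \<longlonglongrightarrow> 0" using True by simp
    moreover have "(x n - y n)\<^sup>2 + (\<epsilon> n)\<^sup>2 > 0" for n
      using e(2)[of n] by (auto simp: sum_power2_gt_zero_iff)
    ultimately have "filterlim (\<lambda>n. (x n - y n)\<^sup>2 + (\<epsilon> n)\<^sup>2) (at_right 0) sequentially"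
      by (simp add: filterlim_at e(2)[THEN less_imp_neq, THEN not_sym])
    moreover have "filterlim (\<lambda>t::real. - ln t / 2) at_top (at_right 0)" by real_asymp
    ultimately have "filterlim (\<lambda>n. - ln ((x n - y n)\<^sup>2 + (\<epsilon> n)\<^sup>2) / 2) at_top sequentially"
      by (rule filterlim_compose[rotated])
    hence "filterlim (\<lambda>n. (kern_shift A + b n) + - ln ((x n - y n)\<^sup>2 + (\<epsilon> n)\<^sup>2) / 2) at_top sequentially"
      by (intro filterlim_tendsto_add_at_top[OF tendsto_add[OF tendsto_const b]])
    moreover have "c = (\<lambda>n. (kern_shift A + b n) + - ln ((x n - y n)\<^sup>2 + (\<epsilon> n)\<^sup>2) / 2)"
      by (simp add: c_def fun_eq_iff)
    ultimately have "filterlim c at_top sequentially" by simp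
    hence "(\<lambda>n. ennreal (c n)) \<longlonglongrightarrow> \<infinity>"
      by (simp add: ennreal_tendsto_top_eq_at_top)
    thus ?thesis using True by (simp add: ekern_def)
  qed
  have "ekern A \<alpha> x0 y0 = liminf (\<lambda>n. ennreal (c n))"
    using lim_imp_Liminf[OF _ lim] by simp
  also have "\<dots> \<le> liminf (\<lambda>n. ennreal (rkern A (\<epsilon> n) (a n) (\<theta> n) (x n) (y n)))"
    using le by (intro Liminf_mono) (auto elim!: eventually_mono intro: ennreal_leI)
  finally show ?thesis .
qed

end

section \<open>Energy, compactness of energy sublevel sets\<close>

lemma prob_on_real_distribution: "prob_on \<sigma> \<mu> \<Longrightarrow> real_distribution \<mu>"
  unfolding prob_on_def by (auto intro!: real_distribution.intro simp: real_distribution_axioms_def)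

lemma prob_on_AE:
  assumes "prob_on \<sigma> \<mu>" shows "AE x in \<mu>. \<sigma> \<le> x"
proof -
  interpret prob_space \<mu> using assms by (simp add: prob_on_def)
  have "prob (Sig \<sigma>) = 1" using assms by (simp add: prob_on_def measure_def)
  hence "AE x in \<mu>. x \<in> Sig \<sigma>"
    using assms by (subst (asm) prob_eq_1) (auto simp: prob_on_def Sig_def)
  thus ?thesis by (simp add: Sig_def)
qed

lemma prob_onI:
  assumes "prob_space \<mu>" "sets \<mu> = sets borel" "AE x in \<mu>. \<sigma> \<le> x"
  shows "prob_on \<sigma> \<mu>"
proof -
  interpret prob_space \<mu> by fact
  have "prob (Sig \<sigma>) = 1"
    using assms by (subst prob_eq_1) (auto simp: Sig_def)
  thus ?thesis using assms by (simp add: prob_on_def emeasure_eq_measure)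
qed

lemma prob_on_distr:
  assumes "prob_space M" "Y \<in> borel_measurable M" "AE w in M. \<sigma> \<le> Y w"
  shows "prob_on \<sigma> (distr M borel Y)"
  using assms by (intro prob_onI) (auto simp: AE_distr_iff intro: prob_space.prob_space_distr)

lemma AE_pair_both:
  assumes "sigma_finite_measure M" "sigma_finite_measure N"
    and "AE x in M. P x" "AE y in N. Q y"
  shows "AE z in M \<Otimes>\<^sub>M N. P (fst z) \<and> Q (snd z)"
proof -
  interpret M: sigma_finite_measure M by fact
  interpret N: sigma_finite_measure N by fact
  interpret pair_sigma_finite M N ..
  from assms(3) obtain A where A: "{x \<in> space M. \<not> P x} \<subseteq> A" "A \<in> null_sets M"
    by (auto elim!: AE_E simp: null_sets_def)
  from assms(4) obtain B where B: "{x \<in> space N. \<not> Q x} \<subseteq> B" "B \<in> null_sets N"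
    by (auto elim!: AE_E simp: null_sets_def)
  have [measurable]: "A \<in> sets M" "B \<in> sets N" using A B by auto
  have "A \<times> space N \<in> null_sets (M \<Otimes>\<^sub>M N)" "space M \<times> B \<in> null_sets (M \<Otimes>\<^sub>M N)"
    using A B by (auto simp: null_sets_def N.emeasure_pair_measure_Times)
  hence "A \<times> space N \<union> space M \<times> B \<in> null_sets (M \<Otimes>\<^sub>M N)" by (rule null_sets.Un)
  thus ?thesis
    by (rule AE_I') (insert A B, auto simp: space_pair_measure)
qed

lemma nn_integral_pair_fst:
  assumes "sigma_finite_measure M" "prob_space N" and [measurable]: "f \<in> borel_measurable M"
  shows "(\<integral>\<^sup>+ z. f (fst z) \<partial>(M \<Otimes>\<^sub>M N)) = (\<integral>\<^sup>+ x. f x \<partial>M)"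
proof -
  interpret N: prob_space N by fact
  interpret M: sigma_finite_measure M by fact
  have "(\<integral>\<^sup>+ z. f (fst z) \<partial>(M \<Otimes>\<^sub>M N)) = (\<integral>\<^sup>+ x. \<integral>\<^sup>+ y. f x \<partial>N \<partial>M)"
    by (subst N.nn_integral_fst[symmetric]) auto
  thus ?thesis by (simp add: N.emeasure_space_1)
qed

lemma nn_integral_distr_pair:
  assumes "prob_space M" and [measurable]: "Y \<in> borel_measurable M"
    "(\<lambda>z. f (fst z) (snd z)) \<in> borel_measurable (borel \<Otimes>\<^sub>M borel)"
  shows "(\<integral>\<^sup>+ z. f (fst z) (snd z) \<partial>(distr M borel Y \<Otimes>\<^sub>M distr M borel Y))
    = (\<integral>\<^sup>+ z. f (Y (fst z)) (Y (snd z)) \<partial>(M \<Otimes>\<^sub>M M))"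
proof -
  interpret prob_space M by fact
  interpret D: prob_space "distr M borel Y" by (rule prob_space_distr) simp
  have eq: "distr M borel Y \<Otimes>\<^sub>M distr M borel Y = distr (M \<Otimes>\<^sub>M M) (borel \<Otimes>\<^sub>M borel) (\<lambda>(x, y). (Y x, Y y))"
    by (rule pair_measure_distr) (auto intro: D.sigma_finite_measure_axioms)
  have [measurable]: "(\<lambda>(x, y). (Y x, Y y)) \<in> M \<Otimes>\<^sub>M M \<rightarrow>\<^sub>M borel \<Otimes>\<^sub>M borel"
    by measurable
  show ?thesis unfolding eq
    by (subst nn_integral_distr) (auto simp: split_beta)
qed

context gas
begin

text \<open>On the half-line \<open>eq_kernel\<close> is bounded below by
  \<open>- kern_shift A\<close>, so its negative part has a finite integral and the difference
  defining \<open>log_energy\<close> is never infinity minus infinity. The shift is added pointwise,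
  before integration, where everything is nonnegative.\<close>

lemma log_energy_eq:
  assumes mu: "prob_on \<sigma> \<mu>"
  shows "log_energy \<alpha> \<mu> = enn2ereal (energy A \<alpha> \<mu>) - ereal (kern_shift A)"
proof -
  interpret prob_space \<mu> using mu by (simp add: prob_on_def)
  note sf = sigma_finite_measure_axioms
  interpret pair_prob_space \<mu> \<mu> ..
  have [measurable_cong]: "sets \<mu> = sets borel" using mu by (simp add: prob_on_def)
  have AE: "AE z in \<mu> \<Otimes>\<^sub>M \<mu>. \<sigma> \<le> fst z \<and> \<sigma> \<le> snd z"
    by (rule AE_pair_both[OF _ _ prob_on_AE[OF mu] prob_on_AE[OF mu]]) (rule sf)+
  define k where "k z = eq_kernel \<alpha> (fst z) (snd z)" for z
  define C where "C = kern_shift A"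
  have C: "C \<ge> 0" using alpha unfolding C_def kern_shift_def by simp
  have [measurable]: "k \<in> borel_measurable (\<mu> \<Otimes>\<^sub>M \<mu>)" unfolding k_def eq_kernel_def Qext_def by measurable
  have *: "eq_kernel \<alpha> x y = ereal (rkern A 0 \<alpha> 1 x y - C)" if "\<sigma> \<le> x" "\<sigma> \<le> y" "x \<noteq> y" for x y
  proof -
    \<comment> \<open>The form with \<open>u\<^sup>2\<close> also makes sense for negative points,
      which occur only when \<alpha> = 0 and the term vanishes.\<close>
    have "\<alpha> * ln (1 / u) = - \<alpha> * ln (u\<^sup>2) / 2" if u: "\<sigma> \<le> u" for u
    proof (cases "\<alpha> = 0")
      case False
      hence "u > 0" using u alpha sigma by simp
      thus ?thesis by (simp add: ln_div ln_realpow)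
    qed auto
    note pot = this[OF that(1)] this[OF that(2)]
    have "ln ((x - y)\<^sup>2) = 2 * ln \<bar>x - y\<bar>"
      using that by (simp add: ln_square)
    thus ?thesis using that pot by (simp add: eq_kernel_def Qext_def rkern_def C_def ln_div field_simps)
  qed
  have key: "ekern A \<alpha> (fst z) (snd z) + e2ennreal (max 0 (- k z)) = e2ennreal (max 0 (k z)) + ennreal C"
    and neg: "e2ennreal (max 0 (- k z)) \<le> ennreal C"
    if z: "\<sigma> \<le> fst z \<and> \<sigma> \<le> snd z" for z
  proof -
    have "(ekern A \<alpha> (fst z) (snd z) + e2ennreal (max 0 (- k z)) = e2ennreal (max 0 (k z)) + ennreal C)
      \<and> e2ennreal (max 0 (- k z)) \<le> ennreal C"
    proof (cases "fst z = snd z")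
      case True
      thus ?thesis by (simp add: k_def eq_kernel_def ekern_def max_def e2ennreal_infty infinity_ennreal_def)
    next
      case False
      define r where "r = rkern A 0 \<alpha> 1 (fst z) (snd z)"
      have k: "k z = ereal (r - C)" using *[of "fst z" "snd z"] z False by (simp add: k_def r_def)
      have r: "r \<ge> 0"
        using alpha alpha_0_or_nonzero[of "fst z"] alpha_0_or_nonzero[of "snd z"] z False unfolding r_def by (intro rkern_nonneg) auto
      have ek: "ekern A \<alpha> (fst z) (snd z) = ennreal r" using False by (simp add: ekern_def r_def)
      have m: "max 0 (k z) = ereal (max 0 (r - C))" "max 0 (- k z) = ereal (max 0 (C - r))"
        unfolding k by (auto simp: max_def zero_ereal_def)
      show ?thesis unfolding ek m using r C
        by (auto simp: max_def ennreal_plus[symmetric] e2ennreal_ereal simp del: ennreal_plus intro!: ennreal_leI)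
    qed
    thus "ekern A \<alpha> (fst z) (snd z) + e2ennreal (max 0 (- k z)) = e2ennreal (max 0 (k z)) + ennreal C"
      "e2ennreal (max 0 (- k z)) \<le> ennreal C" by auto
  qed
  define P N where "P = (\<integral>\<^sup>+z. e2ennreal (max 0 (k z)) \<partial>(\<mu> \<Otimes>\<^sub>M \<mu>))"
    and "N = (\<integral>\<^sup>+z. e2ennreal (max 0 (- k z)) \<partial>(\<mu> \<Otimes>\<^sub>M \<mu>))"
  have "energy A \<alpha> \<mu> + N = (\<integral>\<^sup>+z. ekern A \<alpha> (fst z) (snd z) + e2ennreal (max 0 (- k z)) \<partial>(\<mu> \<Otimes>\<^sub>M \<mu>))"
    unfolding energy_def N_def by (rule nn_integral_add[symmetric]) measurable
  also have "\<dots> = (\<integral>\<^sup>+z. e2ennreal (max 0 (k z)) + ennreal C \<partial>(\<mu> \<Otimes>\<^sub>M \<mu>))"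
    by (rule nn_integral_cong_AE, use AE in eventually_elim, rule key)
  also have "\<dots> = P + ennreal C"
    unfolding P_def by (subst nn_integral_add) (auto simp: P.emeasure_space_1)
  finally have eq: "energy A \<alpha> \<mu> + N = P + ennreal C" .
  have "N \<le> (\<integral>\<^sup>+z. ennreal C \<partial>(\<mu> \<Otimes>\<^sub>M \<mu>))"
    unfolding N_def by (rule nn_integral_mono_AE, use AE in eventually_elim, rule neg)
  hence N: "N \<le> ennreal C" by (simp add: P.emeasure_space_1)
  have "log_energy \<alpha> \<mu> = enn2ereal P - enn2ereal N"
    unfolding log_energy_def P_def N_def k_def ..
  also have "\<dots> = enn2ereal (energy A \<alpha> \<mu>) - ereal C"
  proof (cases "energy A \<alpha> \<mu>" rule: ennreal_cases)
    case (real e)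
    have "N \<noteq> top" using N by (metis ennreal_neq_top top_unique)
    moreover from this have "P + ennreal C \<noteq> top"
      unfolding eq[symmetric] real(2) by (simp add: ennreal_add_eq_top)
    ultimately have "P \<noteq> \<infinity>" "N \<noteq> \<infinity>"
      by (simp_all add: ennreal_add_eq_top)
    then obtain p n where pn: "P = ennreal p" "p \<ge> 0" "N = ennreal n" "n \<ge> 0"
      by (metis ennreal_cases infinity_ennreal_def)
    with eq real C have "e + n = p + C" by (simp add: ennreal_plus[symmetric] del: ennreal_plus)
    thus ?thesis using pn real by simp
  next
    case top
    with eq have "P = top" by (metis ennreal_add_eq_top ennreal_neq_top)
    moreover have "N \<noteq> top" using N by (metis ennreal_neq_top top_unique)
    ultimately show ?thesis using top by (cases N rule: ennreal_cases) auto
  qed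
  finally show ?thesis by (simp add: C_def)
qed

lemma is_equilibrium_measureI:
  assumes "prob_on \<sigma> \<nu>" "\<And>\<mu>. prob_on \<sigma> \<mu> \<Longrightarrow> energy A \<alpha> \<nu> \<le> energy A \<alpha> \<mu>"
  shows "is_equilibrium_measure \<sigma> \<alpha> \<nu>"
  unfolding is_equilibrium_measure_def using assms
  by (auto simp: log_energy_eq less_eq_ennreal.rep_eq[symmetric] intro!: ereal_minus_mono)

text \<open>The coercive lower bound on the kernel gives uniform second moments, hence tightness.
  Weak convergence is then replaced by pointwise convergence of representing variables, and Fatou on
  the product space transfers the energy bound to the limit. With fixed exponent it produces the
  minimiser; with empirical measures and varying exponent it produces the discrete energy
  gap.\<close>

lemma energy_compactness:
  fixes \<mu> :: "nat \<Rightarrow> real measure" and E :: "nat \<Rightarrow> real"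
  assumes mu: "\<And>n. prob_on \<sigma> (\<mu> n)"
    and e: "\<epsilon> \<longlonglongrightarrow> 0" "\<And>n. \<epsilon> n > 0" "\<And>n. \<epsilon> n \<le> 1"
    and a: "a \<longlonglongrightarrow> \<alpha>" "\<And>n. a n \<ge> 0" "\<And>n. a n \<le> A"
    and th: "\<theta> \<longlonglongrightarrow> 1" "\<And>n. \<theta> n \<ge> 1/2" "\<And>n. \<theta> n \<le> 1"
    and bd: "\<And>n. (\<integral>\<^sup>+ z. ennreal (rkern A (\<epsilon> n) (a n) (\<theta> n) (fst z) (snd z)) \<partial>(\<mu> n \<Otimes>\<^sub>M \<mu> n)) \<le> ennreal (E n)"
    and E: "E \<longlonglongrightarrow> E0"
  obtains r \<mu>' where "strict_mono r" "prob_on \<sigma> \<mu>'" "weak_conv_m (\<mu> \<circ> r) \<mu>'" "energy A \<alpha> \<mu>' \<le> ennreal E0"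
proof -
  interpret mu: real_distribution "\<mu> n" for n using prob_on_real_distribution[OF mu] .
  from E obtain B0 where "\<And>n. \<bar>E n\<bar> \<le> B0"
    by (metis convergentI Bseq_def convergent_imp_Bseq real_norm_def)
  then obtain B where B: "B > 0" "\<And>n. E n \<le> B"
    by (metis abs_le_D1 abs_ge_zero add_pos_nonneg le_add_same_cancel2 order_trans zero_le_one zero_less_one)
  have moment: "(\<integral>\<^sup>+ x. ennreal (x\<^sup>2 / 8) \<partial>\<mu> n) \<le> ennreal B" for n
  proof -
    have "(\<integral>\<^sup>+ x. ennreal (x\<^sup>2 / 8) \<partial>\<mu> n) = (\<integral>\<^sup>+ z. ennreal ((fst z)\<^sup>2 / 8) \<partial>(\<mu> n \<Otimes>\<^sub>M \<mu> n))"
      by (rule nn_integral_pair_fst[symmetric]) (auto intro: mu.sigma_finite_measure_axioms mu.prob_space_axioms)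
    also have "\<dots> \<le> (\<integral>\<^sup>+ z. ennreal (rkern A (\<epsilon> n) (a n) (\<theta> n) (fst z) (snd z)) \<partial>(\<mu> n \<Otimes>\<^sub>M \<mu> n))"
    proof (intro nn_integral_mono ennreal_leI)
      fix z :: "real \<times> real"
      have "((fst z)\<^sup>2 + (snd z)\<^sup>2) / 8 \<le> rkern A (\<epsilon> n) (a n) (\<theta> n) (fst z) (snd z)"
        using e(2)[of n] e(3)[of n] a(2,3) th by (intro rkern_lower) auto
      thus "(fst z)\<^sup>2 / 8 \<le> rkern A (\<epsilon> n) (a n) (\<theta> n) (fst z) (snd z)"
        unfolding add_divide_distrib using divide_nonneg_nonneg[OF zero_le_power2[of "snd z"], of 8] by linarith
    qed
    also have "\<dots> \<le> ennreal (E n)" by (rule bd)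
    also have "\<dots> \<le> ennreal B" by (intro ennreal_leI B)
    finally show ?thesis .
  qed
  have "tight \<mu>"
    unfolding tight_def
  proof (intro conjI allI impI mu.real_distribution_axioms)
    fix \<delta> :: real assume d: "\<delta> > 0"
    \<comment> \<open>Chosen so that Markov's inequality with the moment bound \<open>B\<close>
      leaves mass at most \<delta>/2 outside the interval.\<close>
    define K where "K = sqrt (8 * (2 * B / \<delta>)) "
    have K: "K > 0" "K\<^sup>2 / 8 = 2 * B / \<delta>" using B d by (auto simp: K_def)
    show "\<exists>a b. a < b \<and> (\<forall>n. 1 - \<delta> < measure (\<mu> n) {a<..b})"
    proof (rule exI[of _ "-K"], rule exI[of _ K], intro conjI allI)
      show "-K < K" using K by simp
      fix n
      have "emeasure (\<mu> n) {x\<in>space (\<mu> n). 1 \<le> ennreal (1 / (2 * B / \<delta>)) * ennreal (x\<^sup>2 / 8)}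
        \<le> ennreal (1 / (2 * B / \<delta>)) * (\<integral>\<^sup>+ x. ennreal (x\<^sup>2 / 8) * indicator UNIV x \<partial>\<mu> n)"
        using nn_integral_Markov_inequality[of "\<lambda>x. ennreal (x\<^sup>2 / 8)" UNIV "\<mu> n" "ennreal (1 / (2 * B / \<delta>))"] by simp
      also have "\<dots> \<le> ennreal (1 / (2 * B / \<delta>)) * ennreal B"
        using moment[of n] by (intro mult_left_mono) auto
      also have "\<dots> = ennreal (\<delta> / 2)" using B d by (subst ennreal_mult[symmetric]) auto
      finally have le: "emeasure (\<mu> n) {x\<in>space (\<mu> n). 1 \<le> ennreal (1 / (2 * B / \<delta>)) * ennreal (x\<^sup>2 / 8)} \<le> ennreal (\<delta> / 2)" .
      have "emeasure (\<mu> n) (- {-K<..K}) \<le> emeasure (\<mu> n) {x\<in>space (\<mu> n). 1 \<le> ennreal (1 / (2 * B / \<delta>)) * ennreal (x\<^sup>2 / 8)}"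
      proof (intro emeasure_mono subsetI)
        fix x assume "x \<in> - {-K<..K}"
        hence "\<bar>K\<bar> \<le> \<bar>x\<bar>" using K by auto
        hence "K\<^sup>2 \<le> x\<^sup>2" using abs_le_square_iff by blast
        hence "2 * B / \<delta> \<le> x\<^sup>2 / 8" using K(2) by linarith
        hence "1 \<le> 1 / (2 * B / \<delta>) * (x\<^sup>2 / 8)" using B d by (simp add: field_simps)
        hence "ennreal 1 \<le> ennreal (1 / (2 * B / \<delta>) * (x\<^sup>2 / 8))" by (rule ennreal_leI)
        also have "\<dots> = ennreal (1 / (2 * B / \<delta>)) * ennreal (x\<^sup>2 / 8)" using B d by (intro ennreal_mult) auto
        finally show "x \<in> {x\<in>space (\<mu> n). 1 \<le> ennreal (1 / (2 * B / \<delta>)) * ennreal (x\<^sup>2 / 8)}" by simp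
      qed simp
      with le have "emeasure (\<mu> n) (- {-K<..K}) \<le> ennreal (\<delta> / 2)" by (rule order_trans[rotated])
      hence "measure (\<mu> n) (- {-K<..K}) \<le> \<delta> / 2" using d by (simp add: mu.emeasure_eq_measure)
      moreover have "measure (\<mu> n) (- {-K<..K}) = 1 - measure (\<mu> n) {-K<..K}"
        using mu.prob_compl[of "{-K<..K}" n] by (simp add: Compl_eq_Diff_UNIV)
      ultimately show "1 - \<delta> < measure (\<mu> n) {-K<..K}" using d by linarith
    qed
  qed
  from tight_imp_convergent_subsubsequence[OF this strict_mono_id]
  obtain r M where r: "strict_mono r" and M: "real_distribution M" and w: "weak_conv_m (\<mu> \<circ> r) M"
    by auto
  \<comment> \<open>Independent copies of the Skorohod variables, taken on the product of \<Omega>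
    with itself, represent the product measures, so convergence holds for both coordinates at every
    point.\<close>
  from Skorohod[OF _ M w] mu.real_distribution_axioms
  obtain \<Omega> :: "real measure" and Ys Y where Om: "prob_space \<Omega>" and [measurable]: "\<And>n. Ys n \<in> borel_measurable \<Omega>"
    "Y \<in> borel_measurable \<Omega>" and Ys: "\<And>n. distr \<Omega> borel (Ys n) = \<mu> (r n)" and Y: "distr \<Omega> borel Y = M"
    and lim: "\<And>x. x \<in> space \<Omega> \<Longrightarrow> (\<lambda>n. Ys n x) \<longlonglongrightarrow> Y x"
    unfolding comp_def measurable_lborel1 measurable_lborel2 by metis
  interpret Om: prob_space \<Omega> by fact
  interpret Om2: pair_prob_space \<Omega> \<Omega> ..
  have "AE w in \<Omega>. \<forall>n. \<sigma> \<le> Ys n w"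
    unfolding AE_all_countable
  proof
    fix n
    have "AE x in distr \<Omega> borel (Ys n). \<sigma> \<le> x" unfolding Ys by (rule prob_on_AE[OF mu])
    thus "AE w in \<Omega>. \<sigma> \<le> Ys n w" by (simp add: AE_distr_iff)
  qed
  hence AEY: "AE w in \<Omega>. \<sigma> \<le> Y w"
  proof (rule AE_mp, intro AE_I2 impI)
    fix w assume "w \<in> space \<Omega>" "\<forall>n. \<sigma> \<le> Ys n w"
    thus "\<sigma> \<le> Y w" using lim[of w] by (intro LIMSEQ_le_const) auto
  qed
  have pM: "prob_on \<sigma> M"
    unfolding Y[symmetric] by (intro prob_on_distr Om AEY) simp
  let ?g = "\<lambda>n z. ennreal (rkern A (\<epsilon> (r n)) (a (r n)) (\<theta> (r n)) (Ys n (fst z)) (Ys n (snd z)))"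
  have "energy A \<alpha> M = (\<integral>\<^sup>+ z. ekern A \<alpha> (Y (fst z)) (Y (snd z)) \<partial>(\<Omega> \<Otimes>\<^sub>M \<Omega>))"
    unfolding energy_def Y[symmetric] by (rule nn_integral_distr_pair[OF Om]) auto
  also have "\<dots> \<le> (\<integral>\<^sup>+ z. liminf (\<lambda>n. ?g n z) \<partial>(\<Omega> \<Otimes>\<^sub>M \<Omega>))"
  proof (rule nn_integral_mono_AE, rule AE_mp, rule AE_pair_both[OF _ _ AEY AEY])
    show "sigma_finite_measure \<Omega>" "sigma_finite_measure \<Omega>" by (rule Om.sigma_finite_measure_axioms)+
    show "AE z in \<Omega> \<Otimes>\<^sub>M \<Omega>. \<sigma> \<le> Y (fst z) \<and> \<sigma> \<le> Y (snd z) \<longrightarrow> ekern A \<alpha> (Y (fst z)) (Y (snd z)) \<le>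
        liminf (\<lambda>n. ?g n z)"
    proof (intro AE_I2 impI)
      fix z assume z: "z \<in> space (\<Omega> \<Otimes>\<^sub>M \<Omega>)" "\<sigma> \<le> Y (fst z) \<and> \<sigma> \<le> Y (snd z)"
      have "(\<lambda>n. f (r n)) \<longlonglongrightarrow> l" if "f \<longlonglongrightarrow> l" for f and l :: real
        using LIMSEQ_subseq_LIMSEQ[OF that r] by (simp add: comp_def)
      thus "ekern A \<alpha> (Y (fst z)) (Y (snd z)) \<le>
        liminf (\<lambda>n. ?g n z)"
        using z e a th by (intro liminf_rkern lim) (auto simp: space_pair_measure)
    qed
  qed
  also have "\<dots> \<le> liminf (\<lambda>n. \<integral>\<^sup>+ z. ?g n z \<partial>(\<Omega> \<Otimes>\<^sub>M \<Omega>))"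
  proof (intro nn_integral_liminf)
    fix n
    show "(\<lambda>z. ?g n z) \<in> borel_measurable (\<Omega> \<Otimes>\<^sub>M \<Omega>)"
      unfolding rkern_def by measurable
  qed
  also have "\<dots> \<le> liminf (\<lambda>n. ennreal (E (r n)))"
  proof (intro Liminf_mono always_eventually allI)
    fix n
    have "(\<integral>\<^sup>+ z. ?g n z \<partial>(\<Omega> \<Otimes>\<^sub>M \<Omega>))
       = (\<integral>\<^sup>+ z. ennreal (rkern A (\<epsilon> (r n)) (a (r n)) (\<theta> (r n)) (fst z) (snd z)) \<partial>(\<mu> (r n) \<Otimes>\<^sub>M \<mu> (r n)))"
      unfolding Ys[symmetric] by (rule nn_integral_distr_pair[OF Om, symmetric]) (auto simp: rkern_def)
    also have "\<dots> \<le> ennreal (E (r n))" by (rule bd)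
    finally show "(\<integral>\<^sup>+ z. ?g n z \<partial>(\<Omega> \<Otimes>\<^sub>M \<Omega>)) \<le> ennreal (E (r n))" .
  qed
  also have "liminf (\<lambda>n. ennreal (E (r n))) = ennreal E0"
    using LIMSEQ_subseq_LIMSEQ[OF E r] by (intro lim_imp_Liminf tendsto_ennrealI) (auto simp: comp_def)
  finally show ?thesis using that r pM w by blast
qed

end

section \<open>Existence and uniqueness of the minimiser\<close>

text \<open>The local singularity of the logarithmic kernel. The value at 0 is set to infinity so
  that it dominates \<open>ekern\<close> on the diagonal, where \<open>ln 0 = 0\<close> would give
  0.\<close>

definition neg_ln :: "real \<Rightarrow> ennreal" where
  "neg_ln u = (if u = 0 then \<infinity> else ennreal (max 0 (- ln \<bar>u\<bar>)))"

lemma neg_ln_measurable [measurable]: "neg_ln \<in> borel_measurable borel"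
  unfolding neg_ln_def by measurable

lemma nn_integral_neg_ln_finite: "(\<integral>\<^sup>+ u. neg_ln u \<partial>lborel) < \<infinity>"
proof -
  define g :: "real \<Rightarrow> real" where "g u = (if u \<in> {0..1} then - ln u else 0)" for u
  have g0: "0 \<le> g u" for u by (cases "u = 0") (auto simp: g_def)
  have [measurable]: "g \<in> borel_measurable borel" unfolding g_def by measurable
  \<comment> \<open>The antiderivative \<open>u - u * ln u\<close> is continuous up to 0 with the
    value that the convention \<open>ln 0 = 0\<close> assigns to it.\<close>
  have "((\<lambda>u::real. - ln u) has_integral ((1 - 1 * ln 1) - (0 - 0 * ln 0))) {0..1}"
  proof (rule fundamental_theorem_of_calculus_interior)
    have "isCont (\<lambda>u::real. u - u * ln u) x" if "x > 0" for x
      using that by (intro continuous_intros) auto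
    moreover have "((\<lambda>u::real. u - u * ln u) \<longlongrightarrow> 0) (at_right 0)" by real_asymp
    moreover have "((\<lambda>u::real. u - u * ln u) \<longlongrightarrow> 1) (at_left 1)" by real_asymp
    ultimately show "continuous_on {0..1} (\<lambda>u::real. u - u * ln u)"
      by (intro continuous_on_IccI) (auto simp: isCont_def)
    show "((\<lambda>u. u - u * ln u) has_vector_derivative - ln x) (at x)" if "x \<in> {0<..<1}" for x :: real
      unfolding has_real_derivative_iff_has_vector_derivative[symmetric]
      using that by (auto intro!: derivative_eq_intros)
  qed auto
  hence "((\<lambda>u::real. - ln u) has_integral 1) {0..1}" by simp
  hence "(g has_integral 1) UNIV" unfolding g_def by (subst has_integral_restrict_UNIV)
  hence g1: "(\<integral>\<^sup>+ u. ennreal (g u) \<partial>lborel) = ennreal 1"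
    by (intro nn_integral_has_integral_lborel g0) auto
  have g2: "(\<integral>\<^sup>+ u. ennreal (g (- u)) \<partial>lborel) = ennreal 1"
    using nn_integral_real_affine[of "\<lambda>u. ennreal (g u)" "-1" 0] g1 by simp
  have "(\<integral>\<^sup>+ u. neg_ln u \<partial>lborel) \<le> (\<integral>\<^sup>+ u. ennreal (g u) + ennreal (g (- u)) \<partial>lborel)"
  proof (rule nn_integral_mono_AE, use AE_lborel_singleton[of 0] in eventually_elim)
    case (elim u)
    hence "max 0 (- ln \<bar>u\<bar>) \<le> g u + g (- u)" by (auto simp: g_def max_def abs_if)
    thus ?case using elim g0 by (simp add: neg_ln_def ennreal_plus[symmetric] ennreal_leI del: ennreal_plus)
  qed
  also have "\<dots> = ennreal 1 + ennreal 1"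
    by (subst nn_integral_add) (simp_all only: g1 g2, measurable)
  also have "\<dots> < \<infinity>" by simp
  finally show ?thesis .
qed

text \<open>A bounded density, expressed through integrals of nonnegative functions: this is the
  form that logarithmic integrals use directly and that passes to product measures one coordinate at
  a time.\<close>

definition dens_bound :: "ennreal \<Rightarrow> real measure \<Rightarrow> bool" where
  "dens_bound \<kappa> \<rho> \<longleftrightarrow> (\<forall>f \<in> borel_measurable borel. (\<integral>\<^sup>+ x. f x \<partial>\<rho>) \<le> \<kappa> * (\<integral>\<^sup>+ x. f x \<partial>lborel))"

lemma dens_boundD:
  "dens_bound \<kappa> \<rho> \<Longrightarrow> f \<in> borel_measurable borel \<Longrightarrow> (\<integral>\<^sup>+ x. f x \<partial>\<rho>) \<le> \<kappa> * (\<integral>\<^sup>+ x. f x \<partial>lborel)"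
  by (auto simp: dens_bound_def)

text \<open>Lebesgue measure is invariant under reflection and translation, so the bound does not
  depend on the point \<open>x\<close>; this uniformity makes the double integral finite.\<close>

lemma dens_bound_neg_ln:
  assumes "dens_bound \<kappa> \<rho>" "\<kappa> < \<infinity>"
  shows "(\<integral>\<^sup>+ y. neg_ln (x - y) \<partial>\<rho>) \<le> \<kappa> * (\<integral>\<^sup>+ u. neg_ln u \<partial>lborel)"
proof -
  have "(\<integral>\<^sup>+ y. neg_ln (x - y) \<partial>\<rho>) \<le> \<kappa> * (\<integral>\<^sup>+ y. neg_ln (x - y) \<partial>lborel)"
    by (rule dens_boundD[OF assms(1)]) measurable
  also have "(\<integral>\<^sup>+ y. neg_ln (x - y) \<partial>lborel) = (\<integral>\<^sup>+ u. neg_ln u \<partial>lborel)"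
    using nn_integral_real_affine[of neg_ln "-1" x] by simp
  finally show ?thesis .
qed

lemma dens_bound_uniform:
  assumes "c < d"
  shows "dens_bound (1 / ennreal (d - c)) (uniform_measure lborel {c..d})"
  unfolding dens_bound_def
proof
  fix f :: "real \<Rightarrow> ennreal" assume [measurable]: "f \<in> borel_measurable borel"
  have "(\<integral>\<^sup>+ x. f x \<partial>uniform_measure lborel {c..d}) = (\<integral>\<^sup>+ x. f x * indicator {c..d} x \<partial>lborel) / ennreal (d - c)"
    using assms by (subst nn_integral_uniform_measure) auto
  also have "\<dots> \<le> (\<integral>\<^sup>+ x. f x \<partial>lborel) / ennreal (d - c)"
    by (intro divide_right_mono_ennreal nn_integral_mono) (auto simp: indicator_def)
  finally show "(\<integral>\<^sup>+ x. f x \<partial>uniform_measure lborel {c..d}) \<le> 1 / ennreal (d - c) * (\<integral>\<^sup>+ x. f x \<partial>lborel)"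
    by (simp add: ennreal_divide_times mult.commute divide_ennreal_def)
qed

context gas
begin

lemma ekern_le_neg_ln:
  assumes c: "\<sigma> \<le> c"
  obtains K where "K \<ge> 0" "\<And>x y. x \<in> {c..d} \<Longrightarrow> y \<in> {c..d} \<Longrightarrow> ekern A \<alpha> x y \<le> ennreal K + neg_ln (x - y)"
proof -
  define q where "q x = x\<^sup>2 - \<alpha> * ln (x\<^sup>2)" for x
  have "continuous_on {c..d} q"
  proof (cases "\<alpha> = 0")
    case True
    thus ?thesis unfolding q_def by (auto intro!: continuous_intros)
  next
    case False
    have "x \<noteq> 0" if "x \<in> {c..d}" for x using alpha_0_or_nonzero[of x] that False c by auto
    thus ?thesis unfolding q_def by (auto intro!: continuous_intros)
  qed
  hence "bounded (q ` {c..d})" by (intro compact_imp_bounded compact_continuous_image) auto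
  then obtain B where "\<forall>x\<in>{c..d}. \<bar>q x\<bar> \<le> B" by (auto simp: bounded_iff)
  hence B: "\<bar>q x\<bar> \<le> B" if "x \<in> {c..d}" for x using that by blast
  define K where "K = max 0 (kern_shift A + B)"
  show ?thesis
  proof (rule that[of K])
    fix x y assume xy: "x \<in> {c..d}" "y \<in> {c..d}"
    show "ekern A \<alpha> x y \<le> ennreal K + neg_ln (x - y)"
    proof (cases "x = y")
      case False
      have "ln ((x - y)\<^sup>2) = 2 * ln \<bar>x - y\<bar>" using False by (simp add: ln_square)
      hence "rkern A 0 \<alpha> 1 x y = kern_shift A - ln \<bar>x - y\<bar> + (q x + q y) / 2"
        by (simp add: rkern_def q_def)
      also have "\<dots> \<le> K + M" if "- ln \<bar>x - y\<bar> \<le> M" for M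
      proof -
        have q: "q x \<le> B" "q y \<le> B" using abs_le_D1 B[OF xy(1)] B[OF xy(2)] by blast+
        have K: "kern_shift A + B \<le> K" by (simp add: K_def)
        have "c - l + (a + b) / 2 \<le> K + M" if "a \<le> B" "b \<le> B" "c + B \<le> K" "- l \<le> M" for a b c l
          using that unfolding add_divide_distrib by linarith
        from this[OF q K that] show ?thesis .
      qed
      note this[OF max.cobounded2[of "- ln \<bar>x - y\<bar>" 0]]
      finally have "ennreal (rkern A 0 \<alpha> 1 x y) \<le> ennreal (K + max 0 (- ln \<bar>x - y\<bar>))" by (rule ennreal_leI)
      also have "\<dots> = ennreal K + ennreal (max 0 (- ln \<bar>x - y\<bar>))" by (rule ennreal_plus) (auto simp: K_def)
      finally show ?thesis using False by (simp add: ekern_def neg_ln_def)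
    qed (simp add: neg_ln_def)
  qed (simp add: K_def)
qed

section \<open>Trial measures and the direct method\<close>

lemma energy_finite:
  assumes rho: "prob_on \<sigma> \<rho>" and k: "dens_bound \<kappa> \<rho>" "\<kappa> < \<infinity>" and AE: "AE x in \<rho>. x \<in> {c..d}" and c: "\<sigma> \<le> c"
  shows "energy A \<alpha> \<rho> < \<infinity>"
proof -
  interpret prob_space \<rho> using rho by (simp add: prob_on_def)
  have [measurable_cong]: "sets \<rho> = sets borel" using rho by (simp add: prob_on_def)
  from ekern_le_neg_ln[OF c, of d] obtain K where K: "K \<ge> 0"
    "\<And>x y. x \<in> {c..d} \<Longrightarrow> y \<in> {c..d} \<Longrightarrow> ekern A \<alpha> x y \<le> ennreal K + neg_ln (x - y)" by blast
  have "energy A \<alpha> \<rho> = (\<integral>\<^sup>+ x. \<integral>\<^sup>+ y. ekern A \<alpha> x y \<partial>\<rho> \<partial>\<rho>)"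
    unfolding energy_def by (subst nn_integral_fst[symmetric]) auto
  also have "\<dots> \<le> (\<integral>\<^sup>+ x. ennreal K + \<kappa> * (\<integral>\<^sup>+ u. neg_ln u \<partial>lborel) \<partial>\<rho>)"
  proof (rule nn_integral_mono_AE, use AE in eventually_elim)
    case (elim x)
    have "(\<integral>\<^sup>+ y. ekern A \<alpha> x y \<partial>\<rho>) \<le> (\<integral>\<^sup>+ y. ennreal K + neg_ln (x - y) \<partial>\<rho>)"
      by (rule nn_integral_mono_AE, use AE in eventually_elim, rule K) (use elim in auto)
    also have "\<dots> = ennreal K + (\<integral>\<^sup>+ y. neg_ln (x - y) \<partial>\<rho>)"
      by (subst nn_integral_add) (auto simp: emeasure_space_1)
    also have "\<dots> \<le> ennreal K + \<kappa> * (\<integral>\<^sup>+ u. neg_ln u \<partial>lborel)"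
      by (intro add_left_mono dens_bound_neg_ln k)
    finally show ?case .
  qed
  also have "\<dots> = ennreal K + \<kappa> * (\<integral>\<^sup>+ u. neg_ln u \<partial>lborel)" by (simp add: emeasure_space_1)
  also have "\<dots> < \<infinity>" using k nn_integral_neg_ln_finite by (simp add: ennreal_mult_less_top)
  finally show ?thesis .
qed

text \<open>These laws serve as trial measures: they show that the infimum of the energy is finite,
  and later they probe a gap in the support.\<close>

lemma uniform_prob_on:
  assumes "\<sigma> \<le> c" "c < d"
  shows "prob_on \<sigma> (uniform_measure lborel {c..d})" "energy A \<alpha> (uniform_measure lborel {c..d}) < \<infinity>"
    "AE x in uniform_measure lborel {c..d}. x \<in> {c..d}"
proof -
  show 1: "AE x in uniform_measure lborel {c..d}. x \<in> {c..d}" by (rule AE_uniform_measureI) auto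
  show 2: "prob_on \<sigma> (uniform_measure lborel {c..d})"
  proof (rule prob_onI)
    show "prob_space (uniform_measure lborel {c..d})"
      using assms by (intro prob_space_uniform_measure) auto
    show "AE x in uniform_measure lborel {c..d}. \<sigma> \<le> x"
      using 1 by eventually_elim (use assms in auto)
  qed simp
  show "energy A \<alpha> (uniform_measure lborel {c..d}) < \<infinity>"
    by (rule energy_finite[OF 2 dens_bound_uniform[OF assms(2)] _ 1 assms(1)])
       (use assms in \<open>simp add: ennreal_divide_eq_top_iff less_top[symmetric]\<close>)
qed

lemma rkern_integral_le_energy:
  assumes mu: "prob_on \<sigma> \<mu>"
  shows "(\<integral>\<^sup>+ z. ennreal (rkern A \<epsilon> \<alpha> 1 (fst z) (snd z)) \<partial>(\<mu> \<Otimes>\<^sub>M \<mu>)) \<le> energy A \<alpha> \<mu>"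
proof -
  have sf: "sigma_finite_measure \<mu>" using mu by (simp add: prob_on_def prob_space_imp_sigma_finite)
  show ?thesis
    unfolding energy_def
    by (rule nn_integral_mono_AE, use AE_pair_both[OF sf sf prob_on_AE[OF mu] prob_on_AE[OF mu]] in eventually_elim)
       (auto intro: rkern_le_ekern)
qed

lemma minimizer_exists:
  obtains \<nu> where "prob_on \<sigma> \<nu>" "\<And>\<mu>. prob_on \<sigma> \<mu> \<Longrightarrow> energy A \<alpha> \<nu> \<le> energy A \<alpha> \<mu>" "energy A \<alpha> \<nu> < \<infinity>"
proof -
  define m where "m = (INF \<mu>\<in>{\<mu>. prob_on \<sigma> \<mu>}. energy A \<alpha> \<mu>)"
  have m_le: "m \<le> energy A \<alpha> \<mu>" if "prob_on \<sigma> \<mu>" for \<mu>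
    unfolding m_def using that by (intro INF_lower) auto
  have "m < \<infinity>" using m_le[OF uniform_prob_on(1)[of \<sigma> "\<sigma> + 1"]] uniform_prob_on(2)[of \<sigma> "\<sigma> + 1"] by simp
  then obtain e0 where e0: "m = ennreal e0" "e0 \<ge> 0" by (cases m rule: ennreal_cases) auto
  have "\<exists>\<mu>. prob_on \<sigma> \<mu> \<and> energy A \<alpha> \<mu> \<le> ennreal (e0 + 1 / real (Suc n))" for n
  proof -
    have "m < ennreal (e0 + 1 / real (Suc n))" using e0 by (simp add: ennreal_less_iff)
    thus ?thesis unfolding m_def INF_less_iff by (auto intro: less_imp_le)
  qed
  then obtain \<mu> where mu: "\<And>n. prob_on \<sigma> (\<mu> n)" "\<And>n. energy A \<alpha> (\<mu> n) \<le> ennreal (e0 + 1 / real (Suc n))" by metis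
  have lim: "(\<lambda>n. 1 / real (Suc n)) \<longlonglongrightarrow> 0"
    using LIMSEQ_inverse_real_of_nat by (simp add: inverse_eq_divide)
  have "(\<lambda>n. e0 + 1 / real (Suc n)) \<longlonglongrightarrow> e0 + 0"
    by (intro tendsto_intros lim)
  hence lim2: "(\<lambda>n. e0 + 1 / real (Suc n)) \<longlonglongrightarrow> e0" by simp
  show ?thesis
  \<comment> \<open>The exponent is held at \<alpha>. The artificial regularisation 1/(n+1) is
    harmless, because regularised energies lie below the true ones and inherit the bound of the
    minimising sequence.\<close>
  proof (rule energy_compactness[where \<mu> = \<mu> and \<epsilon> = "\<lambda>n. 1 / real (Suc n)" and a = "\<lambda>_. \<alpha>" and \<theta> = "\<lambda>_. 1", OF mu(1) lim _ _ _ _ _ _ _ _ _ lim2])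
    fix r \<mu>' assume *: "prob_on \<sigma> \<mu>'" "energy A \<alpha> \<mu>' \<le> ennreal e0"
    show ?thesis
    proof (rule that[of \<mu>'])
      show "energy A \<alpha> \<mu>' \<le> energy A \<alpha> \<mu>" if "prob_on \<sigma> \<mu>" for \<mu>
        using * m_le[OF that] e0 by simp
      show "energy A \<alpha> \<mu>' < \<infinity>" using *(2) by (simp add: order_le_less_trans)
    qed fact
  next
    fix n show "(\<integral>\<^sup>+ z. ennreal (rkern A (1 / real (Suc n)) \<alpha> 1 (fst z) (snd z)) \<partial>(\<mu> n \<Otimes>\<^sub>M \<mu> n)) \<le> ennreal (e0 + 1 / real (Suc n))"
      using rkern_integral_le_energy[OF mu(1)[of n]] mu(2)[of n] by (rule order_trans)
  qed (use alpha in auto)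
qed

end

section \<open>Displacement convexity and uniqueness\<close>

lemma ln_square_convex_comb:
  fixes p q s :: real
  assumes pq: "p * q > 0" and s: "0 \<le> s" "s \<le> 1"
  shows "(1 - s) * p + s * q \<noteq> 0" "(1 - s) * ln (p\<^sup>2) + s * ln (q\<^sup>2) \<le> ln (((1 - s) * p + s * q)\<^sup>2)"
proof -
  have ab: "\<bar>p\<bar> > 0" "\<bar>q\<bar> > 0" using pq by auto
  \<comment> \<open>\<open>p\<close> and \<open>q\<close> have the same sign, so the absolute value
    is affine between them and concavity of \<open>ln\<close> on the positive axis applies.\<close>
  have eq: "\<bar>(1 - s) * p + s * q\<bar> = (1 - s) * \<bar>p\<bar> + s * \<bar>q\<bar>"
  proof (cases "p > 0")
    case True
    hence "q > 0" using pq by (simp add: zero_less_mult_iff)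
    thus ?thesis using True s by (simp add: abs_of_nonneg)
  next
    case False
    hence neg: "p < 0" "q < 0" using pq by (auto simp: zero_less_mult_iff)
    hence "(1 - s) * p \<le> 0" "s * q \<le> 0" using s by (auto intro!: mult_nonneg_nonpos)
    thus ?thesis using neg by (simp add: abs_of_nonpos)
  qed
  have pos: "(1 - s) * \<bar>p\<bar> + s * \<bar>q\<bar> > 0"
    using ab s by (cases "s = 0") (auto intro: add_nonneg_pos)
  thus nz: "(1 - s) * p + s * q \<noteq> 0" using eq by auto
  have "(1 - s) * ln \<bar>p\<bar> + s * ln \<bar>q\<bar> \<le> ln ((1 - s) * \<bar>p\<bar> + s * \<bar>q\<bar>)"
    using ln_concave ab s by (auto simp: concave_on_iff)
  moreover have "(1 - s) * ln (p\<^sup>2) + s * ln (q\<^sup>2) = 2 * ((1 - s) * ln \<bar>p\<bar> + s * ln \<bar>q\<bar>)"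
    using ab by (simp add: ln_square algebra_simps)
  moreover have "ln (((1 - s) * p + s * q)\<^sup>2) = 2 * ln ((1 - s) * \<bar>p\<bar> + s * \<bar>q\<bar>)"
    unfolding eq[symmetric] by (rule ln_square[OF nz])
  ultimately show "(1 - s) * ln (p\<^sup>2) + s * ln (q\<^sup>2) \<le> ln (((1 - s) * p + s * q)\<^sup>2)"
    by (simp only: mult_le_cancel_left_pos zero_less_numeral)
qed

context gas
begin

text \<open>Convexity while two particles move linearly without crossing, which is what the sign of
  the product of differences expresses. The logarithms contribute only convexity; the extra term is
  the exact convexity defect of the squares. If the particles coincide at an endpoint, the
  right-hand side is infinite because both weights are positive. It is used with both particles
  moving for uniqueness, and with one at rest for the gap argument.\<close>

lemma ekern_convex:
  assumes ge: "\<sigma> \<le> x0" "\<sigma> \<le> x1" "\<sigma> \<le> y0" "\<sigma> \<le> y1" and mon: "0 \<le> (x0 - y0) * (x1 - y1)" and s: "0 < s" "s < 1"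
  shows "ekern A \<alpha> ((1 - s) * x0 + s * x1) ((1 - s) * y0 + s * y1) + ennreal (s * (1 - s) * ((x0 - x1)\<^sup>2 + (y0 - y1)\<^sup>2) / 2)
     \<le> ennreal (1 - s) * ekern A \<alpha> x0 y0 + ennreal s * ekern A \<alpha> x1 y1"
proof (cases "x0 = y0 \<or> x1 = y1")
  case True
  thus ?thesis using s by (auto simp: ekern_def ennreal_mult_top)
next
  case False
  define x y where "x = (1 - s) * x0 + s * x1" and "y = (1 - s) * y0 + s * y1"
  have m: "(x0 - y0) * (x1 - y1) > 0" using mon False by (simp add: less_le)
  have xy: "x - y = (1 - s) * (x0 - y0) + s * (x1 - y1)" by (simp add: x_def y_def algebra_simps)
  note l = ln_square_convex_comb[OF m less_imp_le[OF s(1)] less_imp_le[OF s(2)], folded xy]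
  have pot: "\<alpha> * ((1 - s) * ln (u0\<^sup>2) + s * ln (u1\<^sup>2)) \<le> \<alpha> * ln (((1 - s) * u0 + s * u1)\<^sup>2)"
    if "\<sigma> \<le> u0" "\<sigma> \<le> u1" for u0 u1
  proof (cases "\<alpha> = 0")
    case False
    hence "\<sigma> > 0" using alpha sigma by simp
    hence "u0 * u1 > 0" using that by simp
    thus ?thesis using s alpha by (intro mult_left_mono ln_square_convex_comb) auto
  qed auto
  have sq: "((1 - s) * u0 + s * u1)\<^sup>2 = (1 - s) * u0\<^sup>2 + s * u1\<^sup>2 - s * (1 - s) * (u0 - u1)\<^sup>2" for u0 u1
    by (simp add: power2_eq_square algebra_simps)
  define q where "q u = u\<^sup>2 - \<alpha> * ln (u\<^sup>2)" for u
  have q: "q ((1 - s) * u0 + s * u1) + s * (1 - s) * (u0 - u1)\<^sup>2 \<le> (1 - s) * q u0 + s * q u1"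
    if "\<sigma> \<le> u0" "\<sigma> \<le> u1" for u0 u1
  proof -
    have "(1 - s) * q u0 + s * q u1 = (1 - s) * u0\<^sup>2 + s * u1\<^sup>2 - \<alpha> * ((1 - s) * ln (u0\<^sup>2) + s * ln (u1\<^sup>2))"
      by (simp add: q_def algebra_simps)
    thus ?thesis using pot[OF that] sq[of u0 u1] unfolding q_def[of "(1 - s) * u0 + s * u1"] by linarith
  qed
  have rk: "rkern A 0 \<alpha> 1 u v = kern_shift A - ln ((u - v)\<^sup>2) / 2 + (q u + q v) / 2" for u v
    by (simp add: rkern_def q_def)
  have E1: "(1 - s) * rkern A 0 \<alpha> 1 x0 y0 + s * rkern A 0 \<alpha> 1 x1 y1
    = kern_shift A - ((1 - s) * ln ((x0 - y0)\<^sup>2) + s * ln ((x1 - y1)\<^sup>2)) / 2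
      + (((1 - s) * q x0 + s * q x1) + ((1 - s) * q y0 + s * q y1)) / 2"
    unfolding rk by (simp add: field_simps)
  have E2: "s * (1 - s) * ((x0 - x1)\<^sup>2 + (y0 - y1)\<^sup>2) / 2 = (s * (1 - s) * (x0 - x1)\<^sup>2 + s * (1 - s) * (y0 - y1)\<^sup>2) / 2"
    by (simp add: distrib_left)
  have lin: "C - L / 2 + (a + b) / 2 + T \<le> R"
    if "R = C - L' / 2 + (a' + b') / 2" "T = (t1 + t2) / 2" "L' \<le> L" "a + t1 \<le> a'" "b + t2 \<le> b'"
    for C L L' a b a' b' R T t1 t2 :: real
    using that unfolding add_divide_distrib by linarith
  have "rkern A 0 \<alpha> 1 x y + s * (1 - s) * ((x0 - x1)\<^sup>2 + (y0 - y1)\<^sup>2) / 2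
      \<le> (1 - s) * rkern A 0 \<alpha> 1 x0 y0 + s * rkern A 0 \<alpha> 1 x1 y1"
    unfolding rk[of x y] by (rule lin[OF E1 E2 l(2) q[OF ge(1,2), folded x_def] q[OF ge(3,4), folded y_def]])
  moreover have "rkern A 0 \<alpha> 1 u v \<ge> 0" if "u \<noteq> v" "\<sigma> \<le> u" "\<sigma> \<le> v" for u v
    using alpha alpha_0_or_nonzero[OF that(2)] alpha_0_or_nonzero[OF that(3)] that(1) by (intro rkern_nonneg) auto
  moreover have "\<sigma> \<le> (1 - s) * u + s * v" if "\<sigma> \<le> u" "\<sigma> \<le> v" for u v
  proof -
    have "(1 - s) * \<sigma> + s * \<sigma> \<le> (1 - s) * u + s * v"
      using s that by (intro add_mono mult_left_mono) auto
    thus ?thesis by (simp add: left_diff_distrib)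
  qed
  moreover have "x \<noteq> y" using l(1) s by auto
  ultimately show ?thesis
    using False s ge unfolding ekern_def x_def[symmetric] y_def[symmetric]
    by (simp add: ennreal_mult[symmetric] ennreal_plus[symmetric] ennreal_leI x_def y_def del: ennreal_plus)
qed

end

abbreviation unit_lborel :: "real measure" where
  "unit_lborel \<equiv> restrict_space lborel {0<..<1}"

text \<open>Increasing functions on one common space order every pair of particles alike for all the
  measures involved, so pairs do not cross when the measures are interpolated.\<close>

lemma quantile_function:
  assumes "real_distribution \<mu>"
  obtains Y :: "real \<Rightarrow> real" where "mono_on {0<..<1} Y" "Y \<in> borel_measurable unit_lborel"
    "distr unit_lborel borel Y = \<mu>"
proof -
  interpret cdf_distribution \<mu> using assms by (simp add: cdf_distribution_def)
  have "I \<in> borel_measurable unit_lborel"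
    using measurable_CI by (simp cong: measurable_cong_sets sets_restrict_space_cong)
  thus ?thesis using that[of "\<lambda>\<omega>. Inf {x. \<omega> \<le> cdf \<mu> x}"] mono_I distr_I_eq_M by blast
qed

lemma prob_space_unit: "prob_space unit_lborel"
  by (auto simp: space_restrict_space emeasure_restrict_space intro!: prob_spaceI)

context gas
begin

lemma minimizer_unique:
  assumes mu: "prob_on \<sigma> \<mu>0" "prob_on \<sigma> \<mu>1" and E: "energy A \<alpha> \<mu>0 \<le> E" "energy A \<alpha> \<mu>1 \<le> E" "E < \<infinity>"
    and min: "\<And>\<mu>. prob_on \<sigma> \<mu> \<Longrightarrow> E \<le> energy A \<alpha> \<mu>"
  shows "\<mu>0 = \<mu>1"
proof -
  define \<Omega> :: "real measure" where "\<Omega> = unit_lborel"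
  interpret prob_space \<Omega> unfolding \<Omega>_def by (rule prob_space_unit)
  note sf = sigma_finite_measure_axioms and ps = prob_space_axioms
  from quantile_function[OF prob_on_real_distribution[OF mu(1)]]
  obtain Y0 where Y0: "mono_on {0<..<1} Y0" and [measurable]: "Y0 \<in> borel_measurable \<Omega>" and d0: "distr \<Omega> borel Y0 = \<mu>0"
    unfolding \<Omega>_def by metis
  from quantile_function[OF prob_on_real_distribution[OF mu(2)]]
  obtain Y1 where Y1: "mono_on {0<..<1} Y1" and [measurable]: "Y1 \<in> borel_measurable \<Omega>" and d1: "distr \<Omega> borel Y1 = \<mu>1"
    unfolding \<Omega>_def by metis
  have "AE x in distr \<Omega> borel Y0. \<sigma> \<le> x" unfolding d0 by (rule prob_on_AE[OF mu(1)])
  hence AE0: "AE w in \<Omega>. \<sigma> \<le> Y0 w" by (rule AE_distrD[rotated]) simp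
  have "AE x in distr \<Omega> borel Y1. \<sigma> \<le> x" unfolding d1 by (rule prob_on_AE[OF mu(2)])
  hence AE1: "AE w in \<Omega>. \<sigma> \<le> Y1 w" by (rule AE_distrD[rotated]) simp
  have AE01: "AE w in \<Omega>. \<sigma> \<le> Y0 w \<and> \<sigma> \<le> Y1 w" using AE0 AE1 by eventually_elim auto
  define Y where "Y w = (1 - 1/2) * Y0 w + 1/2 * Y1 w" for w
  have [measurable]: "Y \<in> borel_measurable \<Omega>" unfolding Y_def by measurable
  have pY: "prob_on \<sigma> (distr \<Omega> borel Y)"
    by (rule prob_on_distr[OF ps]) (simp, use AE01 in eventually_elim, simp add: Y_def)
  \<comment> \<open>The convexity defect at s = 1/2, where s (1 - s) / 2 = 1/8. Only the
    contribution of the first particle is kept, which already forces the two quantile functions to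
    agree.\<close>
  define D where "D w = (Y0 w - Y1 w)\<^sup>2 / 8" for w
  have [measurable]: "D \<in> borel_measurable \<Omega>" unfolding D_def by measurable
  have D0: "D w \<ge> 0" for w by (simp add: D_def)
  have energies: "energy A \<alpha> (distr \<Omega> borel Z) = (\<integral>\<^sup>+ z. ekern A \<alpha> (Z (fst z)) (Z (snd z)) \<partial>(\<Omega> \<Otimes>\<^sub>M \<Omega>))"
    if [measurable]: "Z \<in> borel_measurable \<Omega>" for Z
    unfolding energy_def by (rule nn_integral_distr_pair[OF ps]) auto
  have [measurable]: "(\<lambda>z. ekern A \<alpha> (Z (fst z)) (Z (snd z))) \<in> borel_measurable (\<Omega> \<Otimes>\<^sub>M \<Omega>)"
    if [measurable]: "Z \<in> borel_measurable \<Omega>" for Z unfolding ekern_def rkern_def by measurable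
  have "ennreal (1 / 2) + ennreal (1 / 2) = ennreal (1 / 2 + 1 / 2)" by (rule ennreal_plus[symmetric]) auto
  hence half: "ennreal (1 / 2) + ennreal (1 / 2) = 1" by (simp only: field_sum_of_halves ennreal_1)
  have "E + (\<integral>\<^sup>+ w. ennreal (D w) \<partial>\<Omega>) \<le> energy A \<alpha> (distr \<Omega> borel Y) + (\<integral>\<^sup>+ w. ennreal (D w) \<partial>\<Omega>)"
    by (intro add_right_mono min pY)
  also have "\<dots> = (\<integral>\<^sup>+ z. ekern A \<alpha> (Y (fst z)) (Y (snd z)) + ennreal (D (fst z)) \<partial>(\<Omega> \<Otimes>\<^sub>M \<Omega>))"
    by (subst nn_integral_add) (auto simp: energies nn_integral_pair_fst[OF sf ps, of "\<lambda>w. ennreal (D w)"])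
  also have "\<dots> \<le> (\<integral>\<^sup>+ z. ennreal (1/2) * ekern A \<alpha> (Y0 (fst z)) (Y0 (snd z)) + ennreal (1/2) * ekern A \<alpha> (Y1 (fst z)) (Y1 (snd z)) \<partial>(\<Omega> \<Otimes>\<^sub>M \<Omega>))"
  proof (rule nn_integral_mono_AE, rule AE_mp, rule AE_pair_both[OF sf sf AE01 AE01], intro AE_I2 impI)
    fix z assume z: "z \<in> space (\<Omega> \<Otimes>\<^sub>M \<Omega>)"
      and ge: "(\<sigma> \<le> Y0 (fst z) \<and> \<sigma> \<le> Y1 (fst z)) \<and> (\<sigma> \<le> Y0 (snd z) \<and> \<sigma> \<le> Y1 (snd z))"
    obtain u v where uv: "z = (u, v)" by (cases z)
    have "u \<in> {0<..<1}" "v \<in> {0<..<1}" using z by (auto simp: uv space_pair_measure \<Omega>_def space_restrict_space)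
    \<comment> \<open>Both quantile functions increase, so the two differences have the same sign
      whichever of \<open>u\<close> and \<open>v\<close> is larger.\<close>
    hence "(Y0 u \<le> Y0 v \<and> Y1 u \<le> Y1 v) \<or> (Y0 v \<le> Y0 u \<and> Y1 v \<le> Y1 u)"
      using mono_onD[OF Y0, of u v] mono_onD[OF Y0, of v u] mono_onD[OF Y1, of u v] mono_onD[OF Y1, of v u] by linarith
    hence "0 \<le> (Y0 u - Y0 v) * (Y1 u - Y1 v)"
      by (auto intro: mult_nonpos_nonpos)
    hence k1: "ekern A \<alpha> (Y u) (Y v) + ennreal (1/2 * (1 - 1/2) * ((Y0 u - Y1 u)\<^sup>2 + (Y0 v - Y1 v)\<^sup>2) / 2)
      \<le> ennreal (1 - 1/2) * ekern A \<alpha> (Y0 u) (Y0 v) + ennreal (1/2) * ekern A \<alpha> (Y1 u) (Y1 v)"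
      unfolding Y_def using ge by (intro ekern_convex) (auto simp: uv)
    have k2: "ekern A \<alpha> (Y u) (Y v) + ennreal (D u)
      \<le> ekern A \<alpha> (Y u) (Y v) + ennreal (1/2 * (1 - 1/2) * ((Y0 u - Y1 u)\<^sup>2 + (Y0 v - Y1 v)\<^sup>2) / 2)"
      by (intro add_left_mono ennreal_leI) (simp add: D_def)
    have k3: "ennreal (1 - 1/2) = ennreal (1/2)" by (rule arg_cong[of _ _ ennreal]) simp
    show "ekern A \<alpha> (Y (fst z)) (Y (snd z)) + ennreal (D (fst z)) \<le>
      ennreal (1/2) * ekern A \<alpha> (Y0 (fst z)) (Y0 (snd z)) + ennreal (1/2) * ekern A \<alpha> (Y1 (fst z)) (Y1 (snd z))"
      unfolding uv fst_conv snd_conv using order_trans[OF k2 k1] unfolding k3 .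
  qed
  also have "\<dots> = ennreal (1/2) * energy A \<alpha> \<mu>0 + ennreal (1/2) * energy A \<alpha> \<mu>1"
    unfolding d0[symmetric] d1[symmetric] by (simp add: nn_integral_add nn_integral_cmult energies)
  also have "\<dots> \<le> ennreal (1/2) * E + ennreal (1/2) * E"
    by (intro add_mono mult_left_mono E) auto
  also have "\<dots> = E" unfolding distrib_right[symmetric] half by simp
  finally have "E + (\<integral>\<^sup>+ w. ennreal (D w) \<partial>\<Omega>) \<le> E + 0" by simp
  \<comment> \<open>Finiteness of \<open>E\<close> allows it to be cancelled in
    \<open>ennreal\<close>.\<close>
  hence "(\<integral>\<^sup>+ w. ennreal (D w) \<partial>\<Omega>) = 0"
    using E(3) by (subst (asm) ennreal_add_left_cancel_le) auto
  hence "AE w in \<Omega>. ennreal (D w) = 0" by (subst (asm) nn_integral_0_iff_AE) auto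
  hence "AE w in \<Omega>. Y0 w = Y1 w" by eventually_elim (simp add: D_def ennreal_eq_0_iff)
  thus ?thesis unfolding d0[symmetric] d1[symmetric] by (intro distr_cong_AE) auto
qed

end

section \<open>Potential and support of the minimiser\<close>

text \<open>The convex combination with weight \<open>t\<close> on \<tau> and 1 - t on \<mu>,
  realised by a coin toss so that integrals follow from the rule for \<open>bind\<close>.\<close>

definition mixture :: "real \<Rightarrow> real measure \<Rightarrow> real measure \<Rightarrow> real measure" where
  "mixture t \<mu> \<tau> = measure_pmf (bernoulli_pmf t) \<bind> (\<lambda>b. if b then \<tau> else \<mu>)"

lemma mixture:
  assumes t: "0 \<le> t" "t \<le> 1" and mu: "prob_on \<sigma> \<mu>" and tau: "prob_on \<sigma> \<tau>"
  shows nn_integral_mixture: "f \<in> borel_measurable borel \<Longrightarrow>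
      (\<integral>\<^sup>+ x. f x \<partial>mixture t \<mu> \<tau>) = ennreal t * (\<integral>\<^sup>+ x. f x \<partial>\<tau>) + ennreal (1 - t) * (\<integral>\<^sup>+ x. f x \<partial>\<mu>)"
    and prob_on_mixture: "prob_on \<sigma> (mixture t \<mu> \<tau>)"
proof -
  interpret mu: prob_space \<mu> using mu by (simp add: prob_on_def)
  interpret tau: prob_space \<tau> using tau by (simp add: prob_on_def)
  have s: "sets \<mu> = sets borel" "sets \<tau> = sets borel" using mu tau by (auto simp: prob_on_def)
  have N: "(\<lambda>b. if b then \<tau> else \<mu>) \<in> measurable (measure_pmf (bernoulli_pmf t)) (subprob_algebra borel)"
    using s mu.subprob_space_axioms tau.subprob_space_axioms
    by (simp add: measurable_pmf_measure1 space_subprob_algebra)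
  show int: "(\<integral>\<^sup>+ x. f x \<partial>mixture t \<mu> \<tau>) = ennreal t * (\<integral>\<^sup>+ x. f x \<partial>\<tau>) + ennreal (1 - t) * (\<integral>\<^sup>+ x. f x \<partial>\<mu>)"
    if "f \<in> borel_measurable borel" for f
    unfolding mixture_def by (subst nn_integral_bind[OF that N]) (use t in \<open>simp add: mult.commute\<close>)
  have sm: "sets (mixture t \<mu> \<tau>) = sets borel"
    unfolding mixture_def by (rule sets_bind) (auto simp: s)
  have em: "emeasure (mixture t \<mu> \<tau>) B = ennreal t * emeasure \<tau> B + ennreal (1 - t) * emeasure \<mu> B" if "B \<in> sets borel" for B
    using int[of "indicator B"] that sm s by simp
  have "ennreal t + ennreal (1 - t) = ennreal (t + (1 - t))"
    by (rule ennreal_plus[symmetric]) (use t in auto)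
  hence one: "ennreal t * 1 + ennreal (1 - t) * 1 = 1" by simp
  have "space (mixture t \<mu> \<tau>) = UNIV" using sets_eq_imp_space_eq[OF sm] by simp
  moreover have "emeasure \<mu> UNIV = 1" "emeasure \<tau> UNIV = 1"
    using mu.emeasure_space_1 tau.emeasure_space_1 sets_eq_imp_space_eq[OF s(1)] sets_eq_imp_space_eq[OF s(2)] by auto
  ultimately have "prob_space (mixture t \<mu> \<tau>)"
    using em[of UNIV] one by (intro prob_spaceI) simp
  thus "prob_on \<sigma> (mixture t \<mu> \<tau>)"
    unfolding prob_on_def using sm em[of "Sig \<sigma>"] mu tau one by (simp add: prob_on_def Sig_def)
qed

lemma ekern_measurable_snd [measurable]: "ekern A \<alpha> x \<in> borel_measurable borel"
  unfolding ekern_def[abs_def] rkern_def by measurable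

text \<open>First-order condition at t = 0: the right-hand side takes the value \<open>E\<close>
  there and has derivative 2 (J - E), which cannot be negative.\<close>

lemma quadratic_perturbation:
  fixes E J S :: real
  assumes *: "\<And>t. 0 < t \<Longrightarrow> t < 1 \<Longrightarrow> E \<le> t\<^sup>2 * S + 2 * t * (1 - t) * J + (1 - t)\<^sup>2 * E"
  shows "E \<le> J"
proof -
  have "2 * E \<le> 2 * J"
  proof (rule tendsto_le[of "at_right (0::real)"])
    show "((\<lambda>t. E * (2 - t)) \<longlongrightarrow> 2 * E) (at_right 0)" by (auto intro!: tendsto_eq_intros)
    show "((\<lambda>t. t * S + 2 * (1 - t) * J) \<longlongrightarrow> 2 * J) (at_right 0)" by (auto intro!: tendsto_eq_intros)
    have "\<forall>\<^sub>F t in at_right (0::real). 0 < t \<and> t < 1"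
      using eventually_at_right_real[of 0 1] by (auto elim!: eventually_mono)
    thus "\<forall>\<^sub>F t in at_right 0. E * (2 - t) \<le> t * S + 2 * (1 - t) * J"
    proof eventually_elim
      case (elim t)
      have "t * (E * (2 - t)) = E - (1 - t)\<^sup>2 * E" by (simp add: power2_eq_square algebra_simps)
      also have "\<dots> \<le> t\<^sup>2 * S + 2 * t * (1 - t) * J" using *[of t] elim by simp
      also have "\<dots> = t * (t * S + 2 * (1 - t) * J)" by (simp add: power2_eq_square algebra_simps)
      finally show ?case using elim by simp
    qed
  qed simp
  thus ?thesis by simp
qed

locale gas_minimizer = gas +
  fixes \<nu> :: "real measure"
  assumes nu: "prob_on \<sigma> \<nu>"
    and minimal: "\<And>\<mu>. prob_on \<sigma> \<mu> \<Longrightarrow> energy A \<alpha> \<nu> \<le> energy A \<alpha> \<mu>"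
    and finite_energy: "energy A \<alpha> \<nu> < \<infinity>"
begin

text \<open>Since \<open>ekern\<close> carries half of the external field at each argument, this
  averages over \<nu> to the energy itself. The Euler-Lagrange constant is therefore
  \<open>min_energy\<close>, with no separate field term.\<close>

definition potential :: "real \<Rightarrow> ennreal" where
  "potential x = (\<integral>\<^sup>+ y. ekern A \<alpha> x y \<partial>\<nu>)"

definition min_energy :: real where "min_energy = enn2real (energy A \<alpha> \<nu>)"

lemma energy_nu: "energy A \<alpha> \<nu> = ennreal min_energy"
  using finite_energy by (simp add: min_energy_def less_top)

lemma min_energy_nonneg: "min_energy \<ge> 0"
  by (simp add: min_energy_def)

sublocale nu: prob_space \<nu>
  using nu by (simp add: prob_on_def)

lemma sets_nu [measurable_cong]: "sets \<nu> = sets borel"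
  using nu by (simp add: prob_on_def)

lemma space_nu: "space \<nu> = UNIV"
  using sets_eq_imp_space_eq[OF sets_nu] by simp

lemma AE_nu: "AE x in \<nu>. \<sigma> \<le> x"
  by (rule prob_on_AE[OF nu])

lemma potential_measurable [measurable]: "potential \<in> borel_measurable borel"
  unfolding potential_def by measurable

lemma nn_integral_ekern_fst:
  assumes mu: "prob_on \<sigma> \<mu>"
  shows "energy A \<alpha> \<mu> = (\<integral>\<^sup>+ x. \<integral>\<^sup>+ y. ekern A \<alpha> x y \<partial>\<mu> \<partial>\<mu>)"
proof -
  interpret prob_space \<mu> using mu by (simp add: prob_on_def)
  have [measurable_cong]: "sets \<mu> = sets borel" using mu by (simp add: prob_on_def)
  show ?thesis unfolding energy_def by (subst nn_integral_fst[symmetric]) auto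
qed

lemma nn_integral_potential: "(\<integral>\<^sup>+ x. potential x \<partial>\<nu>) = ennreal min_energy"
  unfolding potential_def nn_integral_ekern_fst[OF nu, symmetric] by (rule energy_nu)

text \<open>Along the mixture of \<nu> with \<tau> the energy is a quadratic polynomial in the
  weight, whose mixed coefficient is the integral of the potential against \<tau>. Finite energy of
  \<tau> makes the polynomial real, and minimality at weight 0 gives the bound.\<close>

lemma potential_test:
  assumes tau: "prob_on \<sigma> \<tau>" and fin: "energy A \<alpha> \<tau> < \<infinity>"
  shows "ennreal min_energy \<le> (\<integral>\<^sup>+ x. potential x \<partial>\<tau>)"
proof (cases "(\<integral>\<^sup>+ x. potential x \<partial>\<tau>)" rule: ennreal_cases)
  case (real J)
  interpret tau: prob_space \<tau> using tau by (simp add: prob_on_def)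
  have [measurable_cong]: "sets \<tau> = sets borel" using tau by (simp add: prob_on_def)
  interpret p: pair_sigma_finite \<nu> \<tau> ..
  obtain S where S: "energy A \<alpha> \<tau> = ennreal S" "S \<ge> 0" using fin by (cases "energy A \<alpha> \<tau>" rule: ennreal_cases) auto
  define pt where "pt x = (\<integral>\<^sup>+ y. ekern A \<alpha> x y \<partial>\<tau>)" for x
  have [measurable]: "pt \<in> borel_measurable borel" unfolding pt_def by measurable
  have pt_nu: "(\<integral>\<^sup>+ x. pt x \<partial>\<nu>) = ennreal J"
    unfolding pt_def real(2)[symmetric] potential_def
    by (subst p.Fubini') (auto simp: ekern_commute)
  have pt_tau: "(\<integral>\<^sup>+ x. pt x \<partial>\<tau>) = ennreal S"
    unfolding pt_def nn_integral_ekern_fst[OF tau, symmetric] by (rule S)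
  have "min_energy \<le> J"
  proof (rule quadratic_perturbation)
    fix t :: real assume t: "0 < t" "t < 1"
    note tt = less_imp_le[OF t(1)] less_imp_le[OF t(2)]
    note mi = nn_integral_mixture[OF tt nu tau]
    have "ennreal min_energy \<le> energy A \<alpha> (mixture t \<nu> \<tau>)"
      unfolding energy_nu[symmetric] by (rule minimal[OF prob_on_mixture[OF tt nu tau]])
    also have "\<dots> = (\<integral>\<^sup>+ x. \<integral>\<^sup>+ y. ekern A \<alpha> x y \<partial>mixture t \<nu> \<tau> \<partial>mixture t \<nu> \<tau>)"
      by (rule nn_integral_ekern_fst[OF prob_on_mixture[OF tt nu tau]])
    also have "\<dots> = (\<integral>\<^sup>+ x. ennreal t * pt x + ennreal (1 - t) * potential x \<partial>mixture t \<nu> \<tau>)"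
      unfolding pt_def potential_def by (intro nn_integral_cong mi) measurable
    also have "\<dots> = ennreal t * (\<integral>\<^sup>+ x. ennreal t * pt x + ennreal (1 - t) * potential x \<partial>\<tau>)
       + ennreal (1 - t) * (\<integral>\<^sup>+ x. ennreal t * pt x + ennreal (1 - t) * potential x \<partial>\<nu>)"
      by (rule mi) measurable
    also have "(\<integral>\<^sup>+ x. ennreal t * pt x + ennreal (1 - t) * potential x \<partial>\<tau>) = ennreal (t * S + (1 - t) * J)"
      using S real t by (simp add: nn_integral_add nn_integral_cmult pt_tau ennreal_mult)
    also have "(\<integral>\<^sup>+ x. ennreal t * pt x + ennreal (1 - t) * potential x \<partial>\<nu>) = ennreal (t * J + (1 - t) * min_energy)"
      using S real t by (simp add: nn_integral_add nn_integral_cmult pt_nu nn_integral_potential ennreal_mult min_energy_nonneg)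
    also have "ennreal t * ennreal (t * S + (1 - t) * J) + ennreal (1 - t) * ennreal (t * J + (1 - t) * min_energy)
      = ennreal (t * (t * S + (1 - t) * J) + (1 - t) * (t * J + (1 - t) * min_energy))"
      using S real t min_energy_nonneg by (subst ennreal_plus) (auto simp: ennreal_mult)
    finally have "min_energy \<le> t * (t * S + (1 - t) * J) + (1 - t) * (t * J + (1 - t) * min_energy)"
      using S real t min_energy_nonneg by (subst (asm) ennreal_le_iff) auto
    thus "min_energy \<le> t\<^sup>2 * S + 2 * t * (1 - t) * J + (1 - t)\<^sup>2 * min_energy"
      by (simp add: power2_eq_square algebra_simps)
  qed
  thus ?thesis using real by (simp add: ennreal_leI)
qed simp

lemma nn_integral_less_const:
  assumes "prob_space \<tau>" and [measurable]: "f \<in> borel_measurable \<tau>" and "AE x in \<tau>. f x < ennreal c"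
  shows "(\<integral>\<^sup>+ x. f x \<partial>\<tau>) < ennreal c"
proof -
  interpret prob_space \<tau> by fact
  have "(\<integral>\<^sup>+ x. f x \<partial>\<tau>) \<le> (\<integral>\<^sup>+ x. ennreal c \<partial>\<tau>)"
    by (rule nn_integral_mono_AE, use assms(3) in eventually_elim) simp
  hence "(\<integral>\<^sup>+ x. f x \<partial>\<tau>) \<noteq> \<infinity>" by (auto simp: emeasure_space_1 top_unique)
  moreover have "\<not> (AE x in \<tau>. ennreal c \<le> f x)"
  proof
    assume "AE x in \<tau>. ennreal c \<le> f x"
    with assms(3) have "AE x in \<tau>. False" by eventually_elim auto
    thus False by (simp add: AE_False)
  qed
  ultimately have "(\<integral>\<^sup>+ x. f x \<partial>\<tau>) < (\<integral>\<^sup>+ x. ennreal c \<partial>\<tau>)"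
    by (intro nn_integral_less) (use assms(3) in \<open>auto elim!: eventually_mono\<close>)
  thus ?thesis by (simp add: emeasure_space_1)
qed

text \<open>Otherwise \<nu> could be conditioned on the set where the potential is too small. The
  conditioned measure has density at most \<open>1 / emeasure \<nu> B\<close> with respect to \<nu>,
  hence finite energy, and it contradicts \<open>potential_test\<close>.\<close>

lemma potential_ge_AE: "AE x in \<nu>. ennreal min_energy \<le> potential x"
proof (rule ccontr)
  define B where "B = {x. potential x < ennreal min_energy}"
  have [measurable]: "B \<in> sets borel" unfolding B_def by measurable
  assume "\<not> (AE x in \<nu>. ennreal min_energy \<le> potential x)"
  hence pos: "emeasure \<nu> B \<noteq> 0"
    by (subst (asm) AE_iff_measurable[where N = B]) (auto simp: B_def space_nu not_le)
  define \<tau> where "\<tau> = uniform_measure \<nu> B"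
  have ps: "prob_space \<tau>" unfolding \<tau>_def using pos by (intro prob_space_uniform_measure) auto
  have AEB: "AE x in \<tau>. x \<in> B" unfolding \<tau>_def by (rule AE_uniform_measureI) auto
  have st [measurable_cong]: "sets \<tau> = sets borel" unfolding \<tau>_def by (simp add: sets_nu)
  have tau: "prob_on \<sigma> \<tau>"
    using ps st AE_nu unfolding \<tau>_def by (intro prob_onI AE_uniform_measureI) (auto elim: eventually_mono)
  have le: "(\<integral>\<^sup>+ x. f x \<partial>\<tau>) \<le> (1 / emeasure \<nu> B) * (\<integral>\<^sup>+ x. f x \<partial>\<nu>)" if [measurable]: "f \<in> borel_measurable borel" for f
  proof -
    have "(\<integral>\<^sup>+ x. f x \<partial>\<tau>) = (\<integral>\<^sup>+ x. f x * indicator B x \<partial>\<nu>) / emeasure \<nu> B"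
      unfolding \<tau>_def by (rule nn_integral_uniform_measure) auto
    also have "\<dots> \<le> (\<integral>\<^sup>+ x. f x \<partial>\<nu>) / emeasure \<nu> B"
      by (intro divide_right_mono_ennreal nn_integral_mono) (auto simp: indicator_def)
    finally show ?thesis by (simp add: ennreal_divide_times mult.commute divide_ennreal_def)
  qed
  have "energy A \<alpha> \<tau> = (\<integral>\<^sup>+ x. \<integral>\<^sup>+ y. ekern A \<alpha> x y \<partial>\<tau> \<partial>\<tau>)" by (rule nn_integral_ekern_fst[OF tau])
  also have "\<dots> \<le> (\<integral>\<^sup>+ x. (1 / emeasure \<nu> B) * potential x \<partial>\<tau>)"
    unfolding potential_def by (intro nn_integral_mono le) measurable
  also have "\<dots> = (1 / emeasure \<nu> B) * (\<integral>\<^sup>+ x. potential x \<partial>\<tau>)"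
    by (rule nn_integral_cmult) measurable
  also have "\<dots> \<le> (1 / emeasure \<nu> B) * ((1 / emeasure \<nu> B) * ennreal min_energy)"
    using le[of potential] by (intro mult_left_mono) (auto simp: nn_integral_potential)
  also have "\<dots> < \<infinity>"
  proof -
    have "nu.prob B > 0" using pos by (simp add: nu.emeasure_eq_measure zero_less_measure_iff)
    hence "1 / emeasure \<nu> B = ennreal (1 / nu.prob B)"
      unfolding nu.emeasure_eq_measure using divide_ennreal[of 1 "nu.prob B"] by simp
    thus ?thesis by (simp add: ennreal_mult_less_top)
  qed
  finally have "ennreal min_energy \<le> (\<integral>\<^sup>+ x. potential x \<partial>\<tau>)" by (rule potential_test[OF tau])
  moreover have "(\<integral>\<^sup>+ x. potential x \<partial>\<tau>) < ennreal min_energy"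
    by (rule nn_integral_less_const[OF ps]) (use AEB in \<open>auto simp: B_def\<close>)
  ultimately show False by simp
qed

text \<open>The potential is at least its own average almost everywhere, so it cannot exceed that
  average on a set of positive mass.\<close>

lemma potential_le_AE: "AE x in \<nu>. potential x \<le> ennreal min_energy"
proof (rule ccontr)
  assume "\<not> (AE x in \<nu>. potential x \<le> ennreal min_energy)"
  hence "(\<integral>\<^sup>+ x. ennreal min_energy \<partial>\<nu>) < (\<integral>\<^sup>+ x. potential x \<partial>\<nu>)"
    by (intro nn_integral_less potential_ge_AE) (auto simp: nu.emeasure_space_1)
  thus False by (simp add: nn_integral_potential nu.emeasure_space_1)
qed

text \<open>Every ball around a support point has positive mass and so contains a point where the
  almost sure bounds hold. Lower semicontinuity, obtained from the regularised kernels and Fatou,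
  carries the bound to the support point itself; the gap argument needs it at the two endpoints of
  the gap.\<close>

lemma msupport_potential:
  assumes "x \<in> msupport \<nu>"
  shows "\<sigma> \<le> x" "potential x \<le> ennreal min_energy"
proof -
  have "\<exists>u. u \<in> ball x (1 / real (Suc n)) \<and> \<sigma> \<le> u \<and> potential u \<le> ennreal min_energy" for n
  proof (rule ccontr)
    assume *: "\<not> ?thesis"
    have "AE u in \<nu>. u \<notin> ball x (1 / real (Suc n))"
      using AE_nu potential_le_AE by eventually_elim (use * in blast)
    hence "emeasure \<nu> (ball x (1 / real (Suc n))) = 0"
      by (subst (asm) AE_iff_measurable[where N = "ball x (1 / real (Suc n))"]) (auto simp: space_nu sets_nu)
    thus False using assms by (simp add: msupport_def) (metis less_irrefl of_nat_0_less_iff zero_less_Suc zero_less_divide_1_iff of_nat_Suc)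
  qed
  then obtain u where u: "\<And>n. u n \<in> ball x (1 / real (Suc n))" "\<And>n. \<sigma> \<le> u n" "\<And>n. potential (u n) \<le> ennreal min_energy"
    by metis
  have lim0: "(\<lambda>n. 1 / real (Suc n)) \<longlonglongrightarrow> 0"
    using LIMSEQ_inverse_real_of_nat by (simp add: inverse_eq_divide)
  have "(\<lambda>n. dist (u n) x) \<longlonglongrightarrow> 0"
    by (rule tendsto_sandwich[OF _ _ tendsto_const lim0]) (use u(1) in \<open>auto simp: dist_commute less_imp_le\<close>)
  hence lim: "u \<longlonglongrightarrow> x" by (simp add: tendsto_dist_iff[symmetric])
  show ge: "\<sigma> \<le> x" using lim u(2) by (intro LIMSEQ_le_const) auto
  have "potential x \<le> (\<integral>\<^sup>+ y. liminf (\<lambda>n. ennreal (rkern A (1 / real (Suc n)) \<alpha> 1 (u n) y)) \<partial>\<nu>)"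
    unfolding potential_def
    by (rule nn_integral_mono_AE, use AE_nu in eventually_elim, rule liminf_rkern)
       (use lim lim0 ge alpha in auto)
  also have "\<dots> \<le> liminf (\<lambda>n. \<integral>\<^sup>+ y. ennreal (rkern A (1 / real (Suc n)) \<alpha> 1 (u n) y) \<partial>\<nu>)"
    by (rule nn_integral_liminf) (auto simp: rkern_def)
  also have "\<dots> \<le> liminf (\<lambda>n. ennreal min_energy)"
  proof (intro Liminf_mono always_eventually allI)
    fix n
    have "(\<integral>\<^sup>+ y. ennreal (rkern A (1 / real (Suc n)) \<alpha> 1 (u n) y) \<partial>\<nu>) \<le> potential (u n)"
      unfolding potential_def by (rule nn_integral_mono_AE, use AE_nu in eventually_elim) (rule rkern_le_ekern[OF u(2)])
    thus "(\<integral>\<^sup>+ y. ennreal (rkern A (1 / real (Suc n)) \<alpha> 1 (u n) y) \<partial>\<nu>) \<le> ennreal min_energy"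
      using u(3)[of n] by (rule order_trans)
  qed
  also have "\<dots> = ennreal min_energy" by (simp add: Liminf_const)
  finally show "potential x \<le> ennreal min_energy" .
qed

section \<open>Geometry of the support\<close>

lemma bounded_msupport: "bounded (msupport \<nu>)"
proof -
  have "\<bar>x\<bar> \<le> sqrt (8 * min_energy)" if x: "x \<in> msupport \<nu>" for x
  proof -
    have "ennreal (x\<^sup>2 / 8) = (\<integral>\<^sup>+ y. ennreal (x\<^sup>2 / 8) \<partial>\<nu>)" by (simp add: nu.emeasure_space_1)
    also have "\<dots> \<le> potential x"
      unfolding potential_def
    proof (rule nn_integral_mono_AE, use AE_nu in eventually_elim)
      case (elim y)
      have "ennreal (x\<^sup>2 / 8) \<le> ennreal ((x\<^sup>2 + y\<^sup>2) / 8)" by (intro ennreal_leI) simp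
      also have "\<dots> \<le> ekern A \<alpha> x y" by (rule ekern_lower[OF msupport_potential(1)[OF x] elim])
      finally show ?case .
    qed
    also have "\<dots> \<le> ennreal min_energy" by (rule msupport_potential[OF x])
    finally have "x\<^sup>2 \<le> 8 * min_energy" using min_energy_nonneg by (subst (asm) ennreal_le_iff) auto
    hence "sqrt (x\<^sup>2) \<le> sqrt (8 * min_energy)" by (rule real_sqrt_le_mono)
    thus ?thesis by simp
  qed
  thus ?thesis by (auto simp: bounded_iff)
qed

lemma open_compl_msupport: "open (- msupport \<nu>)"
  unfolding open_contains_ball
proof
  fix x assume "x \<in> - msupport \<nu>"
  then obtain e where e: "e > 0" "emeasure \<nu> (ball x e) = 0" by (auto simp: msupport_def)
  have "y \<notin> msupport \<nu>" if y: "y \<in> ball x e" for y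
  proof -
    obtain d where d: "d > 0" "ball y d \<subseteq> ball x e" using y by (metis open_ball open_contains_ball)
    have "emeasure \<nu> (ball y d) \<le> emeasure \<nu> (ball x e)" using d by (intro emeasure_mono) (auto simp: sets_nu)
    thus ?thesis using e d unfolding msupport_def by (auto simp: not_less intro!: exI[of _ d])
  qed
  thus "\<exists>e>0. ball x e \<subseteq> - msupport \<nu>" using e by blast
qed

text \<open>The complement is covered by null balls, and by the Lindelof property countably many of
  them suffice.\<close>

lemma emeasure_compl_msupport: "emeasure \<nu> (- msupport \<nu>) = 0"
proof -
  define F where "F = {ball x e | x e. emeasure \<nu> (ball x e) = 0}"
  have "\<And>S. S \<in> F \<Longrightarrow> open S" by (auto simp: F_def)
  then obtain F' where F': "F' \<subseteq> F" "countable F'" "\<Union>F' = \<Union>F" using Lindelof by metis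
  have "- msupport \<nu> \<subseteq> \<Union>F"
  proof
    fix x assume "x \<in> - msupport \<nu>"
    then obtain e where e: "e > 0" "emeasure \<nu> (ball x e) = 0" by (auto simp: msupport_def)
    thus "x \<in> \<Union>F" unfolding F_def by (intro UnionI[of "ball x e"]) auto
  qed
  moreover have "\<Union>F' \<in> null_sets \<nu>"
  proof -
    have "S \<in> null_sets \<nu>" if S: "S \<in> F'" for S
    proof -
      obtain x e where "S = ball x e" "emeasure \<nu> S = 0" using S F'(1) unfolding F_def by blast
      thus ?thesis by (simp add: null_sets_def sets_nu)
    qed
    thus ?thesis using null_sets_UN'[OF F'(2), of "\<lambda>S. S" \<nu>] by simp
  qed
  moreover have "- msupport \<nu> \<in> sets \<nu>"
    using open_compl_msupport by (simp add: sets_nu)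
  ultimately have "- msupport \<nu> \<in> null_sets \<nu>"
    unfolding F'(3) by (metis null_sets_subset)
  thus ?thesis by (rule null_setsD1)
qed

lemma AE_msupport: "AE x in \<nu>. x \<in> msupport \<nu>"
proof -
  have "- msupport \<nu> \<in> null_sets \<nu>"
    using open_compl_msupport emeasure_compl_msupport by (auto simp: null_sets_def sets_nu)
  thus ?thesis by (rule AE_I') auto
qed

lemma closed_msupport: "closed (msupport \<nu>)"
  using open_compl_msupport by (simp add: closed_def)

lemma msupport_convex:
  assumes p: "p \<in> msupport \<nu>" and q: "q \<in> msupport \<nu>" and m: "p \<le> m" "m \<le> q"
  shows "m \<in> msupport \<nu>"
proof (rule ccontr)
  assume m': "m \<notin> msupport \<nu>"
  define L R where "L = msupport \<nu> \<inter> {..m}" and "R = msupport \<nu> \<inter> {m..}"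
  define c d where "c = Sup L" and "d = Inf R"
  have bdd: "bdd_above L" "bdd_below R" by (auto simp: L_def R_def)
  have "c \<in> L" unfolding c_def using p m bdd closed_msupport
    by (intro closed_contains_Sup) (auto simp: L_def)
  have "d \<in> R" unfolding d_def using q m bdd closed_msupport
    by (intro closed_contains_Inf) (auto simp: R_def)
  have cd: "c \<in> msupport \<nu>" "c < m" "d \<in> msupport \<nu>" "m < d"
    using \<open>c \<in> L\<close> \<open>d \<in> R\<close> m' by (auto simp: L_def R_def less_le)
  have gap: "x \<notin> {c<..<d}" if "x \<in> msupport \<nu>" for x
  proof
    assume x: "x \<in> {c<..<d}"
    show False
    proof (cases "x \<le> m")
      case True
      hence "x \<le> c" unfolding c_def using that bdd by (intro cSup_upper) (auto simp: L_def)
      thus ?thesis using x by simp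
    next
      case False
      hence "d \<le> x" unfolding d_def using that bdd by (intro cInf_lower) (auto simp: R_def)
      thus ?thesis using x by simp
    qed
  qed
  have sc: "\<sigma> \<le> c" "\<sigma> \<le> d" using msupport_potential cd by blast+
  \<comment> \<open>3/16 is the minimum of s (1 - s) for s between 1/4 and 3/4, so this bounds from
    below the defect in \<open>ekern_convex\<close> when one particle travels from \<open>c\<close>
    to \<open>d\<close> and the other rests.\<close>
  define \<delta> where "\<delta> = 3 / 16 * (c - d)\<^sup>2 / 2"
  have \<delta>: "\<delta> > 0" using cd by (simp add: \<delta>_def)
  have key: "potential ((1 - s) * c + s * d) + ennreal \<delta> \<le> ennreal min_energy" if s: "1/4 \<le> s" "s \<le> 3/4" for s
  proof -
    have "potential ((1 - s) * c + s * d) + ennreal \<delta> = (\<integral>\<^sup>+ y. ekern A \<alpha> ((1 - s) * c + s * d) y + ennreal \<delta> \<partial>\<nu>)"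
      unfolding potential_def by (subst nn_integral_add) (auto simp: nu.emeasure_space_1)
    also have "\<dots> \<le> (\<integral>\<^sup>+ y. ennreal (1 - s) * ekern A \<alpha> c y + ennreal s * ekern A \<alpha> d y \<partial>\<nu>)"
    proof (rule nn_integral_mono_AE, use AE_msupport in eventually_elim)
      case (elim y)
      \<comment> \<open>The support avoids the gap, so the resting particle lies on one side of both
        endpoints and is not crossed.\<close>
      have "y \<le> c \<or> d \<le> y" using gap[OF elim] by auto
      hence "0 \<le> (c - y) * (d - y)" using cd by (auto intro: mult_nonneg_nonneg mult_nonpos_nonpos)
      hence k: "ekern A \<alpha> ((1 - s) * c + s * d) ((1 - s) * y + s * y) + ennreal (s * (1 - s) * ((c - d)\<^sup>2 + (y - y)\<^sup>2) / 2)
        \<le> ennreal (1 - s) * ekern A \<alpha> c y + ennreal s * ekern A \<alpha> d y"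
        using sc msupport_potential(1)[OF elim] s by (intro ekern_convex) auto
      have yy: "(1 - s) * y + s * y = y" by (simp add: algebra_simps)
      have "\<delta> \<le> s * (1 - s) * ((c - d)\<^sup>2 + (y - y)\<^sup>2) / 2"
      proof -
        have "0 \<le> (s - 1/4) * (3/4 - s)" using s by (intro mult_nonneg_nonneg) auto
        moreover have "(s - 1/4) * (3/4 - s) = s * (1 - s) - 3 / 16" by (simp add: field_simps)
        ultimately have "3 / 16 \<le> s * (1 - s)" by simp
        hence "3 / 16 * (c - d)\<^sup>2 \<le> s * (1 - s) * (c - d)\<^sup>2" by (rule mult_right_mono) simp
        thus ?thesis unfolding \<delta>_def by simp
      qed
      from order_trans[OF add_left_mono[OF ennreal_leI[OF this]] k] show ?case unfolding yy .
    qed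
    also have "\<dots> = ennreal (1 - s) * potential c + ennreal s * potential d"
      unfolding potential_def by (simp add: nn_integral_add nn_integral_cmult)
    also have "\<dots> \<le> ennreal (1 - s) * ennreal min_energy + ennreal s * ennreal min_energy"
      by (intro add_mono mult_left_mono msupport_potential cd) auto
    also have "\<dots> = ennreal ((1 - s) * min_energy + s * min_energy)"
      using s min_energy_nonneg by (simp add: ennreal_mult)
    also have "(1 - s) * min_energy + s * min_energy = min_energy" by (simp add: algebra_simps)
    finally show ?thesis .
  qed
  \<comment> \<open>The middle half of the gap. The uniform law there has finite energy, so
    \<open>potential_test\<close> applies to it, while the potential lies below
    \<open>min_energy\<close> by at least \<delta> throughout.\<close>
  define c' d' where "c' = (3 * c + d) / 4" and "d' = (c + 3 * d) / 4"
  have c'd': "\<sigma> \<le> c'" "c' < d'" using sc cd by (auto simp: c'_def d'_def)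
  define \<tau> where "\<tau> = uniform_measure lborel {c'..d'}"
  note \<tau> = uniform_prob_on[OF c'd', folded \<tau>_def]
  have pt: "potential x + ennreal \<delta> \<le> ennreal min_energy" if "x \<in> {c'..d'}" for x
  proof -
    define s where "s = (x - c) / (d - c)"
    have "s * (d - c) = x - c" using cd by (simp add: s_def)
    hence "x = (1 - s) * c + s * d" by (simp add: algebra_simps)
    moreover have "1/4 \<le> s" "s \<le> 3/4" using that cd by (auto simp: s_def c'_def d'_def field_simps)
    ultimately show ?thesis using key[of s] by simp
  qed
  interpret tau: prob_space \<tau> using \<tau>(1) by (simp add: prob_on_def)
  have [measurable_cong]: "sets \<tau> = sets borel" using \<tau>(1) by (simp add: prob_on_def)
  have "ennreal min_energy + ennreal \<delta> \<le> (\<integral>\<^sup>+ x. potential x \<partial>\<tau>) + ennreal \<delta>"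
    by (intro add_right_mono potential_test \<tau>)
  also have "\<dots> = (\<integral>\<^sup>+ x. potential x + ennreal \<delta> \<partial>\<tau>)"
    by (subst nn_integral_add) (auto simp: tau.emeasure_space_1)
  also have "\<dots> \<le> (\<integral>\<^sup>+ x. ennreal min_energy \<partial>\<tau>)"
    by (rule nn_integral_mono_AE, use \<tau>(3) in eventually_elim) (rule pt)
  also have "\<dots> = ennreal min_energy" by (simp add: tau.emeasure_space_1)
  finally show False using \<delta> min_energy_nonneg by (simp add: ennreal_plus[symmetric] del: ennreal_plus)
qed

lemma msupport_interval:
  obtains a b where "\<sigma> \<le> a" "a < b" "msupport \<nu> = {a..b}"
proof -
  define a b where "a = Inf (msupport \<nu>)" and "b = Sup (msupport \<nu>)"
  have ne: "msupport \<nu> \<noteq> {}" using emeasure_compl_msupport nu.emeasure_space_1 by (auto simp: space_nu)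
  have bdd: "bdd_below (msupport \<nu>)" "bdd_above (msupport \<nu>)"
    using bounded_msupport by (auto intro: bounded_imp_bdd_below bounded_imp_bdd_above)
  have ab: "a \<in> msupport \<nu>" "b \<in> msupport \<nu>" unfolding a_def b_def
    by (intro closed_contains_Inf closed_contains_Sup ne bdd closed_msupport)+
  have eq: "msupport \<nu> = {a..b}"
    using msupport_convex[OF ab] bdd by (auto simp: a_def b_def intro: cInf_lower cSup_upper)
  \<comment> \<open>If the interval were a single point, \<nu> would be a point mass, whose energy
    is infinite.\<close>
  have "a \<noteq> b"
  proof
    assume "a = b"
    with AE_msupport eq have AE: "AE x in \<nu>. x = a" by simp
    have "(\<integral>\<^sup>+ x. potential x \<partial>\<nu>) = (\<integral>\<^sup>+ x. \<infinity> \<partial>\<nu>)"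
    proof (rule nn_integral_cong_AE, use AE in eventually_elim)
      case (elim x)
      have "potential x = (\<integral>\<^sup>+ y. \<infinity> \<partial>\<nu>)"
        unfolding potential_def by (rule nn_integral_cong_AE, use AE in eventually_elim) (simp add: ekern_def elim)
      thus ?case by (simp add: nu.emeasure_space_1)
    qed
    thus False by (simp add: nn_integral_potential nu.emeasure_space_1)
  qed
  moreover have "a \<le> b" using ab(1) unfolding eq by simp
  ultimately show ?thesis using that[of a b] eq msupport_potential(1)[OF ab(1)] by simp
qed

end

section \<open>Product measures and the discrete energy gap\<close>

lemma dens_bound_expanding:
  fixes T :: "real \<Rightarrow> real"
  assumes T [measurable]: "T \<in> borel_measurable unit_lborel" and \<delta>: "\<delta> > 0"
    and exp: "\<And>u v. 0 < u \<Longrightarrow> u < v \<Longrightarrow> v < 1 \<Longrightarrow> \<delta> * (v - u) \<le> T v - T u"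
  shows "dens_bound (ennreal (1 / \<delta>)) (distr unit_lborel borel T)"
proof -
  define \<rho> where "\<rho> = distr unit_lborel borel T"
  define \<kappa> where "\<kappa> = ennreal (1 / \<delta>)"
  have s [measurable_cong]: "sets \<rho> = sets borel" by (simp add: \<rho>_def)
  have em: "emeasure \<rho> C = emeasure lborel {w \<in> {0<..<1}. T w \<in> C}" if [measurable]: "C \<in> sets borel" for C
  proof -
    have "emeasure \<rho> C = emeasure unit_lborel (T -` C \<inter> space unit_lborel)"
      unfolding \<rho>_def by (rule emeasure_distr) measurable
    also have "T -` C \<inter> space unit_lborel = {w \<in> {0<..<1}. T w \<in> C}"
      by (auto simp: space_restrict_space)
    also have "emeasure unit_lborel \<dots> = emeasure lborel \<dots>"
      by (rule emeasure_restrict_space) auto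
    finally show ?thesis .
  qed
  have interval: "emeasure \<rho> C \<le> \<kappa> * emeasure lborel C" if C: "open C" "connected C" for C
  proof (cases "emeasure lborel C" rule: ennreal_cases)
    case top
    thus ?thesis using \<delta> by (simp add: \<kappa>_def ennreal_mult_top)
  next
    case (real l)
    define W where "W = {w \<in> {0<..<1}. T w \<in> C}"
    have diam: "v - u \<le> l / \<delta>" if uv: "u \<in> W" "v \<in> W" for u v
    proof (cases "u < v")
      case True
      have le: "\<delta> * (v - u) \<le> T v - T u" using uv True by (intro exp) (auto simp: W_def)
      moreover have "0 \<le> \<delta> * (v - u)" using \<delta> True by simp
      ultimately have "T u \<le> T v" by linarith
      moreover have "{T u..T v} \<subseteq> C" using C(2) uv
        by (metis (mono_tags, lifting) W_def connected_contains_Icc mem_Collect_eq)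
      hence "emeasure lborel {T u..T v} \<le> ennreal l"
        unfolding real(2)[symmetric] using C(1) by (intro emeasure_mono) auto
      ultimately have "T v - T u \<le> l" using real by simp
      hence "\<delta> * (v - u) \<le> l" using le by simp
      thus ?thesis using \<delta> by (simp add: field_simps)
    next
      case False
      have "0 \<le> l / \<delta>" using real \<delta> by simp
      thus ?thesis using False by simp
    qed
    have "emeasure lborel W \<le> ennreal (l / \<delta>)"
    proof (cases "W = {}")
      case False
      have bdd: "bdd_below W" by (auto simp: W_def bdd_below_def intro!: exI[of _ 0])
      have "W \<subseteq> {Inf W..Inf W + l / \<delta>}"
      proof
        fix v assume v: "v \<in> W"
        have "v - l / \<delta> \<le> Inf W"
        proof (rule cInf_greatest[OF False])
          fix u assume "u \<in> W"
          from diam[OF this v] show "v - l / \<delta> \<le> u" by simp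
        qed
        moreover have "Inf W \<le> v" by (rule cInf_lower[OF v bdd])
        ultimately show "v \<in> {Inf W..Inf W + l / \<delta>}" by simp
      qed
      hence "emeasure lborel W \<le> emeasure lborel {Inf W..Inf W + l / \<delta>}" by (intro emeasure_mono) auto
      thus ?thesis using real \<delta> by simp
    qed simp
    also have "ennreal (l / \<delta>) = \<kappa> * emeasure lborel C"
      using real \<delta> by (simp add: \<kappa>_def ennreal_mult[symmetric])
    finally show ?thesis using C(1) by (simp add: em W_def)
  qed
  have op: "emeasure \<rho> U \<le> \<kappa> * emeasure lborel U" if U: "open U" for U
  proof -
    have oc: "open C" if "C \<in> components U" for C using open_components[OF U that] .
    have disj: "disjoint_family_on (\<lambda>C. C) (components U)"
      using pairwise_disjoint_components[of U] by (auto simp: disjoint_family_on_def pairwise_def)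
    have cnt: "countable (components U)"
      by (rule countable_disjoint_open_subsets) (use oc pairwise_disjoint_components[of U] in \<open>auto simp: pairwise_def disjnt_def\<close>)
    have split: "emeasure M U = (\<integral>\<^sup>+ C. emeasure M C \<partial>count_space (components U))" if "sets M = sets borel" for M
      using emeasure_UN_countable[OF _ cnt disj, of M] oc that by simp
    have "emeasure \<rho> U = (\<integral>\<^sup>+ C. emeasure \<rho> C \<partial>count_space (components U))" by (rule split[OF s])
    also have "\<dots> \<le> (\<integral>\<^sup>+ C. \<kappa> * emeasure lborel C \<partial>count_space (components U))"
      by (intro nn_integral_mono interval) (auto simp: oc in_components_connected)
    also have "\<dots> = \<kappa> * emeasure lborel U"
      by (subst nn_integral_cmult) (auto simp: split[of lborel])
    finally show ?thesis .
  qed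
  have all: "emeasure \<rho> B \<le> \<kappa> * emeasure lborel B" if B: "B \<in> sets borel" for B
  proof (rule ennreal_le_epsilon)
    \<comment> \<open>The open superset is chosen with excess \<delta> e, because the factor
      \<kappa> = 1/\<delta> turns this into \<open>e\<close>.\<close>
    fix e :: real assume e: "0 < e"
    obtain U where U: "open U" "B \<subseteq> U" "emeasure lborel (U - B) \<le> \<delta> * e"
      using outer_regular_lborel_le[OF B, of "\<delta> * e"] e \<delta> by auto
    have "emeasure \<rho> B \<le> emeasure \<rho> U" using U by (intro emeasure_mono) (auto simp: s)
    also have "\<dots> \<le> \<kappa> * emeasure lborel U" by (rule op[OF U(1)])
    also have "emeasure lborel U \<le> emeasure lborel B + emeasure lborel (U - B)"
      using U B emeasure_subadditive[of B lborel "U - B"] by (simp add: Un_absorb1)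
    also have "\<dots> \<le> emeasure lborel B + ennreal (\<delta> * e)" by (rule add_left_mono[OF U(3)])
    also have "\<kappa> * (emeasure lborel B + ennreal (\<delta> * e)) = \<kappa> * emeasure lborel B + ennreal e"
      using \<delta> e by (simp add: distrib_left \<kappa>_def ennreal_mult[symmetric])
    finally show "emeasure \<rho> B \<le> \<kappa> * emeasure lborel B + ennreal e" by (simp add: mult_left_mono)
  qed
  have "\<rho> \<le> scale_measure \<kappa> lborel"
    using all by (subst le_measure) (auto simp: s)
  hence le: "nn_integral \<rho> f \<le> nn_integral (scale_measure \<kappa> lborel) f" for f
    by (intro nn_integral_mono_measure) (auto simp: s)
  show ?thesis unfolding dens_bound_def \<rho>_def[symmetric] \<kappa>_def[symmetric]
  proof
    fix f :: "real \<Rightarrow> ennreal" assume "f \<in> borel_measurable borel"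
    thus "(\<integral>\<^sup>+ x. f x \<partial>\<rho>) \<le> \<kappa> * (\<integral>\<^sup>+ x. f x \<partial>lborel)"
      using le[of f] nn_integral_scale_measure[of f lborel \<kappa>] by simp
  qed
qed

text \<open>Turns an expectation over independent points into a lower bound for a Lebesgue integral.
  The price is exponential in the number of points, hence negligible on the scale
  \<open>n^2\<close>.\<close>

lemma PiM_dens_bound:
  fixes \<rho> :: "real measure"
  assumes rho: "dens_bound \<kappa> \<rho>" "prob_space \<rho>" "sets \<rho> = sets borel" and I: "finite I"
    and f: "f \<in> borel_measurable (PiM I (\<lambda>_. lborel))"
  shows "(\<integral>\<^sup>+ x. f x \<partial>PiM I (\<lambda>_. \<rho>)) \<le> \<kappa> ^ card I * (\<integral>\<^sup>+ x. f x \<partial>PiM I (\<lambda>_. lborel))"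
  using I f
proof (induction I arbitrary: f rule: finite_induct)
  case empty
  show ?case by (simp add: PiM_empty nn_integral_count_space_finite)
next
  case (insert i I)
  interpret prob_space \<rho> by fact
  interpret R: product_sigma_finite "\<lambda>_. \<rho>" by standard
  interpret L: product_sigma_finite "\<lambda>_. lborel :: real measure" by standard
  have cong: "sets (PiM J (\<lambda>_. \<rho>)) = sets (PiM J (\<lambda>_. lborel))" for J :: "'a set"
    by (rule sets_PiM_cong) (auto simp: rho)
  note f [measurable] = insert.prems
  have f' [measurable]: "f \<in> borel_measurable (PiM (insert i I) (\<lambda>_. \<rho>))"
    using f by (simp cong: measurable_cong_sets add: cong)
  have [measurable]: "(\<lambda>x. \<integral>\<^sup>+ y. f (x(i := y)) \<partial>lborel) \<in> borel_measurable (PiM I (\<lambda>_. lborel))"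
    by measurable
  have "(\<integral>\<^sup>+ x. f x \<partial>PiM (insert i I) (\<lambda>_. \<rho>)) = (\<integral>\<^sup>+ x. \<integral>\<^sup>+ y. f (x(i := y)) \<partial>\<rho> \<partial>PiM I (\<lambda>_. \<rho>))"
    using insert by (intro R.product_nn_integral_insert f') auto
  also have "\<dots> \<le> (\<integral>\<^sup>+ x. \<kappa> * (\<integral>\<^sup>+ y. f (x(i := y)) \<partial>lborel) \<partial>PiM I (\<lambda>_. \<rho>))"
  proof (intro nn_integral_mono dens_boundD[OF rho(1)])
    fix x assume "x \<in> space (PiM I (\<lambda>_. \<rho>))"
    hence [measurable]: "x \<in> space (PiM I (\<lambda>_. lborel))" using sets_eq_imp_space_eq[OF cong] by simp
    show "(\<lambda>y. f (x(i := y))) \<in> borel_measurable borel" by measurable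
  qed
  also have "\<dots> \<le> \<kappa> ^ card I * (\<integral>\<^sup>+ x. \<kappa> * (\<integral>\<^sup>+ y. f (x(i := y)) \<partial>lborel) \<partial>PiM I (\<lambda>_. lborel))"
    by (rule insert.IH) measurable
  also have "\<dots> = \<kappa> ^ card (insert i I) * (\<integral>\<^sup>+ x. \<integral>\<^sup>+ y. f (x(i := y)) \<partial>lborel \<partial>PiM I (\<lambda>_. lborel))"
    using insert by (subst nn_integral_cmult) (auto simp: mult_ac)
  also have "(\<integral>\<^sup>+ x. \<integral>\<^sup>+ y. f (x(i := y)) \<partial>lborel \<partial>PiM I (\<lambda>_. lborel)) = (\<integral>\<^sup>+ x. f x \<partial>PiM (insert i I) (\<lambda>_. lborel))"
    using insert by (intro L.product_nn_integral_insert[symmetric] f) auto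
  finally show ?case .
qed

lemma PiM_pair_marginal:
  assumes "prob_space \<rho>" and I: "finite I" "i \<in> I" "j \<in> I" "i \<noteq> j"
    and F [measurable]: "F \<in> borel_measurable (\<rho> \<Otimes>\<^sub>M \<rho>)"
  shows "(\<integral>\<^sup>+ x. F (x i, x j) \<partial>PiM I (\<lambda>_. \<rho>)) = (\<integral>\<^sup>+ z. F z \<partial>(\<rho> \<Otimes>\<^sub>M \<rho>))"
proof -
  interpret prob_space \<rho> by fact
  note sf = sigma_finite_measure_axioms
  interpret R: product_sigma_finite "\<lambda>_. \<rho>" by standard
  define K where "K = I - {i, j}"
  have K: "I = insert i (insert j K)" "finite K" "j \<notin> K" "i \<notin> insert j K" using I by (auto simp: K_def)
  interpret PK: prob_space "PiM K (\<lambda>_. \<rho>)" by (rule prob_space_PiM) (rule assms(1))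
  have "(\<integral>\<^sup>+ x. F (x i, x j) \<partial>PiM I (\<lambda>_. \<rho>))
    = (\<integral>\<^sup>+ y. \<integral>\<^sup>+ x. F ((x(i := y)) i, (x(i := y)) j) \<partial>PiM (insert j K) (\<lambda>_. \<rho>) \<partial>\<rho>)"
    unfolding K(1) using K by (intro R.product_nn_integral_insert_rev) auto
  also have "\<dots> = (\<integral>\<^sup>+ y. \<integral>\<^sup>+ x. F (y, x j) \<partial>PiM (insert j K) (\<lambda>_. \<rho>) \<partial>\<rho>)"
    using I by simp
  also have "\<dots> = (\<integral>\<^sup>+ y. \<integral>\<^sup>+ z. F (y, z) \<partial>\<rho> \<partial>\<rho>)"
  proof (intro nn_integral_cong)
    fix y assume [measurable]: "y \<in> space \<rho>"
    have "(\<integral>\<^sup>+ x. F (y, x j) \<partial>PiM (insert j K) (\<lambda>_. \<rho>)) = (\<integral>\<^sup>+ z. \<integral>\<^sup>+ x. F (y, (x(j := z)) j) \<partial>PiM K (\<lambda>_. \<rho>) \<partial>\<rho>)"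
      using K by (intro R.product_nn_integral_insert_rev) auto
    thus "(\<integral>\<^sup>+ x. F (y, x j) \<partial>PiM (insert j K) (\<lambda>_. \<rho>)) = (\<integral>\<^sup>+ z. F (y, z) \<partial>\<rho>)"
      by (simp add: PK.emeasure_space_1)
  qed
  also have "\<dots> = (\<integral>\<^sup>+ z. F z \<partial>(\<rho> \<Otimes>\<^sub>M \<rho>))" by (rule nn_integral_fst) measurable
  finally show ?thesis .
qed

lemma PiM_marginal:
  assumes "prob_space \<rho>" and I: "i \<in> I" and [measurable]: "F \<in> borel_measurable \<rho>"
  shows "(\<integral>\<^sup>+ x. F (x i) \<partial>PiM I (\<lambda>_. \<rho>)) = (\<integral>\<^sup>+ z. F z \<partial>\<rho>)"
proof -
  have "(\<integral>\<^sup>+ z. F z \<partial>distr (PiM I (\<lambda>_. \<rho>)) \<rho> (\<lambda>x. x i)) = (\<integral>\<^sup>+ x. F (x i) \<partial>PiM I (\<lambda>_. \<rho>))"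
    using I by (intro nn_integral_distr) auto
  thus ?thesis using assms(1) I by (subst (asm) distr_PiM_component) auto
qed

text \<open>The image of the uniform law on the indices, so that coinciding points are counted with
  multiplicity.\<close>

definition empirical :: "nat \<Rightarrow> (nat \<Rightarrow> real) \<Rightarrow> real measure" where
  "empirical n u = distr (measure_pmf (pmf_of_set {..<n})) borel u"

lemma nn_integral_empirical:
  assumes "n > 0" "f \<in> borel_measurable borel"
  shows "(\<integral>\<^sup>+ x. f x \<partial>empirical n u) = (\<Sum>i<n. f (u i)) / of_nat n"
  unfolding empirical_def using assms by (subst nn_integral_distr) (auto simp: nn_integral_pmf_of_set lessThan_empty_iff)

lemma integral_empirical:
  fixes f :: "real \<Rightarrow> real"
  assumes "n > 0" "f \<in> borel_measurable borel"
  shows "(\<integral> x. f x \<partial>empirical n u) = (\<Sum>i<n. f (u i)) / real n"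
  unfolding empirical_def using assms by (subst integral_distr) (auto simp: integral_pmf_of_set lessThan_empty_iff)

lemma prob_on_empirical:
  assumes "n > 0" "\<And>i. i < n \<Longrightarrow> \<sigma> \<le> u i"
  shows "prob_on \<sigma> (empirical n u)"
  unfolding empirical_def
  by (rule prob_on_distr) (use assms in \<open>auto intro: prob_space_measure_pmf simp: AE_measure_pmf_iff lessThan_empty_iff\<close>)

context gas_minimizer
begin

text \<open>If no gap existed, there would be configurations of growing size with energy tending to
  the minimum and averages of \<open>\<phi>\<close> staying away from the limit. A subsequence of
  their empirical measures converges to a measure of minimal energy, which is \<nu> by uniqueness: a
  contradiction. The regularised kernel is finite on the diagonal, so the full double sum is the
  energy of the empirical measure.\<close>

lemma discrete_gap:
  fixes \<phi> :: "real \<Rightarrow> real"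
  assumes a: "a \<longlonglongrightarrow> \<alpha>" "\<And>n. a n \<ge> 0" "\<And>n. a n \<le> A"
    and phi: "continuous_on UNIV \<phi>" "\<And>x. \<bar>\<phi> x\<bar> \<le> B" and \<eta>: "\<eta> > 0"
  obtains c N where "c > 0" "N \<ge> 2"
    "\<And>n u. n \<ge> N \<Longrightarrow> (\<And>i. i < n \<Longrightarrow> \<sigma> \<le> u i) \<Longrightarrow> \<eta> \<le> \<bar>(\<Sum>i<n. \<phi> (u i)) / real n - (\<integral>x. \<phi> x \<partial>\<nu>)\<bar> \<Longrightarrow>
       (real n)\<^sup>2 * (min_energy + c) \<le> (\<Sum>i<n. \<Sum>j<n. rkern A (1 / real n) (a n) (1 - 1 / real n) (u i) (u j))"
proof (rule ccontr)
  assume contr: "\<not> thesis"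
  \<comment> \<open>Size at least k + 2 sends the sizes to infinity and keeps 1 - 1/n at least 1/2,
    as \<open>energy_compactness\<close> requires; the slack 1/(k+1) tends to 0.\<close>
  have "\<exists>n u. n \<ge> k + 2 \<and> (\<forall>i<n. \<sigma> \<le> u i) \<and> \<eta> \<le> \<bar>(\<Sum>i<n. \<phi> (u i)) / real n - (\<integral>x. \<phi> x \<partial>\<nu>)\<bar> \<and>
      (\<Sum>i<n. \<Sum>j<n. rkern A (1 / real n) (a n) (1 - 1 / real n) (u i) (u j)) < (real n)\<^sup>2 * (min_energy + 1 / real (Suc k))" for k
  proof (rule ccontr)
    assume *: "\<not> ?thesis"
    have thesis
      by (rule that[of "1 / real (Suc k)" "k + 2"]) (use * in \<open>auto simp: not_less\<close>)
    thus False using contr by contradiction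
  qed
  then obtain n u where n: "\<And>k. n k \<ge> k + 2" and u: "\<And>k i. i < n k \<Longrightarrow> \<sigma> \<le> u k i"
    and far: "\<And>k. \<eta> \<le> \<bar>(\<Sum>i<n k. \<phi> (u k i)) / real (n k) - (\<integral>x. \<phi> x \<partial>\<nu>)\<bar>"
    and small: "\<And>k. (\<Sum>i<n k. \<Sum>j<n k. rkern A (1 / real (n k)) (a (n k)) (1 - 1 / real (n k)) (u k i) (u k j))
        < (real (n k))\<^sup>2 * (min_energy + 1 / real (Suc k))"
    by metis
  have n0: "n k > 0" "real (n k) \<ge> 2" for k using n[of k] by auto
  define \<mu> where "\<mu> k = empirical (n k) (u k)" for k
  have mu: "prob_on \<sigma> (\<mu> k)" for k unfolding \<mu>_def by (rule prob_on_empirical[OF n0(1) u])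
  have [measurable]: "\<phi> \<in> borel_measurable borel" by (rule borel_measurable_continuous_onI[OF phi(1)])
  have nlim: "filterlim n at_top sequentially"
    by (rule filterlim_at_top_mono[OF filterlim_ident]) (use n in \<open>auto intro!: always_eventually order_trans[OF _ n]\<close>)
  have rlim: "(\<lambda>k. 1 / real (n k)) \<longlonglongrightarrow> 0"
    by (rule tendsto_divide_0[OF tendsto_const])
       (rule filterlim_at_top_imp_at_infinity, rule filterlim_compose[OF filterlim_real_sequentially nlim])
  have alim: "(\<lambda>k. a (n k)) \<longlonglongrightarrow> \<alpha>" by (rule filterlim_compose[OF a(1) nlim])
  have tlim: "(\<lambda>k. 1 - 1 / real (n k)) \<longlonglongrightarrow> 1" using tendsto_diff[OF tendsto_const rlim, of 1] by simp
  have elim: "(\<lambda>k. min_energy + 1 / real (Suc k)) \<longlonglongrightarrow> min_energy"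
    using tendsto_add[OF tendsto_const LIMSEQ_inverse_real_of_nat, of min_energy] by (simp add: inverse_eq_divide)
  have bd: "(\<integral>\<^sup>+ z. ennreal (rkern A (1 / real (n k)) (a (n k)) (1 - 1 / real (n k)) (fst z) (snd z)) \<partial>(\<mu> k \<Otimes>\<^sub>M \<mu> k))
      \<le> ennreal (min_energy + 1 / real (Suc k))" for k
  proof -
    define R where "R = rkern A (1 / real (n k)) (a (n k)) (1 - 1 / real (n k))"
    have [measurable]: "(\<lambda>z. R (fst z) (snd z)) \<in> borel_measurable (borel \<Otimes>\<^sub>M borel)" unfolding R_def by measurable
    have R0: "R x y \<ge> 0" for x y
      unfolding R_def using n0[of k] a by (intro rkern_nonneg) auto
    interpret mu: prob_space "\<mu> k" using mu by (simp add: prob_on_def)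
    have [measurable_cong]: "sets (\<mu> k) = sets borel" using mu by (simp add: prob_on_def)
    have "(\<integral>\<^sup>+ z. ennreal (R (fst z) (snd z)) \<partial>(\<mu> k \<Otimes>\<^sub>M \<mu> k)) = (\<integral>\<^sup>+ x. \<integral>\<^sup>+ y. ennreal (R x y) \<partial>\<mu> k \<partial>\<mu> k)"
      by (subst mu.nn_integral_fst[symmetric]) auto
    also have "\<dots> = (\<Sum>i<n k. (\<Sum>j<n k. ennreal (R (u k i) (u k j))) / of_nat (n k)) / of_nat (n k)"
    proof -
      have [measurable]: "(\<lambda>y. R x y) \<in> borel_measurable borel" for x unfolding R_def rkern_def by measurable
      have [measurable]: "(\<lambda>x. R x y) \<in> borel_measurable borel" for y unfolding R_def rkern_def by measurable
      have "(\<integral>\<^sup>+ y. ennreal (R x y) \<partial>\<mu> k) = (\<Sum>j<n k. ennreal (R x (u k j))) / of_nat (n k)" for x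
        unfolding \<mu>_def by (rule nn_integral_empirical[OF n0(1)]) measurable
      thus ?thesis unfolding \<mu>_def[of k]
        by (simp only:) (rule nn_integral_empirical[OF n0(1)], measurable)
    qed
    also have "\<dots> = ennreal ((\<Sum>i<n k. \<Sum>j<n k. R (u k i) (u k j)) / (real (n k))\<^sup>2)"
      using R0 n0[of k] by (simp add: sum_ennreal sum_nonneg ennreal_of_nat_eq_real_of_nat divide_ennreal sum_divide_distrib[symmetric] power2_eq_square)
    also have "\<dots> \<le> ennreal (min_energy + 1 / real (Suc k))"
      using small[of k] n0[of k] unfolding R_def by (intro ennreal_leI) (simp add: pos_divide_le_eq mult.commute)
    finally show ?thesis unfolding R_def .
  qed
  show False
  proof (rule energy_compactness[OF mu rlim _ _ alim _ _ tlim _ _ bd elim])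
    fix r \<mu>' assume r: "strict_mono r" and mu': "prob_on \<sigma> \<mu>'" and w: "weak_conv_m (\<mu> \<circ> r) \<mu>'"
      and en: "energy A \<alpha> \<mu>' \<le> ennreal min_energy"
    have "\<mu>' = \<nu>"
      by (rule minimizer_unique[OF mu' nu en, unfolded energy_nu]) (use minimal in \<open>auto simp: energy_nu\<close>)
    have "(\<lambda>k. integral\<^sup>L ((\<mu> \<circ> r) k) \<phi>) \<longlonglongrightarrow> integral\<^sup>L \<mu>' \<phi>"
      using phi mu w prob_on_real_distribution[OF mu'] prob_on_real_distribution[OF mu]
      by (intro weak_conv_imp_integral_bdd_continuous_conv[where B = B]) (auto simp: continuous_on_eq_continuous_at comp_def)
    hence "(\<lambda>k. \<bar>integral\<^sup>L (\<mu> (r k)) \<phi> - (\<integral>x. \<phi> x \<partial>\<nu>)\<bar>) \<longlonglongrightarrow> \<bar>(\<integral>x. \<phi> x \<partial>\<nu>) - (\<integral>x. \<phi> x \<partial>\<nu>)\<bar>"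
      unfolding \<open>\<mu>' = \<nu>\<close> by (intro tendsto_intros) (simp add: comp_def)
    moreover have "\<eta> \<le> \<bar>integral\<^sup>L (\<mu> (r k)) \<phi> - (\<integral>x. \<phi> x \<partial>\<nu>)\<bar>" for k
      using far[of "r k"] unfolding \<mu>_def by (subst integral_empirical[OF n0(1)]) auto
    ultimately have "\<eta> \<le> 0" by (intro LIMSEQ_le_const[where a = \<eta>]) auto
    thus False using \<eta> by simp
  qed (use n0 a in \<open>auto simp: field_simps Suc_le_eq\<close>)
qed

end

section \<open>Upper bound for the density\<close>

definition pairs :: "nat \<Rightarrow> (nat \<times> nat) set" where
  "pairs n = {(i, j). i < j \<and> j < n}"

lemma finite_pairs [simp]: "finite (pairs n)"
  by (rule finite_subset[of _ "{..<n} \<times> {..<n}"]) (auto simp: pairs_def)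

lemma sum_pairs:
  fixes F :: "nat \<Rightarrow> nat \<Rightarrow> real"
  assumes sym: "\<And>i j. F i j = F j i"
  shows "(\<Sum>i<n. \<Sum>j<n. F i j) = (\<Sum>i<n. F i i) + 2 * (\<Sum>p\<in>pairs n. F (fst p) (snd p))"
proof (induction n)
  case 0
  show ?case by (simp add: pairs_def)
next
  case (Suc n)
  have "pairs (Suc n) = pairs n \<union> (\<lambda>i. (i, n)) ` {..<n}" by (auto simp: pairs_def less_Suc_eq)
  moreover have "pairs n \<inter> (\<lambda>i. (i, n)) ` {..<n} = {}" by (auto simp: pairs_def)
  ultimately have "(\<Sum>p\<in>pairs (Suc n). F (fst p) (snd p)) = (\<Sum>p\<in>pairs n. F (fst p) (snd p)) + (\<Sum>i<n. F i n)"
    by (simp add: sum.union_disjoint sum.reindex inj_on_def)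
  moreover have "(\<Sum>i<n. F n i) = (\<Sum>i<n. F i n)" by (intro sum.cong sym) auto
  ultimately show ?case using Suc by (simp add: sum.distrib algebra_simps)
qed

lemma card_pairs: "2 * real (card (pairs n)) = real n * (real n - 1)"
  using sum_pairs[of "\<lambda>_ _. 1" n] by (simp add: algebra_simps)

lemma sum_pairs_add:
  fixes q :: "nat \<Rightarrow> real"
  shows "(\<Sum>p\<in>pairs n. q (fst p) + q (snd p)) = (real n - 1) * (\<Sum>i<n. q i)"
proof -
  have "(\<Sum>i<n. \<Sum>j<n. q i + q j) = 2 * real n * (\<Sum>i<n. q i)"
    by (simp add: sum.distrib sum_distrib_left mult.assoc)
  moreover have "(\<Sum>i<n. q i + q i) = 2 * (\<Sum>i<n. q i)" by (simp add: sum_distrib_left)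
  ultimately show ?thesis using sum_pairs[of "\<lambda>i j. q i + q j" n] by (simp add: add.commute algebra_simps)
qed

section \<open>The density written as an energy\<close>

definition reg_pot :: "real \<Rightarrow> real \<Rightarrow> real \<Rightarrow> real" where
  "reg_pot \<epsilon> a x = x\<^sup>2 - a * ln (x\<^sup>2 + \<epsilon>\<^sup>2)"

lemma rkern_reg_pot:
  "rkern A \<epsilon> a \<theta> x y = kern_shift A - ln ((x - y)\<^sup>2 + \<epsilon>\<^sup>2) / 2 + \<theta> * (reg_pot \<epsilon> a x + reg_pot \<epsilon> a y) / 2"
  by (simp add: rkern_def reg_pot_def)

text \<open>The diagonal contributes the term with \<open>ln \<epsilon>\<close>. The weight 1 - 1/n
  leaves n - 1 copies of each one-particle potential, one less than the density contains.\<close>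

lemma rkern_double_sum:
  assumes e: "\<epsilon> > 0" and n: "n > 0"
  shows "(\<Sum>i<n. \<Sum>j<n. rkern A \<epsilon> a (1 - 1 / real n) (u i) (u j))
    = (real n)\<^sup>2 * kern_shift A - real n * ln \<epsilon> - (\<Sum>p\<in>pairs n. ln ((u (fst p) - u (snd p))\<^sup>2 + \<epsilon>\<^sup>2))
      + (real n - 1) * (\<Sum>i<n. reg_pot \<epsilon> a (u i))"
proof -
  let ?q = "\<lambda>i. reg_pot \<epsilon> a (u i)" and ?L = "\<lambda>i j. ln ((u i - u j)\<^sup>2 + \<epsilon>\<^sup>2)"
  have "ln (\<epsilon>\<^sup>2) = 2 * ln \<epsilon>" using e by (simp add: ln_realpow)
  hence L: "(\<Sum>i<n. \<Sum>j<n. ?L i j) = 2 * real n * ln \<epsilon> + 2 * (\<Sum>p\<in>pairs n. ?L (fst p) (snd p))"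
    using sum_pairs[of ?L n] by (simp add: power2_commute)
  have Q: "(\<Sum>i<n. \<Sum>j<n. ?q i + ?q j) = 2 * real n * (\<Sum>i<n. ?q i)"
    by (simp add: sum.distrib sum_distrib_left mult.assoc)
  have th: "(1 - 1 / real n) * real n = real n - 1" using n by (simp add: algebra_simps)
  have "(\<Sum>i<n. \<Sum>j<n. rkern A \<epsilon> a (1 - 1 / real n) (u i) (u j))
    = (\<Sum>i<n. \<Sum>j<n. kern_shift A - (1 / 2) * ?L i j + ((1 - 1 / real n) / 2) * (?q i + ?q j))"
    by (intro sum.cong refl) (simp add: rkern_reg_pot)
  also have "\<dots> = (real n)\<^sup>2 * kern_shift A - (1 / 2) * (\<Sum>i<n. \<Sum>j<n. ?L i j) + ((1 - 1 / real n) / 2) * (\<Sum>i<n. \<Sum>j<n. ?q i + ?q j)"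
    unfolding sum_distrib_left by (simp only: sum.distrib sum_subtractf sum_constant card_lessThan) (simp add: power2_eq_square)
  also have "((1 - 1 / real n) / 2) * (\<Sum>i<n. \<Sum>j<n. ?q i + ?q j) = ((1 - 1 / real n) * real n) * (\<Sum>i<n. ?q i)"
    unfolding Q by simp
  also have "\<dots> = (real n - 1) * (\<Sum>i<n. ?q i)" unfolding th ..
  finally show ?thesis unfolding L by (simp add: algebra_simps)
qed

lemma sum_reg_pot:
  assumes n: "n > 0"
  shows "(\<Sum>i<n. \<beta> * m / 2 * ln ((u i)\<^sup>2 + \<epsilon>\<^sup>2)) + (- (\<beta> / 2) * (real n * (\<Sum>i<n. (u i)\<^sup>2)))
    = - (\<beta> / 2) * (real n * (\<Sum>i<n. reg_pot \<epsilon> (m / real n) (u i)))"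
proof -
  have "real n * (\<Sum>i<n. reg_pot \<epsilon> (m / real n) (u i))
    = real n * ((\<Sum>i<n. (u i)\<^sup>2) - (m / real n) * (\<Sum>i<n. ln ((u i)\<^sup>2 + \<epsilon>\<^sup>2)))"
    by (simp add: reg_pot_def sum_subtractf sum_distrib_left)
  also have "\<dots> = real n * (\<Sum>i<n. (u i)\<^sup>2) - m * (\<Sum>i<n. ln ((u i)\<^sup>2 + \<epsilon>\<^sup>2))"
    using n by (simp add: right_diff_distrib)
  finally have eq: "real n * (\<Sum>i<n. reg_pot \<epsilon> (m / real n) (u i))
    = real n * (\<Sum>i<n. (u i)\<^sup>2) - m * (\<Sum>i<n. ln ((u i)\<^sup>2 + \<epsilon>\<^sup>2))" .
  show ?thesis unfolding eq sum_distrib_left[symmetric] by (simp add: algebra_simps)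
qed

definition scaled_dens :: "real \<Rightarrow> real \<Rightarrow> nat \<Rightarrow> (nat \<Rightarrow> real) \<Rightarrow> real" where
  "scaled_dens \<beta> m n u = (\<Prod>i<n. \<bar>u i\<bar> powr (\<beta> * m)) * exp (- (\<beta> / 2) * (real n * (\<Sum>i<n. (u i)\<^sup>2)))
     * (\<Prod>p\<in>pairs n. \<bar>u (fst p) - u (snd p)\<bar> powr \<beta>)"

text \<open>The powers of \<open>sqrt n\<close> released by rescaling the integrand; the integration
  variable is not changed, so there is no Jacobian. The factor is never evaluated: it occurs in the
  upper and the lower bound and cancels in their quotient.\<close>

definition scale_factor :: "real \<Rightarrow> real \<Rightarrow> nat \<Rightarrow> real" where
  "scale_factor \<beta> m n = (\<Prod>i<n. sqrt n powr (\<beta> * m)) * (\<Prod>p\<in>pairs n. sqrt n powr \<beta>)"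

lemma scale_factor_pos: "n > 0 \<Longrightarrow> scale_factor \<beta> m n > 0"
  unfolding scale_factor_def by (intro mult_pos_pos prod_pos) auto

lemma gge_dens_scaled:
  assumes n: "n > 0" and x: "x \<in> space (Leb_n n)"
  shows "gge_dens \<beta> m \<sigma> n x = (if \<forall>i<n. \<sigma> \<le> x i / sqrt n then scale_factor \<beta> m n * scaled_dens \<beta> m n (\<lambda>i. x i / sqrt n) else 0)"
proof -
  have s: "sqrt n > 0" using n by simp
  have ext: "x \<in> extensional {..<n}" using x by (auto simp: Leb_n_def space_PiM PiE_def)
  have ind: "x \<in> PiE {..<n} (\<lambda>_. {\<sigma> * sqrt n..}) \<longleftrightarrow> (\<forall>i<n. \<sigma> \<le> x i / sqrt n)"
    using ext s by (auto simp: PiE_iff pos_le_divide_eq)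
  have pw: "\<bar>y\<bar> powr c = sqrt n powr c * \<bar>y / sqrt n\<bar> powr c" for y c :: real
  proof -
    have "\<bar>y\<bar> = sqrt n * \<bar>y / sqrt n\<bar>" using s by (simp add: abs_divide)
    thus ?thesis using s by (metis abs_ge_zero less_imp_le powr_mult)
  qed
  have sq: "(\<Sum>i<n. (x i)\<^sup>2) = real n * (\<Sum>i<n. (x i / sqrt n)\<^sup>2)"
    using n by (simp add: power_divide sum_divide_distrib[symmetric])
  have "(\<Prod>i<n. \<bar>x i\<bar> powr (\<beta> * m)) = (\<Prod>i<n. sqrt n powr (\<beta> * m)) * (\<Prod>i<n. \<bar>x i / sqrt n\<bar> powr (\<beta> * m))"
    unfolding prod.distrib[symmetric] by (intro prod.cong refl pw)
  moreover have "(\<Prod>p\<in>pairs n. \<bar>x (fst p) - x (snd p)\<bar> powr \<beta>)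
     = (\<Prod>p\<in>pairs n. sqrt n powr \<beta>) * (\<Prod>p\<in>pairs n. \<bar>x (fst p) / sqrt n - x (snd p) / sqrt n\<bar> powr \<beta>)"
    unfolding prod.distrib[symmetric] diff_divide_distrib[symmetric] by (intro prod.cong refl pw)
  ultimately show ?thesis
    unfolding gge_dens_def scaled_dens_def scale_factor_def pairs_def[symmetric] ind sq
    by (simp add: indicator_def ind)
qed

lemma gge_dens_measurable [measurable]: "gge_dens \<beta> m \<sigma> n \<in> borel_measurable (Leb_n n)"
proof -
  have [measurable]: "PiE {..<n} (\<lambda>_. {\<sigma> * sqrt n..}) \<in> sets (PiM {..<n} (\<lambda>_. lborel))"
    by (intro sets_PiM_I_finite) auto
  have [measurable]: "(\<lambda>x. \<bar>x (fst p) - x (snd p)\<bar> powr \<beta>) \<in> borel_measurable (PiM {..<n} (\<lambda>_. lborel))"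
    if "p \<in> pairs n" for p
  proof -
    have [measurable]: "fst p \<in> {..<n}" "snd p \<in> {..<n}" using that by (auto simp: pairs_def)
    show ?thesis by measurable
  qed
  show ?thesis unfolding gge_dens_def[abs_def] Leb_n_def pairs_def[symmetric] by measurable
qed

lemma gge_dens_nonneg: "gge_dens \<beta> m \<sigma> n x \<ge> 0"
  unfolding gge_dens_def by (intro mult_nonneg_nonneg prod_nonneg) auto

lemma abs_powr_le_exp_ln:
  fixes c d \<epsilon> :: real
  assumes "c \<ge> 0" "\<epsilon> \<noteq> 0"
  shows "\<bar>d\<bar> powr c \<le> exp (c / 2 * ln (d\<^sup>2 + \<epsilon>\<^sup>2))"
proof (cases "d = 0")
  case False
  have "ln (d\<^sup>2) = 2 * ln \<bar>d\<bar>" by (rule ln_square[OF False])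
  moreover have "ln (d\<^sup>2) \<le> ln (d\<^sup>2 + \<epsilon>\<^sup>2)" using False by (subst ln_le_cancel_iff) (auto intro: add_pos_nonneg)
  ultimately have "ln \<bar>d\<bar> \<le> ln (d\<^sup>2 + \<epsilon>\<^sup>2) / 2" by simp
  hence "c * ln \<bar>d\<bar> \<le> c * (ln (d\<^sup>2 + \<epsilon>\<^sup>2) / 2)" using assms by (intro mult_left_mono) auto
  thus ?thesis using False by (simp add: powr_def)
qed simp

text \<open>Regularising each distance can only enlarge the density, and then its exponent is the
  double energy sum plus the one copy of the potentials left out of it.\<close>

lemma scaled_dens_upper:
  assumes n: "n > 0" and e: "\<epsilon> > 0" and b: "\<beta> > 0" and m: "m \<ge> 0"
  shows "scaled_dens \<beta> m n u \<le> exp (- (\<beta> / 2) * ((\<Sum>i<n. \<Sum>j<n. rkern A \<epsilon> (m / real n) (1 - 1 / real n) (u i) (u j))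
     - (real n)\<^sup>2 * kern_shift A + real n * ln \<epsilon> + (\<Sum>i<n. reg_pot \<epsilon> (m / real n) (u i))))"
proof -
  let ?PP = "(\<Prod>p\<in>pairs n. \<bar>u (fst p) - u (snd p)\<bar> powr \<beta>)"
  let ?PI = "(\<Prod>i<n. \<bar>u i\<bar> powr (\<beta> * m))"
  let ?LB = "(\<Sum>p\<in>pairs n. \<beta> / 2 * ln ((u (fst p) - u (snd p))\<^sup>2 + \<epsilon>\<^sup>2))"
  let ?LS = "(\<Sum>p\<in>pairs n. ln ((u (fst p) - u (snd p))\<^sup>2 + \<epsilon>\<^sup>2))"
  let ?SQ = "(- (\<beta> / 2) * (real n * (\<Sum>i<n. (u i)\<^sup>2)))"
  let ?LI = "(\<Sum>i<n. \<beta> * m / 2 * ln ((u i)\<^sup>2 + \<epsilon>\<^sup>2))"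
  let ?q = "\<lambda>i. reg_pot \<epsilon> (m / real n) (u i)"
  have "?PI \<le> (\<Prod>i<n. exp (\<beta> * m / 2 * ln ((u i)\<^sup>2 + \<epsilon>\<^sup>2)))"
    using b m e by (intro prod_mono conjI abs_powr_le_exp_ln) auto
  hence 1: "?PI \<le> exp ?LI"
    by (simp add: exp_sum)
  have "?PP \<le> (\<Prod>p\<in>pairs n. exp (\<beta> / 2 * ln ((u (fst p) - u (snd p))\<^sup>2 + \<epsilon>\<^sup>2)))"
    using b e by (intro prod_mono conjI abs_powr_le_exp_ln) auto
  hence 2: "?PP \<le> exp ?LB"
    by (simp add: exp_sum)
  have "scaled_dens \<beta> m n u \<le> exp ?LI * exp ?SQ
     * exp ?LB"
    unfolding scaled_dens_def by (intro mult_mono 1 2 order_refl) (auto intro!: mult_nonneg_nonneg prod_nonneg)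
  also have "\<dots> = exp (?LI + ?SQ
     + ?LB)"
    by (simp only: exp_add)
  also have "?LI + ?SQ = - (\<beta> / 2) * (real n * (\<Sum>i<n. ?q i))"
    by (rule sum_reg_pot[OF n])
  also have "?LB = \<beta> / 2 * ?LS"
    by (rule sum_distrib_left[symmetric])
  also have "- (\<beta> / 2) * (real n * (\<Sum>i<n. ?q i)) + \<beta> / 2 * ?LS
     = - (\<beta> / 2) * ((\<Sum>i<n. \<Sum>j<n. rkern A \<epsilon> (m / real n) (1 - 1 / real n) (u i) (u j))
     - (real n)\<^sup>2 * kern_shift A + real n * ln \<epsilon> + (\<Sum>i<n. ?q i))"
    unfolding rkern_double_sum[OF e n] by (simp add: algebra_simps)
  finally show ?thesis .
qed

text \<open>The lower bound needs an identity for the true density, so no regularisation is allowed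
  here. With weight 1 and off-diagonal pairs only, the pairs again carry n - 1 copies of each
  potential and one copy remains. The excluded configurations are null for the measure to which this
  is applied.\<close>

lemma scaled_dens_eq:
  assumes n: "n > 0" and nz: "\<And>i. i < n \<Longrightarrow> u i \<noteq> 0" and d: "\<And>p. p \<in> pairs n \<Longrightarrow> u (fst p) \<noteq> u (snd p)"
  shows "scaled_dens \<beta> m n u = exp (- (\<beta> / 2) * (2 * (\<Sum>p\<in>pairs n. rkern A 0 (m / real n) 1 (u (fst p)) (u (snd p)))
     - real n * (real n - 1) * kern_shift A + (\<Sum>i<n. reg_pot 0 (m / real n) (u i))))"
proof -
  let ?LB = "(\<Sum>p\<in>pairs n. \<beta> / 2 * ln ((u (fst p) - u (snd p))\<^sup>2))"
  let ?LS = "(\<Sum>p\<in>pairs n. ln ((u (fst p) - u (snd p))\<^sup>2))"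
  let ?SQ = "(- (\<beta> / 2) * (real n * (\<Sum>i<n. (u i)\<^sup>2)))"
  let ?R = "(\<Sum>p\<in>pairs n. rkern A 0 (m / real n) 1 (u (fst p)) (u (snd p)))"
  let ?LI = "(\<Sum>i<n. \<beta> * m / 2 * ln ((u i)\<^sup>2))"
  let ?q = "\<lambda>i. reg_pot 0 (m / real n) (u i)"
  have pw: "\<bar>y\<bar> powr c = exp (c / 2 * ln (y\<^sup>2))" if "y \<noteq> 0" for y c :: real
    using that by (simp add: powr_def ln_square)
  have 1: "(\<Prod>i<n. \<bar>u i\<bar> powr (\<beta> * m)) = exp ?LI"
    unfolding exp_sum[OF finite_lessThan] using nz by (intro prod.cong pw) auto
  have 2: "(\<Prod>p\<in>pairs n. \<bar>u (fst p) - u (snd p)\<bar> powr \<beta>) = exp ?LB"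
    unfolding exp_sum[OF finite_pairs] using d by (intro prod.cong pw) auto
  have "?R
    = (\<Sum>p\<in>pairs n. kern_shift A - (1 / 2) * ln ((u (fst p) - u (snd p))\<^sup>2) + (1 / 2) * (?q (fst p) + ?q (snd p)))"
    by (intro sum.cong refl) (simp add: rkern_reg_pot)
  also have "\<dots> = real (card (pairs n)) * kern_shift A - (1 / 2) * ?LS
     + (1 / 2) * (\<Sum>p\<in>pairs n. ?q (fst p) + ?q (snd p))"
    unfolding sum_distrib_left by (simp only: sum.distrib sum_subtractf sum_constant)
  finally have "2 * ?R
    = (2 * real (card (pairs n))) * kern_shift A - ?LS + (\<Sum>p\<in>pairs n. ?q (fst p) + ?q (snd p))"
    by simp
  hence R: "2 * ?R
    = real n * (real n - 1) * kern_shift A - ?LS + (real n - 1) * (\<Sum>i<n. ?q i)"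
    unfolding card_pairs sum_pairs_add[of "\<lambda>i. reg_pot 0 (m / real n) (u i)"] .
  have P: "?LI + ?SQ = - (\<beta> / 2) * (real n * (\<Sum>i<n. ?q i))"
    using sum_reg_pot[OF n, of \<beta> m u 0] by simp
  have "scaled_dens \<beta> m n u = exp (?LI + ?SQ
     + ?LB)"
    unfolding scaled_dens_def 1 2 by (simp only: exp_add)
  also have "?LB = \<beta> / 2 * ?LS"
    by (rule sum_distrib_left[symmetric])
  finally show ?thesis unfolding P R by (simp add: algebra_simps)
qed

text \<open>What the tangent bound with c = 2 (A + 1) leaves over when half of the square is kept in
  \<open>reg_pot_lower\<close>.\<close>

definition pot_shift :: "real \<Rightarrow> real" where
  "pot_shift A = 1 / 2 + A * ln (2 * (A + 1))"

lemma reg_pot_lower: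
  assumes a: "0 \<le> a" "a \<le> A" and e: "\<bar>\<epsilon>\<bar> \<le> 1" "\<epsilon> \<noteq> 0"
  shows "x\<^sup>2 / 2 - pot_shift A \<le> reg_pot \<epsilon> a x"
proof -
  have e2: "\<epsilon>\<^sup>2 \<le> 1" using e by (simp add: abs_square_le_1)
  have p: "1 + x\<^sup>2 > 0" "x\<^sup>2 + \<epsilon>\<^sup>2 > 0" using e by (auto intro: add_pos_nonneg add_nonneg_pos)
  have l: "ln (1 + x\<^sup>2) \<le> (1 + x\<^sup>2) / (2 * (A + 1)) + ln (2 * (A + 1))"
    using a by (intro ln_one_plus_square_le) simp
  have "a * ln (x\<^sup>2 + \<epsilon>\<^sup>2) \<le> a * ln (1 + x\<^sup>2)"
    using a e2 p by (intro mult_left_mono) auto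
  also have "\<dots> \<le> A * ln (1 + x\<^sup>2)" using a by (intro mult_right_mono) auto
  also have "\<dots> \<le> A * ((1 + x\<^sup>2) / (2 * (A + 1)) + ln (2 * (A + 1)))"
    using a l by (intro mult_left_mono) auto
  also have "\<dots> = A / (A + 1) * ((1 + x\<^sup>2) / 2) + A * ln (2 * (A + 1))"
  proof -
    have "A * (z / (2 * w) + l) = A / w * (z / 2) + A * l" for z w l by (simp add: distrib_left)
    thus ?thesis by blast
  qed
  also have "A / (A + 1) * ((1 + x\<^sup>2) / 2) \<le> 1 * ((1 + x\<^sup>2) / 2)"
    using a p by (intro mult_right_mono) auto
  finally have "a * ln (x\<^sup>2 + \<epsilon>\<^sup>2) \<le> (1 + x\<^sup>2) / 2 + A * ln (2 * (A + 1))" by simp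
  thus ?thesis by (simp add: reg_pot_def pot_shift_def add_divide_distrib)
qed

section \<open>Gaussian domination\<close>

lemma nn_integral_gaussian:
  assumes "b > 0"
  shows "(\<integral>\<^sup>+ x. ennreal (exp (- (b * x\<^sup>2))) \<partial>lborel) = ennreal (sqrt (pi / b))"
proof -
  define s where "s = sqrt (1 / (2 * b))"
  have s: "s > 0" "s\<^sup>2 = 1 / (2 * b)" using assms by (auto simp: s_def)
  have eq: "exp (- (b * x\<^sup>2)) = sqrt (pi / b) * normal_density 0 s x" for x
    using assms by (simp add: normal_density_def s(2) real_sqrt_divide)
  have "(\<integral>\<^sup>+ x. ennreal (normal_density 0 s x) \<partial>lborel) = ennreal (\<integral> x. normal_density 0 s x \<partial>lborel)"
    by (rule nn_integral_eq_integral) (use s in auto)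
  also have "\<dots> = 1" using s by simp
  finally have 1: "(\<integral>\<^sup>+ x. ennreal (normal_density 0 s x) \<partial>lborel) = 1" .
  have "(\<integral>\<^sup>+ x. ennreal (exp (- (b * x\<^sup>2))) \<partial>lborel) = (\<integral>\<^sup>+ x. ennreal (sqrt (pi / b)) * ennreal (normal_density 0 s x) \<partial>lborel)"
    unfolding eq using assms by (simp add: ennreal_mult)
  also have "\<dots> = ennreal (sqrt (pi / b))" by (subst nn_integral_cmult) (auto simp: 1)
  finally show ?thesis .
qed

text \<open>The energy bound becomes a constant factor, and the copy of the potentials set aside
  dominates the rest by a product of Gaussians. It is applied to the deviating configurations with
  energy above the minimum, and to all configurations with e = 0, which shows that the partition
  function is finite.\<close>

lemma gge_upper:
  assumes n: "n \<ge> 2" and b: "\<beta> > 0" and m: "0 \<le> m" "m / real n \<le> A"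
    and S: "\<And>x. x \<in> S \<Longrightarrow> x \<in> space (Leb_n n) \<Longrightarrow> (\<And>i. i < n \<Longrightarrow> \<sigma> \<le> x i / sqrt n) \<Longrightarrow>
      (real n)\<^sup>2 * e \<le> (\<Sum>i<n. \<Sum>j<n. rkern A (1 / real n) (m / real n) (1 - 1 / real n) (x i / sqrt n) (x j / sqrt n))"
  shows "(\<integral>\<^sup>+ x. ennreal (gge_dens \<beta> m \<sigma> n x) * indicator S x \<partial>Leb_n n)
    \<le> ennreal (scale_factor \<beta> m n * exp (- (\<beta> / 2) * ((real n)\<^sup>2 * (e - kern_shift A) - real n * ln (real n)))
        * (exp (\<beta> * pot_shift A / 2) * sqrt (pi / (\<beta> / (4 * real n)))) ^ n)"
proof -
  let ?G = "exp (\<beta> * pot_shift A / 2) * sqrt (pi / (\<beta> / (4 * real n)))" and ?e = "- (\<beta> / 2) * ((real n)\<^sup>2 * (e - kern_shift A) - real n * ln (real n))"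
  define C where "C = scale_factor \<beta> m n * exp ?e"
  \<comment> \<open>The leftover \<open>(\<beta> / 2) * (u\<^sup>2 / 2)\<close> in the unscaled
    variable y = sqrt n * u.\<close>
  define g where "g y = exp (\<beta> * pot_shift A / 2) * exp (- (\<beta> / (4 * real n) * y\<^sup>2))" for y
  have n0: "n > 0" "real n \<ge> 2" using n by auto
  have C0: "C \<ge> 0" unfolding C_def using scale_factor_pos[OF n0(1), of \<beta> m] by simp
  have [measurable]: "g \<in> borel_measurable borel" unfolding g_def by measurable
  have pw: "ennreal (gge_dens \<beta> m \<sigma> n x) * indicator S x \<le> ennreal C * (\<Prod>i<n. ennreal (g (x i)))"
    if x: "x \<in> space (Leb_n n)" for x
  proof (cases "x \<in> S \<and> (\<forall>i<n. \<sigma> \<le> x i / sqrt n)")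
    case False
    hence "ennreal (gge_dens \<beta> m \<sigma> n x) * indicator S x = 0"
      using gge_dens_scaled[OF n0(1) x, of \<beta> m \<sigma>] by auto
    thus ?thesis by (simp only: zero_le)
  next
    case True
    define u where "u = (\<lambda>i. x i / sqrt n)"
    let ?R = "\<Sum>i<n. \<Sum>j<n. rkern A (1 / real n) (m / real n) (1 - 1 / real n) (u i) (u j)"
    let ?Q = "\<Sum>i<n. reg_pot (1 / real n) (m / real n) (u i)"
    have R: "(real n)\<^sup>2 * e \<le> ?R" unfolding u_def by (rule S) (use True x in auto)
    have "(u i)\<^sup>2 / 2 - pot_shift A \<le> reg_pot (1 / real n) (m / real n) (u i)" for i
      using n0 m by (intro reg_pot_lower) auto
    hence Q: "(\<Sum>i<n. (u i)\<^sup>2 / 2 - pot_shift A) \<le> ?Q" by (intro sum_mono) auto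
    have "ln (1 / real n) = - ln (real n)" using n0 by (simp add: ln_div)
    hence "scaled_dens \<beta> m n u \<le> exp (- (\<beta> / 2) * (?R - (real n)\<^sup>2 * kern_shift A - real n * ln (real n) + ?Q))"
      using scaled_dens_upper[OF n0(1) _ b m(1), of "1 / real n" u A] n0 by simp
    also have "\<dots> \<le> exp (- (\<beta> / 2) * ((real n)\<^sup>2 * (e - kern_shift A) - real n * ln (real n) + (\<Sum>i<n. (u i)\<^sup>2 / 2 - pot_shift A)))"
    proof -
      have "(real n)\<^sup>2 * (e - kern_shift A) - real n * ln (real n) + (\<Sum>i<n. (u i)\<^sup>2 / 2 - pot_shift A)
        \<le> ?R - (real n)\<^sup>2 * kern_shift A - real n * ln (real n) + ?Q"
        using R Q by (simp add: right_diff_distrib)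
      from mult_left_mono[OF this, of "\<beta> / 2"] show ?thesis using b by simp
    qed
    also have "\<dots> = exp ?e
       * exp (\<Sum>i<n. - (\<beta> / 2) * ((u i)\<^sup>2 / 2 - pot_shift A))"
      unfolding sum_distrib_left[symmetric] exp_add[symmetric] distrib_left ..
    also have "exp (\<Sum>i<n. - (\<beta> / 2) * ((u i)\<^sup>2 / 2 - pot_shift A)) = (\<Prod>i<n. g (x i))"
      unfolding exp_sum[OF finite_lessThan] g_def exp_add[symmetric]
      using n0 by (intro prod.cong refl arg_cong[where f = exp]) (simp add: u_def power_divide right_diff_distrib)
    finally have "scale_factor \<beta> m n * scaled_dens \<beta> m n u \<le> C * (\<Prod>i<n. g (x i))"
      unfolding C_def using scale_factor_pos[OF n0(1), of \<beta> m] by (simp add: mult.assoc)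
    hence "gge_dens \<beta> m \<sigma> n x \<le> C * (\<Prod>i<n. g (x i))"
      using True by (simp add: gge_dens_scaled[OF n0(1) x] u_def)
    hence "ennreal (gge_dens \<beta> m \<sigma> n x) \<le> ennreal (C * (\<Prod>i<n. g (x i)))" by (rule ennreal_leI)
    also have "\<dots> = ennreal C * (\<Prod>i<n. ennreal (g (x i)))"
      using C0 by (subst prod_ennreal) (auto simp: g_def ennreal_mult prod_nonneg)
    finally show ?thesis using True by simp
  qed
  interpret L: product_sigma_finite "\<lambda>_. lborel :: real measure" by standard
  have int: "(\<integral>\<^sup>+ y. ennreal (g y) \<partial>lborel) = ennreal ?G"
  proof -
    have "(\<integral>\<^sup>+ y. ennreal (g y) \<partial>lborel) = (\<integral>\<^sup>+ y. ennreal (exp (\<beta> * pot_shift A / 2)) * ennreal (exp (- (\<beta> / (4 * real n) * y\<^sup>2))) \<partial>lborel)"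
      unfolding g_def by (simp add: ennreal_mult)
    also have "\<dots> = ennreal (exp (\<beta> * pot_shift A / 2)) * ennreal (sqrt (pi / (\<beta> / (4 * real n))))"
      using b n0 nn_integral_gaussian[of "\<beta> / (4 * real n)"] by (subst nn_integral_cmult) auto
    finally show ?thesis using b by (subst ennreal_mult) auto
  qed
  have "(\<integral>\<^sup>+ x. ennreal (gge_dens \<beta> m \<sigma> n x) * indicator S x \<partial>Leb_n n)
     \<le> (\<integral>\<^sup>+ x. ennreal C * (\<Prod>i<n. ennreal (g (x i))) \<partial>Leb_n n)"
    by (intro nn_integral_mono pw)
  also have "\<dots> = ennreal C * (\<integral>\<^sup>+ x. (\<Prod>i<n. ennreal (g (x i))) \<partial>Leb_n n)"
    unfolding Leb_n_def by (intro nn_integral_cmult) measurable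
  also have "(\<integral>\<^sup>+ x. (\<Prod>i<n. ennreal (g (x i))) \<partial>Leb_n n) = (\<Prod>i<n. \<integral>\<^sup>+ y. ennreal (g y) \<partial>lborel)"
    unfolding Leb_n_def by (intro L.product_nn_integral_prod) auto
  also have "ennreal C * \<dots> = ennreal (C * ?G ^ n)"
  proof -
    have "ennreal C * (\<Prod>i<n. ennreal D) = ennreal (C * D ^ n)" if "D \<ge> 0" for D
      using that C0 by (simp add: ennreal_mult ennreal_power)
    thus ?thesis unfolding int using b by simp
  qed
  finally show ?thesis unfolding C_def .
qed

section \<open>Lower bound for the partition function\<close>

lemma dens_bound_AE_neq:
  assumes "dens_bound \<kappa> \<rho>" "sets \<rho> = sets borel"
  shows "AE x in \<rho>. x \<noteq> c"
proof -
  have "(\<integral>\<^sup>+ x. indicator {c} x \<partial>\<rho>) \<le> \<kappa> * (\<integral>\<^sup>+ x. indicator {c} x \<partial>lborel)"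
    by (rule dens_boundD[OF assms(1)]) measurable
  hence "emeasure \<rho> {c} = 0" using assms(2) by simp
  thus ?thesis using assms(2) sets_eq_imp_space_eq[OF assms(2)] by (intro AE_I[of _ _ "{c}"]) auto
qed

text \<open>Jensen's inequality via the tangent line of the exponential at \<open>B\<close>, so an
  upper bound \<open>B\<close> for the mean suffices. The terms of negative sign are moved to the
  other side to stay in \<open>ennreal\<close>.\<close>

lemma exp_integral_ge:
  assumes "prob_space M" and [measurable]: "X \<in> borel_measurable M"
    and X: "\<And>x. x \<in> space M \<Longrightarrow> 0 \<le> X x" and int: "(\<integral>\<^sup>+ x. ennreal (X x) \<partial>M) \<le> ennreal B" and B: "0 \<le> B" and b: "0 \<le> b"
  shows "ennreal (exp (- b * B)) \<le> (\<integral>\<^sup>+ x. ennreal (exp (- b * X x)) \<partial>M)"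
proof -
  let ?J = "\<integral>\<^sup>+ x. ennreal (exp (- b * X x)) \<partial>M"
  interpret prob_space M by fact
  define E where "E = exp (- b * B)"
  have pw: "E + E * b * B \<le> exp (- b * X x) + E * b * X x" for x
  proof -
    have "E * (1 + (b * B - b * X x)) \<le> E * exp (b * B - b * X x)"
      unfolding E_def by (intro mult_left_mono exp_ge_add_one_self) auto
    also have "\<dots> = exp (- b * X x)" unfolding E_def exp_add[symmetric] by simp
    finally show ?thesis by (simp add: algebra_simps)
  qed
  have "ennreal E + ennreal (E * b * B) = ennreal (E + E * b * B)"
    using B b by (intro ennreal_plus[symmetric]) (auto simp: E_def)
  also have "\<dots> = (\<integral>\<^sup>+ x. ennreal (E + E * b * B) \<partial>M)" by (simp add: emeasure_space_1)
  also have "\<dots> \<le> (\<integral>\<^sup>+ x. ennreal (exp (- b * X x)) + ennreal (E * b) * ennreal (X x) \<partial>M)"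
  proof (intro nn_integral_mono)
    fix x assume x: "x \<in> space M"
    have "ennreal (E + E * b * B) \<le> ennreal (exp (- b * X x) + E * b * X x)" by (intro ennreal_leI pw)
    also have "\<dots> = ennreal (exp (- b * X x)) + ennreal (E * b * X x)"
      using X[OF x] b by (intro ennreal_plus) (auto simp: E_def)
    also have "ennreal (E * b * X x) = ennreal (E * b) * ennreal (X x)"
      using X[OF x] b by (intro ennreal_mult) (auto simp: E_def)
    finally show "ennreal (E + E * b * B) \<le> ennreal (exp (- b * X x)) + ennreal (E * b) * ennreal (X x)" .
  qed
  also have "\<dots> = ?J + ennreal (E * b) * (\<integral>\<^sup>+ x. ennreal (X x) \<partial>M)"
    by (subst nn_integral_add) (auto simp: nn_integral_cmult)
  also have "\<dots> \<le> ?J + ennreal (E * b) * ennreal B"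
    by (intro add_left_mono mult_left_mono int) auto
  also have "ennreal (E * b) * ennreal B = ennreal (E * b * B)"
    using B b by (intro ennreal_mult[symmetric]) (auto simp: E_def)
  finally have "ennreal (E * b * B) + ennreal E \<le> ennreal (E * b * B) + ?J"
    by (simp add: add.commute)
  thus ?thesis unfolding E_def[symmetric] by (subst (asm) ennreal_add_left_cancel_le) auto
qed

context gas_minimizer
begin

text \<open>Besides spreading the points, the bounded density of \<open>T w\<close> controls the
  change of exponent from \<alpha> to \<open>a n\<close>. For \<alpha> > 0 the logarithm is bounded
  on the support; for \<alpha> = 0 the support may contain 0, and there the logarithm is only
  integrable. Positive parts are stated because \<open>exp_integral_ge\<close> asks for a
  nonnegative exponent.\<close>

lemma smoothing:
  assumes a: "a \<longlonglongrightarrow> \<alpha>" "\<And>n. a n \<ge> 0" "\<And>n. a n \<le> A" and c: "c > 0"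
  obtains T \<delta> Q where "T \<in> borel_measurable unit_lborel" "\<delta> > 0"
    "\<And>u v. 0 < u \<Longrightarrow> u < v \<Longrightarrow> v < 1 \<Longrightarrow> \<delta> * (v - u) \<le> T v - T u"
    "AE w in unit_lborel. \<sigma> \<le> T w"
    "Q \<ge> 0"
    "\<forall>\<^sub>F n in sequentially. (\<integral>\<^sup>+ z. ennreal (max 0 (rkern A 0 (a n) 1 (T (fst z)) (T (snd z))))
        \<partial>(unit_lborel \<Otimes>\<^sub>M unit_lborel)) \<le> ennreal (min_energy + c)"
    "\<forall>\<^sub>F n in sequentially. (\<integral>\<^sup>+ w. ennreal (max 0 (reg_pot 0 (a n) (T w))) \<partial>unit_lborel) \<le> ennreal Q"
proof -
  define \<Omega> :: "real measure" where "\<Omega> = unit_lborel"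
  interpret Om: prob_space \<Omega> unfolding \<Omega>_def by (rule prob_space_unit)
  note sf = Om.sigma_finite_measure_axioms and ps = Om.prob_space_axioms
  have sp: "w \<in> {0<..<1}" if "w \<in> space \<Omega>" for w using that by (simp add: \<Omega>_def space_restrict_space)
  from quantile_function[OF prob_on_real_distribution[OF nu]]
  obtain Y where Y: "mono_on {0<..<1} Y" and Ym [measurable]: "Y \<in> borel_measurable \<Omega>" and dY: "distr \<Omega> borel Y = \<nu>"
    unfolding \<Omega>_def by metis
  obtain p q where pq: "\<sigma> \<le> p" "p < q" "msupport \<nu> = {p..q}" by (rule msupport_interval)
  have "AE x in distr \<Omega> borel Y. x \<in> {p..q}" unfolding dY pq(3)[symmetric] by (rule AE_msupport)
  hence AEY: "AE w in \<Omega>. Y w \<in> {p..q}" by (rule AE_distrD[rotated]) simp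
  define M where "M = max \<bar>p\<bar> \<bar>q\<bar>"
  have M: "\<bar>y\<bar> \<le> M" if "y \<in> {p..q}" for y using that by (auto simp: M_def)
  have M0: "M \<ge> 0" by (simp add: M_def)
  have "\<exists>L\<ge>0. \<alpha> > 0 \<longrightarrow> (\<forall>y\<in>{p..q}. \<bar>ln (y\<^sup>2)\<bar> \<le> L)"
  proof (cases "\<alpha> > 0")
    case True
    hence p: "p > 0" using sigma pq by simp
    have "bounded ((\<lambda>y. ln (y\<^sup>2)) ` {p..q})"
      using p by (intro compact_imp_bounded compact_continuous_image continuous_intros) auto
    then obtain L where L: "\<forall>y\<in>{p..q}. \<bar>ln (y\<^sup>2)\<bar> \<le> L" by (auto simp: bounded_iff)
    moreover have "L \<ge> 0" using L pq(2) by (meson abs_ge_zero atLeastAtMost_iff less_imp_le order_refl order_trans)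
    ultimately show ?thesis by blast
  qed auto
  then obtain L where L: "L \<ge> 0" "\<And>y. \<alpha> > 0 \<Longrightarrow> y \<in> {p..q} \<Longrightarrow> \<bar>ln (y\<^sup>2)\<bar> \<le> L" by blast
  \<comment> \<open>The shift raises the square of a point by at most \<delta> (2 M + 1). Keeping
    this below c/4 leaves room for the other errors up to c/2 per point, and a pair costs two of
    these.\<close>
  define \<delta> where "\<delta> = min 1 (c / (4 * (2 * M + 1)))"
  have \<delta>: "0 < \<delta>" "\<delta> \<le> 1" using c M0 by (auto simp: \<delta>_def)
  have \<delta>c: "\<delta> * (2 * M + 1) \<le> c / 4"
  proof -
    have "\<delta> * k \<le> c / 4" if "k > 0" "\<delta> \<le> c / (4 * k)" for k
      using that by (simp add: field_simps)
    thus ?thesis using M0 by (auto simp: \<delta>_def)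
  qed
  define T where "T w = Y w + \<delta> * w" for w
  have idm [measurable]: "(\<lambda>w. w) \<in> borel_measurable \<Omega>"
    unfolding \<Omega>_def by (rule measurable_restrict_space1) simp
  have [measurable]: "T \<in> borel_measurable \<Omega>" unfolding T_def by measurable
  have expand: "\<delta> * (v - u) \<le> T v - T u" if "0 < u" "u < v" "v < 1" for u v
  proof -
    have "Y u \<le> Y v" using that by (intro mono_onD[OF Y]) auto
    thus ?thesis by (simp add: T_def right_diff_distrib)
  qed
  have dens: "dens_bound (ennreal (1 / \<delta>)) (distr \<Omega> borel T)"
    unfolding \<Omega>_def by (rule dens_bound_expanding) (use \<delta> expand in \<open>auto simp: \<Omega>_def[symmetric]\<close>)
  obtain I where I: "(\<integral>\<^sup>+ u. neg_ln u \<partial>lborel) = ennreal I" "I \<ge> 0"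
    using nn_integral_neg_ln_finite by (cases "\<integral>\<^sup>+ u. neg_ln u \<partial>lborel" rule: ennreal_cases) auto
  have nl: "(\<integral>\<^sup>+ w. neg_ln (T w) \<partial>\<Omega>) \<le> ennreal (I / \<delta>)"
  proof -
    have "(\<integral>\<^sup>+ w. neg_ln (T w) \<partial>\<Omega>) = (\<integral>\<^sup>+ u. neg_ln u \<partial>distr \<Omega> borel T)" by (rule nn_integral_distr[symmetric]) auto
    also have "\<dots> \<le> ennreal (1 / \<delta>) * (\<integral>\<^sup>+ u. neg_ln u \<partial>lborel)" by (rule dens_boundD[OF dens]) measurable
    also have "\<dots> = ennreal (I / \<delta>)" unfolding I(1) using I(2) \<delta> by (simp add: ennreal_mult[symmetric])
    finally show ?thesis .
  qed
  define e where "e n = \<bar>\<alpha> - a n\<bar>" for n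
  have e: "e \<longlonglongrightarrow> 0" "e n \<ge> 0" for n
    using tendsto_rabs[OF tendsto_diff[OF tendsto_const a(1), of \<alpha>]] by (auto simp: e_def[abs_def])
  \<comment> \<open>Error budget for one point: growth of the square, change of exponent on a
    support away from 0, and the logarithm near 0 that matters only for \<alpha> = 0.\<close>
  define d where "d n w = \<delta> * (2 * M + 1) + e n * L + 2 * e n * max 0 (- ln \<bar>T w\<bar>)" for n w
  have d0: "d n w \<ge> 0" for n w using \<delta> M0 e L by (auto simp: d_def intro!: add_nonneg_nonneg mult_nonneg_nonneg)
  have [measurable]: "d n \<in> borel_measurable \<Omega>" for n unfolding d_def by measurable
  define G where "G n = \<delta> * (2 * M + 1) + e n * L + 2 * e n * (I / \<delta>)" for n
  have G0: "G n \<ge> 0" for n using \<delta> M0 e L I by (auto simp: G_def intro!: add_nonneg_nonneg mult_nonneg_nonneg)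
  have AET: "AE w in \<Omega>. T w \<noteq> 0"
  proof -
    have "AE x in distr \<Omega> borel T. x \<noteq> 0" by (rule dens_bound_AE_neq[OF dens]) simp
    thus ?thesis by (rule AE_distrD[rotated]) simp
  qed
  have intd: "(\<integral>\<^sup>+ w. ennreal (d n w) \<partial>\<Omega>) \<le> ennreal (G n)" for n
  proof -
    have "(\<integral>\<^sup>+ w. ennreal (d n w) \<partial>\<Omega>) = (\<integral>\<^sup>+ w. ennreal (\<delta> * (2 * M + 1) + e n * L) + ennreal (2 * e n) * neg_ln (T w) \<partial>\<Omega>)"
    proof (rule nn_integral_cong_AE, use AET in eventually_elim)
      case (elim w)
      have "ennreal (d n w) = ennreal (\<delta> * (2 * M + 1) + e n * L) + ennreal (2 * e n * max 0 (- ln \<bar>T w\<bar>))"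
        unfolding d_def using \<delta> M0 e L by (intro ennreal_plus add_nonneg_nonneg mult_nonneg_nonneg) auto
      also have "ennreal (2 * e n * max 0 (- ln \<bar>T w\<bar>)) = ennreal (2 * e n) * neg_ln (T w)"
        using elim e by (simp add: neg_ln_def ennreal_mult)
      finally show ?case .
    qed
    also have "\<dots> = ennreal (\<delta> * (2 * M + 1) + e n * L) + ennreal (2 * e n) * (\<integral>\<^sup>+ w. neg_ln (T w) \<partial>\<Omega>)"
      by (subst nn_integral_add) (auto simp: Om.emeasure_space_1 nn_integral_cmult)
    also have "\<dots> \<le> ennreal (\<delta> * (2 * M + 1) + e n * L) + ennreal (2 * e n) * ennreal (I / \<delta>)"
      by (intro add_left_mono mult_left_mono nl) auto
    also have "ennreal (2 * e n) * ennreal (I / \<delta>) = ennreal (2 * e n * (I / \<delta>))"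
      using e I \<delta> by (intro ennreal_mult[symmetric]) auto
    also have "ennreal (\<delta> * (2 * M + 1) + e n * L) + \<dots> = ennreal (G n)"
      unfolding G_def using \<delta> M0 e L I by (intro ennreal_plus[symmetric] add_nonneg_nonneg mult_nonneg_nonneg) auto
    finally show ?thesis .
  qed
  have "G \<longlonglongrightarrow> \<delta> * (2 * M + 1) + 0 * L + 2 * 0 * (I / \<delta>)"
    unfolding G_def by (intro tendsto_intros e)
  hence "\<forall>\<^sub>F n in sequentially. G n < c / 2"
    using \<delta>c c by (intro order_tendstoD(2)) auto
  hence Gc: "\<forall>\<^sub>F n in sequentially. G n \<le> c / 2" by (auto elim: eventually_mono)
  have single: "reg_pot 0 (a n) (T w) \<le> reg_pot 0 \<alpha> (Y w) + d n w"
    if w: "w \<in> {0<..<1}" and y: "Y w \<in> {p..q}" and t: "T w \<noteq> 0" for n w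
  proof -
    have sq: "(T w)\<^sup>2 - (Y w)\<^sup>2 \<le> \<delta> * (2 * M + 1)"
    proof -
      have "\<bar>Y w\<bar> * \<bar>w\<bar> \<le> M * 1" using M[OF y] w M0 by (intro mult_mono) auto
      hence "Y w * w \<le> M" using abs_ge_self[of "Y w * w"] by (simp add: abs_mult)
      moreover have "\<delta> * (w * w) \<le> 1 * (1 * 1)" using w \<delta> by (intro mult_mono) auto
      ultimately have "\<delta> * (2 * (Y w * w) + \<delta> * (w * w)) \<le> \<delta> * (2 * M + 1)" using \<delta> by (intro mult_left_mono) auto
      thus ?thesis by (simp add: T_def power2_eq_square algebra_simps)
    qed
    have "\<alpha> * ln ((Y w)\<^sup>2) - a n * ln ((T w)\<^sup>2) \<le> e n * L + 2 * e n * max 0 (- ln \<bar>T w\<bar>)"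
    proof (cases "\<alpha> = 0")
      case True
      hence an: "a n = e n" using a(2)[of n] by (simp add: e_def)
      have "e n * (- ln \<bar>T w\<bar>) \<le> e n * max 0 (- ln \<bar>T w\<bar>)" using e by (intro mult_left_mono) auto
      moreover have "0 \<le> e n * L" using e L by simp
      ultimately show ?thesis using True by (simp add: an ln_square[OF t])
    next
      \<comment> \<open>Here the points are positive and the shift moves them to the right, which
        lowers the potential's logarithmic part; only the change of exponent has to be paid
        for.\<close>
      case False
      hence al: "\<alpha> > 0" using alpha by simp
      hence pos: "Y w > 0" using y pq sigma by auto
      have "Y w \<le> T w" using w \<delta> by (simp add: T_def)
      hence "(Y w)\<^sup>2 \<le> (T w)\<^sup>2" using pos by (intro power_mono) auto
      hence "ln ((Y w)\<^sup>2) \<le> ln ((T w)\<^sup>2)" using pos t by (subst ln_le_cancel_iff) auto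
      hence "a n * ln ((Y w)\<^sup>2) \<le> a n * ln ((T w)\<^sup>2)" using a by (intro mult_left_mono) auto
      moreover have "(\<alpha> - a n) * ln ((Y w)\<^sup>2) \<le> e n * L"
      proof -
        have "(\<alpha> - a n) * ln ((Y w)\<^sup>2) \<le> e n * \<bar>ln ((Y w)\<^sup>2)\<bar>" unfolding e_def abs_mult[symmetric] by simp
        also have "\<dots> \<le> e n * L" using L(2)[OF al y] e by (intro mult_left_mono) auto
        finally show ?thesis .
      qed
      moreover have "0 \<le> 2 * e n * max 0 (- ln \<bar>T w\<bar>)" using e by (intro mult_nonneg_nonneg) auto
      ultimately show ?thesis unfolding left_diff_distrib by linarith
    qed
    thus ?thesis using sq by (simp add: reg_pot_def d_def)
  qed
  have pair: "ennreal (max 0 (rkern A 0 (a n) 1 (T w) (T v))) \<le> ekern A \<alpha> (Y w) (Y v) + (ennreal (d n w) + ennreal (d n v))"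
    if w: "w \<in> {0<..<1}" "Y w \<in> {p..q}" "T w \<noteq> 0" and v: "v \<in> {0<..<1}" "Y v \<in> {p..q}" "T v \<noteq> 0" for n w v
  proof (cases "Y w = Y v")
    case True
    thus ?thesis by (simp add: ekern_def)
  next
    case False
    have "\<bar>Y w - Y v\<bar> \<le> \<bar>T w - T v\<bar>"
    proof (cases "w \<le> v")
      case True
      have "Y w \<le> Y v" using True w v by (intro mono_onD[OF Y]) auto
      moreover have "\<delta> * w \<le> \<delta> * v" using True \<delta> by simp
      ultimately show ?thesis by (simp add: T_def)
    next
      case False
      have "Y v \<le> Y w" using False w v by (intro mono_onD[OF Y]) auto
      moreover have "\<delta> * v \<le> \<delta> * w" using False \<delta> by simp
      ultimately show ?thesis by (simp add: T_def)
    qed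
    hence "(Y w - Y v)\<^sup>2 \<le> (T w - T v)\<^sup>2" by (simp add: abs_le_square_iff)
    moreover have "(Y w - Y v)\<^sup>2 > 0" using False by simp
    ultimately have l: "ln ((Y w - Y v)\<^sup>2) \<le> ln ((T w - T v)\<^sup>2)" by (subst ln_le_cancel_iff) auto
    have lin: "c1 - l1 / 2 + (q1 + q2) / 2 \<le> c1 - l2 / 2 + (q1' + q2') / 2 + (d1 + d2)"
      if "l2 \<le> l1" "q1 \<le> q1' + d1" "q2 \<le> q2' + d2" "0 \<le> d1" "0 \<le> d2" for c1 l1 l2 q1 q2 q1' q2' d1 d2 :: real
      using that unfolding add_divide_distrib by linarith
    have R: "rkern A 0 (a n) 1 (T w) (T v) \<le> rkern A 0 \<alpha> 1 (Y w) (Y v) + (d n w + d n v)"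
      using lin[OF l single[OF w] single[OF v] d0 d0] by (simp add: rkern_reg_pot)
    have R0: "0 \<le> rkern A 0 \<alpha> 1 (Y w) (Y v)"
      using False alpha alpha_0_or_nonzero[of "Y w"] alpha_0_or_nonzero[of "Y v"] w v pq by (intro rkern_nonneg) auto
    have "ennreal (max 0 (rkern A 0 (a n) 1 (T w) (T v))) \<le> ennreal (rkern A 0 \<alpha> 1 (Y w) (Y v) + (d n w + d n v))"
      using R R0 d0[of n w] d0[of n v] by (intro ennreal_leI) auto
    also have "\<dots> = ekern A \<alpha> (Y w) (Y v) + (ennreal (d n w) + ennreal (d n v))"
      using False R0 d0 by (simp add: ekern_def)
    finally show ?thesis .
  qed
  have AEall: "AE w in \<Omega>. w \<in> {0<..<1} \<and> Y w \<in> {p..q} \<and> T w \<noteq> 0"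
    using AE_space AEY AET by eventually_elim (use sp in auto)
  have E: "energy A \<alpha> \<nu> = (\<integral>\<^sup>+ z. ekern A \<alpha> (Y (fst z)) (Y (snd z)) \<partial>(\<Omega> \<Otimes>\<^sub>M \<Omega>))"
    unfolding energy_def dY[symmetric] by (rule nn_integral_distr_pair[OF ps]) auto
  have fstd: "(\<integral>\<^sup>+ z. ennreal (d n (fst z)) \<partial>(\<Omega> \<Otimes>\<^sub>M \<Omega>)) = (\<integral>\<^sup>+ w. ennreal (d n w) \<partial>\<Omega>)" for n
    by (rule nn_integral_pair_fst[OF sf ps]) auto
  have sndd: "(\<integral>\<^sup>+ z. ennreal (d n (snd z)) \<partial>(\<Omega> \<Otimes>\<^sub>M \<Omega>)) = (\<integral>\<^sup>+ w. ennreal (d n w) \<partial>\<Omega>)" for n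
    by (subst Om.nn_integral_fst[symmetric]) (auto simp: Om.emeasure_space_1)
  have energy_T: "(\<integral>\<^sup>+ z. ennreal (max 0 (rkern A 0 (a n) 1 (T (fst z)) (T (snd z)))) \<partial>(\<Omega> \<Otimes>\<^sub>M \<Omega>)) \<le> ennreal (min_energy + 2 * G n)" for n
  proof -
    let ?F = "\<integral>\<^sup>+ z. ekern A \<alpha> (Y (fst z)) (Y (snd z)) + (ennreal (d n (fst z)) + ennreal (d n (snd z))) \<partial>(\<Omega> \<Otimes>\<^sub>M \<Omega>)"
    let ?D = "\<integral>\<^sup>+ z. ennreal (d n (fst z)) + ennreal (d n (snd z)) \<partial>(\<Omega> \<Otimes>\<^sub>M \<Omega>)"
    have "(\<integral>\<^sup>+ z. ennreal (max 0 (rkern A 0 (a n) 1 (T (fst z)) (T (snd z)))) \<partial>(\<Omega> \<Otimes>\<^sub>M \<Omega>))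
       \<le> ?F"
      by (rule nn_integral_mono_AE, use AE_pair_both[OF sf sf AEall AEall] in eventually_elim) (rule pair, auto)
    also have "\<dots> = energy A \<alpha> \<nu> + ((\<integral>\<^sup>+ w. ennreal (d n w) \<partial>\<Omega>) + (\<integral>\<^sup>+ w. ennreal (d n w) \<partial>\<Omega>))"
    proof -
      have [measurable]: "(\<lambda>z. ekern A \<alpha> (Y (fst z)) (Y (snd z))) \<in> borel_measurable (\<Omega> \<Otimes>\<^sub>M \<Omega>)"
        unfolding ekern_def rkern_def by measurable
      have "?F
        = energy A \<alpha> \<nu> + ?D"
        unfolding E by (rule nn_integral_add) auto
      also have "?D
        = (\<integral>\<^sup>+ z. ennreal (d n (fst z)) \<partial>(\<Omega> \<Otimes>\<^sub>M \<Omega>)) + (\<integral>\<^sup>+ z. ennreal (d n (snd z)) \<partial>(\<Omega> \<Otimes>\<^sub>M \<Omega>))"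
        by (rule nn_integral_add) auto
      finally show ?thesis unfolding fstd sndd .
    qed
    also have "\<dots> \<le> ennreal min_energy + (ennreal (G n) + ennreal (G n))"
      unfolding energy_nu by (intro add_left_mono add_mono intd)
    also have "\<dots> = ennreal (min_energy + 2 * G n)"
      using G0[of n] min_energy_nonneg by (simp flip: ennreal_plus)
    finally show ?thesis .
  qed
  define Q where "Q = M\<^sup>2 + \<alpha> * L + c / 2"
  have Q0: "Q \<ge> 0" using L alpha c by (simp add: Q_def)
  have potY: "reg_pot 0 \<alpha> y \<le> M\<^sup>2 + \<alpha> * L" if y: "y \<in> {p..q}" for y
  proof -
    have "y\<^sup>2 \<le> M\<^sup>2" using M[OF y] by (metis abs_ge_zero power2_abs power_mono)
    moreover have "- (\<alpha> * ln (y\<^sup>2)) \<le> \<alpha> * L"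
    proof (cases "\<alpha> > 0")
      case True
      have "\<alpha> * (- ln (y\<^sup>2)) \<le> \<alpha> * L" using L(2)[OF True y] True by (intro mult_left_mono) auto
      thus ?thesis by simp
    next
      case False
      thus ?thesis using alpha by simp
    qed
    ultimately show ?thesis by (simp add: reg_pot_def)
  qed
  have pot_T: "(\<integral>\<^sup>+ w. ennreal (max 0 (reg_pot 0 (a n) (T w))) \<partial>\<Omega>) \<le> ennreal (M\<^sup>2 + \<alpha> * L + G n)" for n
  proof -
    have "(\<integral>\<^sup>+ w. ennreal (max 0 (reg_pot 0 (a n) (T w))) \<partial>\<Omega>) \<le> (\<integral>\<^sup>+ w. ennreal (M\<^sup>2 + \<alpha> * L) + ennreal (d n w) \<partial>\<Omega>)"
    proof (rule nn_integral_mono_AE, use AEall in eventually_elim)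
      case (elim w)
      have "max 0 (reg_pot 0 (a n) (T w)) \<le> M\<^sup>2 + \<alpha> * L + d n w"
        using single[of w n] potY[of "Y w"] elim d0[of n w] L alpha by auto
      hence "ennreal (max 0 (reg_pot 0 (a n) (T w))) \<le> ennreal (M\<^sup>2 + \<alpha> * L + d n w)" by (rule ennreal_leI)
      also have "\<dots> = ennreal (M\<^sup>2 + \<alpha> * L) + ennreal (d n w)" using d0 L alpha by (intro ennreal_plus) auto
      finally show ?case .
    qed
    also have "\<dots> = ennreal (M\<^sup>2 + \<alpha> * L) + (\<integral>\<^sup>+ w. ennreal (d n w) \<partial>\<Omega>)"
      by (subst nn_integral_add) (auto simp: Om.emeasure_space_1)
    also have "\<dots> \<le> ennreal (M\<^sup>2 + \<alpha> * L) + ennreal (G n)" by (intro add_left_mono intd)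
    also have "\<dots> = ennreal (M\<^sup>2 + \<alpha> * L + G n)" using G0 L alpha by (intro ennreal_plus[symmetric]) auto
    finally show ?thesis .
  qed
  show ?thesis
  proof (rule that[of T \<delta> Q])
    show "T \<in> borel_measurable unit_lborel" unfolding \<Omega>_def[symmetric] by measurable
    show "AE w in unit_lborel. \<sigma> \<le> T w"
      unfolding \<Omega>_def[symmetric] using AEall
    proof eventually_elim
      case (elim w)
      hence "0 \<le> \<delta> * w" using \<delta> by auto
      thus ?case using elim pq by (auto simp: T_def)
    qed
    show "\<forall>\<^sub>F n in sequentially. (\<integral>\<^sup>+ z. ennreal (max 0 (rkern A 0 (a n) 1 (T (fst z)) (T (snd z))))
        \<partial>(unit_lborel \<Otimes>\<^sub>M unit_lborel)) \<le> ennreal (min_energy + c)"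
      unfolding \<Omega>_def[symmetric] using Gc
      by eventually_elim (rule order_trans[OF energy_T ennreal_leI], simp)
    show "\<forall>\<^sub>F n in sequentially. (\<integral>\<^sup>+ w. ennreal (max 0 (reg_pot 0 (a n) (T w))) \<partial>unit_lborel) \<le> ennreal Q"
      unfolding \<Omega>_def[symmetric] using Gc
      by eventually_elim (rule order_trans[OF pot_T ennreal_leI], simp add: Q_def)
  qed (use \<delta> Q0 expand in auto)
qed

text \<open>The particles are taken independent with the law of \<open>sqrt n * T w\<close>.
  Jensen's inequality bounds the mean of the density below by the mean energy, and the bounded
  marginal densities convert this mean into the Lebesgue integral at the cost
  \<open>\<delta> ^ n\<close>.\<close>

lemma gge_lower:
  assumes m: "\<And>n. m n > 0" "(\<lambda>n. m n / real n) \<longlonglongrightarrow> \<alpha>" "\<And>n. m n / real n \<le> A"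
    and b: "\<beta> > 0" and c: "c > 0"
  obtains \<delta> K where "\<delta> > 0"
    "\<forall>\<^sub>F n in sequentially. ennreal (scale_factor \<beta> (m n) n *
        exp (- (\<beta> / 2) * ((real n)\<^sup>2 * (min_energy + c - kern_shift A) + real n * K)) * \<delta> ^ n)
      \<le> (\<integral>\<^sup>+ x. ennreal (gge_dens \<beta> (m n) \<sigma> n x) \<partial>Leb_n n)"
proof -
  define \<Omega> :: "real measure" where "\<Omega> = unit_lborel"
  interpret Om: prob_space \<Omega> unfolding \<Omega>_def by (rule prob_space_unit)
  define a where "a n = m n / real n" for n
  have a: "a \<longlonglongrightarrow> \<alpha>" "a n \<ge> 0" "a n \<le> A" for n using m less_imp_le[OF m(1)] by (auto simp: a_def[abs_def])
  obtain T \<delta> Q where Tm: "T \<in> borel_measurable \<Omega>" and \<delta>: "\<delta> > 0"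
    and expand: "\<And>u v. 0 < u \<Longrightarrow> u < v \<Longrightarrow> v < 1 \<Longrightarrow> \<delta> * (v - u) \<le> T v - T u"
    and AET: "AE w in \<Omega>. \<sigma> \<le> T w" and Q: "Q \<ge> 0"
    and pairb: "\<forall>\<^sub>F n in sequentially. (\<integral>\<^sup>+ z. ennreal (max 0 (rkern A 0 (a n) 1 (T (fst z)) (T (snd z)))) \<partial>(\<Omega> \<Otimes>\<^sub>M \<Omega>)) \<le> ennreal (min_energy + c)"
    and singleb: "\<forall>\<^sub>F n in sequentially. (\<integral>\<^sup>+ w. ennreal (max 0 (reg_pot 0 (a n) (T w))) \<partial>\<Omega>) \<le> ennreal Q"
    using smoothing[OF a c] unfolding \<Omega>_def[symmetric] by blast
  note [measurable] = Tm
  \<comment> \<open>The terms of order n: the one-particle potentials, and the shift lost when n (n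
    - 1) is replaced by \<open>n^2\<close>.\<close>
  define K where "K = Q + kern_shift A"
  have "\<forall>\<^sub>F n in sequentially. ennreal (scale_factor \<beta> (m n) n *
        exp (- (\<beta> / 2) * ((real n)\<^sup>2 * (min_energy + c - kern_shift A) + real n * K)) * \<delta> ^ n)
      \<le> (\<integral>\<^sup>+ x. ennreal (gge_dens \<beta> (m n) \<sigma> n x) \<partial>Leb_n n)"
    using pairb singleb eventually_gt_at_top[of 0]
  proof eventually_elim
    case (elim n)
    let ?Z = "(\<integral>\<^sup>+ x. ennreal (gge_dens \<beta> (m n) \<sigma> n x) \<partial>Leb_n n)"
    let ?sf = "scale_factor \<beta> (m n) n"
    let ?L = "exp (- (\<beta> / 2) * ((real n)\<^sup>2 * (min_energy + c - kern_shift A) + real n * K))"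
    define s where "s = sqrt (real n)"
    have s: "s \<ge> 1" "s > 0" using elim(3) by (auto simp: s_def Suc_le_eq)
    \<comment> \<open>Scaling by s \<ge> 1 only increases the expansion, so the density bound
      1/\<delta> is retained for every \<open>n\<close>.\<close>
    define \<rho> where "\<rho> = distr \<Omega> borel (\<lambda>w. s * T w)"
    have sr [measurable_cong]: "sets \<rho> = sets borel" by (simp add: \<rho>_def)
    have dens: "dens_bound (ennreal (1 / \<delta>)) \<rho>"
      unfolding \<rho>_def \<Omega>_def
    proof (rule dens_bound_expanding)
      fix u v :: real assume uv: "0 < u" "u < v" "v < 1"
      have "0 \<le> \<delta> * (v - u)" using \<delta> uv by simp
      hence "1 * (\<delta> * (v - u)) \<le> s * (T v - T u)" using s expand[OF uv] by (intro mult_mono) auto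
      thus "\<delta> * (v - u) \<le> s * T v - s * T u" by (simp add: right_diff_distrib)
    qed (use \<delta> in \<open>auto simp: \<Omega>_def[symmetric]\<close>)
    interpret rho: prob_space \<rho> unfolding \<rho>_def by (rule Om.prob_space_distr) measurable
    note sfr = rho.sigma_finite_measure_axioms and psr = rho.prob_space_axioms
    define R where "R = PiM {..<n} (\<lambda>_. \<rho>)"
    interpret R: prob_space R unfolding R_def by (rule prob_space_PiM) (rule psr)
    have sR [measurable_cong]: "sets R = sets (Leb_n n)"
      unfolding R_def Leb_n_def by (rule sets_PiM_cong) (auto simp: sr)
    have comp: "(\<lambda>x. x i) \<in> borel_measurable R" if "i < n" for i
      using that measurable_component_singleton[of i "{..<n}" "\<lambda>_. \<rho>"] unfolding R_def
      by (simp cong: measurable_cong_sets add: sr)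
    define p where "p x y = max 0 (rkern A 0 (a n) 1 (x / s) (y / s))" for x y
    define q where "q x = max 0 (reg_pot 0 (a n) (x / s))" for x
    have [measurable]: "(\<lambda>z. p (fst z) (snd z)) \<in> borel_measurable (borel \<Otimes>\<^sub>M borel)" "q \<in> borel_measurable borel"
      unfolding p_def q_def rkern_def reg_pot_def by measurable
    have pint: "(\<integral>\<^sup>+ x. ennreal (p (x i) (x j)) \<partial>R) \<le> ennreal (min_energy + c)" if "(i, j) \<in> pairs n" for i j
    proof -
      have "(\<integral>\<^sup>+ x. ennreal (p (x i) (x j)) \<partial>R) = (\<integral>\<^sup>+ z. ennreal (p (fst z) (snd z)) \<partial>(\<rho> \<Otimes>\<^sub>M \<rho>))"
        using PiM_pair_marginal[OF psr, of "{..<n}" i j "\<lambda>z. ennreal (p (fst z) (snd z))"] that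
        by (simp add: pairs_def R_def)
      also have "\<dots> = (\<integral>\<^sup>+ z. ennreal (p (s * T (fst z)) (s * T (snd z))) \<partial>(\<Omega> \<Otimes>\<^sub>M \<Omega>))"
        unfolding \<rho>_def by (rule nn_integral_distr_pair[OF Om.prob_space_axioms]) auto
      also have "\<dots> \<le> ennreal (min_energy + c)" using elim(1) s by (simp add: p_def)
      finally show ?thesis .
    qed
    have qint: "(\<integral>\<^sup>+ x. ennreal (q (x i)) \<partial>R) \<le> ennreal Q" if "i < n" for i
    proof -
      have "(\<integral>\<^sup>+ x. ennreal (q (x i)) \<partial>R) = (\<integral>\<^sup>+ z. ennreal (q z) \<partial>\<rho>)"
        unfolding R_def by (rule PiM_marginal[OF psr]) (use that in simp, measurable)
      also have "\<dots> = (\<integral>\<^sup>+ w. ennreal (q (s * T w)) \<partial>\<Omega>)"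
        unfolding \<rho>_def by (rule nn_integral_distr) auto
      also have "\<dots> \<le> ennreal Q" using elim(2) s by (simp add: q_def)
      finally show ?thesis .
    qed
    \<comment> \<open>Majorises the exponent in \<open>scaled_dens_eq\<close> up to the constant
      shift. Taking positive parts can only lower the resulting bound for the density.\<close>
    define X where "X x = (\<Sum>z\<in>pairs n. 2 * p (x (fst z)) (x (snd z))) + (\<Sum>i<n. q (x i))" for x
    define B where "B = real n * (real n - 1) * (min_energy + c) + real n * Q"
    have p0: "p x y \<ge> 0" and q0: "q x \<ge> 0" for x y by (auto simp: p_def q_def)
    have X0: "X x \<ge> 0" for x unfolding X_def by (intro add_nonneg_nonneg sum_nonneg) (auto simp: p0 q0)
    have B0: "B \<ge> 0" using elim(3) Q c min_energy_nonneg unfolding B_def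
      by (intro add_nonneg_nonneg mult_nonneg_nonneg) (auto simp: Suc_le_eq)
    have pm: "(\<lambda>x. p (x (fst z)) (x (snd z))) \<in> borel_measurable R" if "z \<in> pairs n" for z
    proof -
      have [measurable]: "(\<lambda>x. x (fst z)) \<in> borel_measurable R" "(\<lambda>x. x (snd z)) \<in> borel_measurable R"
        using that by (auto simp: pairs_def intro!: comp)
      show ?thesis unfolding p_def rkern_def by measurable
    qed
    have qm: "(\<lambda>x. q (x i)) \<in> borel_measurable R" if "i < n" for i
      by (rule measurable_compose[OF comp[OF that]]) measurable
    have Xm [measurable]: "X \<in> borel_measurable R" unfolding X_def
      by (intro borel_measurable_add borel_measurable_sum borel_measurable_times borel_measurable_const pm qm) auto
    have pm': "(\<lambda>x. 2 * ennreal (p (x (fst z)) (x (snd z)))) \<in> borel_measurable R"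
      and pm'': "(\<lambda>x. ennreal (p (x (fst z)) (x (snd z)))) \<in> borel_measurable R" if "z \<in> pairs n" for z
      using pm[OF that] by (measurable, measurable)
    have qm': "(\<lambda>x. ennreal (q (x i))) \<in> borel_measurable R" if "i < n" for i
      using qm[OF that] by measurable
    let ?P = "\<lambda>x. \<Sum>z\<in>pairs n. 2 * ennreal (p (x (fst z)) (x (snd z)))"
    have "(\<integral>\<^sup>+ x. ennreal (X x) \<partial>R) = (\<integral>\<^sup>+ x. ?P x + (\<Sum>i<n. ennreal (q (x i))) \<partial>R)"
      unfolding X_def using p0 q0 by (intro nn_integral_cong) (simp add: sum_nonneg ennreal_mult flip: sum_ennreal)
    also have "\<dots> = (\<Sum>z\<in>pairs n. 2 * (\<integral>\<^sup>+ x. ennreal (p (x (fst z)) (x (snd z))) \<partial>R)) + (\<Sum>i<n. \<integral>\<^sup>+ x. ennreal (q (x i)) \<partial>R)"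
    proof -
      have "(\<integral>\<^sup>+ x. ?P x + (\<Sum>i<n. ennreal (q (x i))) \<partial>R)
        = (\<integral>\<^sup>+ x. ?P x \<partial>R) + (\<integral>\<^sup>+ x. (\<Sum>i<n. ennreal (q (x i))) \<partial>R)"
        by (intro nn_integral_add borel_measurable_sum pm' qm') auto
      also have "(\<integral>\<^sup>+ x. ?P x \<partial>R)
        = (\<Sum>z\<in>pairs n. \<integral>\<^sup>+ x. 2 * ennreal (p (x (fst z)) (x (snd z))) \<partial>R)"
        by (intro nn_integral_sum pm')
      also have "\<dots> = (\<Sum>z\<in>pairs n. 2 * (\<integral>\<^sup>+ x. ennreal (p (x (fst z)) (x (snd z))) \<partial>R))"
        by (intro sum.cong refl nn_integral_cmult pm'')
      also have "(\<integral>\<^sup>+ x. (\<Sum>i<n. ennreal (q (x i))) \<partial>R) = (\<Sum>i<n. \<integral>\<^sup>+ x. ennreal (q (x i)) \<partial>R)"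
        by (intro nn_integral_sum qm') auto
      finally show ?thesis .
    qed
    also have "\<dots> \<le> (\<Sum>z\<in>pairs n. 2 * ennreal (min_energy + c)) + (\<Sum>i<n. ennreal Q)"
      by (intro add_mono sum_mono mult_left_mono pint qint) auto
    also have "\<dots> = ennreal (real (card (pairs n)) * (2 * (min_energy + c)) + real n * Q)"
    proof -
      have "ennreal (real k * (2 * x) + real l * y) = of_nat k * (2 * ennreal x) + of_nat l * ennreal y"
        if "x \<ge> 0" "y \<ge> 0" for k l :: nat and x y
        using that by (simp add: ennreal_mult ennreal_of_nat_eq_real_of_nat)
      from this[of "min_energy + c" Q "card (pairs n)" n] show ?thesis using Q c min_energy_nonneg by simp
    qed
    also have "real (card (pairs n)) * (2 * (min_energy + c)) + real n * Q = B"
    proof -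
      have "real (card (pairs n)) * (2 * (min_energy + c)) = (2 * real (card (pairs n))) * (min_energy + c)" by simp
      thus ?thesis unfolding card_pairs B_def by simp
    qed
    finally have Xint: "(\<integral>\<^sup>+ x. ennreal (X x) \<partial>R) \<le> ennreal B" .
    define S where "S = ?sf * exp (\<beta> / 2 * (real n * (real n - 1) * kern_shift A))"
    have S0: "S > 0" unfolding S_def using scale_factor_pos[OF elim(3), of \<beta> "m n"] by simp
    have AE_sigma: "AE x in R. \<forall>i\<in>{..<n}. \<sigma> \<le> x i / s"
    proof (rule AE_finite_allI)
      fix i assume i: "i \<in> {..<n}"
      have "AE x in \<rho>. \<sigma> \<le> x / s" unfolding \<rho>_def
        using AET s by (subst AE_distr_iff) (auto elim: eventually_mono)
      thus "AE x in R. \<sigma> \<le> x i / s" unfolding R_def by (rule AE_PiM_component[OF psr i])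
    qed simp
    have AE_nz: "AE x in R. \<forall>i\<in>{..<n}. x i \<noteq> 0"
    proof (rule AE_finite_allI)
      fix i assume i: "i \<in> {..<n}"
      show "AE x in R. x i \<noteq> 0" unfolding R_def
        by (rule AE_PiM_component[OF psr i dens_bound_AE_neq[OF dens sr]])
    qed simp
    have AE_d: "AE x in R. \<forall>z\<in>pairs n. x (fst z) \<noteq> x (snd z)"
    proof (rule AE_finite_allI)
      fix z assume z: "z \<in> pairs n"
      define D where "D w = (if fst w = snd w then 1 else 0 :: ennreal)" for w :: "real \<times> real"
      have [measurable]: "D \<in> borel_measurable (borel \<Otimes>\<^sub>M borel)" unfolding D_def by measurable
      have "(\<integral>\<^sup>+ x. D (x (fst z), x (snd z)) \<partial>R) = (\<integral>\<^sup>+ w. D w \<partial>(\<rho> \<Otimes>\<^sub>M \<rho>))"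
        unfolding R_def by (rule PiM_pair_marginal[OF psr]) (use z in \<open>auto simp: pairs_def\<close>)
      also have "\<dots> = (\<integral>\<^sup>+ x. \<integral>\<^sup>+ y. D (x, y) \<partial>\<rho> \<partial>\<rho>)" by (rule rho.nn_integral_fst[symmetric]) measurable
      also have "\<dots> = (\<integral>\<^sup>+ x. 0 \<partial>\<rho>)"
      proof (rule nn_integral_cong)
        fix x
        have "(\<integral>\<^sup>+ y. D (x, y) \<partial>\<rho>) = (\<integral>\<^sup>+ y. 0 \<partial>\<rho>)"
          by (rule nn_integral_cong_AE, use dens_bound_AE_neq[OF dens sr, of x] in eventually_elim) (auto simp: D_def)
        thus "(\<integral>\<^sup>+ y. D (x, y) \<partial>\<rho>) = 0" by simp
      qed
      finally have D0: "(\<integral>\<^sup>+ x. D (x (fst z), x (snd z)) \<partial>R) = 0" by simp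
      have [measurable]: "(\<lambda>x. x (fst z)) \<in> borel_measurable R" "(\<lambda>x. x (snd z)) \<in> borel_measurable R"
        using z by (auto simp: pairs_def intro!: comp)
      have "(\<lambda>x. D (x (fst z), x (snd z))) \<in> borel_measurable R" by measurable
      hence "AE x in R. D (x (fst z), x (snd z)) = 0" using D0 by (subst (asm) nn_integral_0_iff_AE) auto
      thus "AE x in R. x (fst z) \<noteq> x (snd z)" by eventually_elim (auto simp: D_def split: if_splits)
    qed simp
    have AE_ge: "AE x in R. S * exp (- (\<beta> / 2) * X x) \<le> gge_dens \<beta> (m n) \<sigma> n x"
      using AE_sigma AE_nz AE_d AE_space
    proof eventually_elim
      case (elim x)
      have xs: "x \<in> space (Leb_n n)" using elim(4) sets_eq_imp_space_eq[OF sR] by simp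
      define u where "u = (\<lambda>i. x i / s)"
      let ?P = "\<Sum>z\<in>pairs n. rkern A 0 (a n) 1 (u (fst z)) (u (snd z))" and ?q = "\<Sum>i<n. reg_pot 0 (a n) (u i)"
      have "gge_dens \<beta> (m n) \<sigma> n x = ?sf * scaled_dens \<beta> (m n) n u"
        using gge_dens_scaled[OF \<open>n > 0\<close> xs, of \<beta> "m n" \<sigma>] elim(1) by (simp add: u_def s_def)
      also have "scaled_dens \<beta> (m n) n u = exp (- (\<beta> / 2) * (2 * ?P - real n * (real n - 1) * kern_shift A + ?q))"
        unfolding a_def by (rule scaled_dens_eq) (use elim(2,3) s \<open>n > 0\<close> in \<open>auto simp: u_def\<close>)
      finally have eq: "gge_dens \<beta> (m n) \<sigma> n x = ?sf * exp (- (\<beta> / 2) * (2 * ?P - real n * (real n - 1) * kern_shift A + ?q))" .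
      have "2 * ?P \<le> (\<Sum>z\<in>pairs n. 2 * p (x (fst z)) (x (snd z)))"
        unfolding sum_distrib_left by (intro sum_mono) (simp add: p_def u_def)
      moreover have "?q \<le> (\<Sum>i<n. q (x i))" by (intro sum_mono) (simp add: q_def u_def)
      ultimately have le: "2 * ?P - real n * (real n - 1) * kern_shift A + ?q \<le> X x - real n * (real n - 1) * kern_shift A"
        unfolding X_def by simp
      have "S * exp (- (\<beta> / 2) * X x) = ?sf * exp (- (\<beta> / 2) * (X x - real n * (real n - 1) * kern_shift A))"
        unfolding S_def mult.assoc exp_add[symmetric] by (simp add: algebra_simps)
      also have "\<dots> \<le> gge_dens \<beta> (m n) \<sigma> n x"
        unfolding eq using b mult_left_mono[OF le, of "\<beta> / 2"] scale_factor_pos[OF \<open>n > 0\<close>, of \<beta> "m n"]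
        by (intro mult_left_mono) auto
      finally show ?case .
    qed
    have jensen: "ennreal (exp (- (\<beta> / 2) * B)) \<le> (\<integral>\<^sup>+ x. ennreal (exp (- (\<beta> / 2) * X x)) \<partial>R)"
      by (rule exp_integral_ge[OF R.prob_space_axioms Xm X0 Xint B0]) (use b in auto)
    have "ennreal (S * exp (- (\<beta> / 2) * B)) = ennreal S * ennreal (exp (- (\<beta> / 2) * B))"
      using S0 by (intro ennreal_mult) auto
    also have "\<dots> \<le> ennreal S * (\<integral>\<^sup>+ x. ennreal (exp (- (\<beta> / 2) * X x)) \<partial>R)" by (intro mult_left_mono jensen) auto
    also have "\<dots> = (\<integral>\<^sup>+ x. ennreal (S * exp (- (\<beta> / 2) * X x)) \<partial>R)"
      using S0 by (subst nn_integral_cmult[symmetric]) (auto simp: ennreal_mult)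
    also have "\<dots> \<le> (\<integral>\<^sup>+ x. ennreal (gge_dens \<beta> (m n) \<sigma> n x) \<partial>R)"
      by (rule nn_integral_mono_AE, use AE_ge in eventually_elim) (rule ennreal_leI)
    also have "\<dots> \<le> ennreal (1 / \<delta>) ^ card {..<n} * ?Z"
      unfolding R_def Leb_n_def
      by (rule PiM_dens_bound[OF dens psr sr]) (auto simp: Leb_n_def[symmetric])
    finally have "ennreal (\<delta> ^ n) * ennreal (S * exp (- (\<beta> / 2) * B))
      \<le> ennreal (\<delta> ^ n) * (ennreal (1 / \<delta>) ^ n * ?Z)"
      by (intro mult_left_mono) auto
    also have "\<dots> = ennreal (\<delta> ^ n * (1 / \<delta>) ^ n) * ?Z"
      using \<delta> by (simp add: ennreal_power ennreal_mult mult.assoc del: power_one_over)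
    also have "\<delta> ^ n * (1 / \<delta>) ^ n = 1" using \<delta> by (simp flip: power_mult_distrib)
    finally have main: "ennreal (\<delta> ^ n) * ennreal (S * exp (- (\<beta> / 2) * B)) \<le> ?Z"
      by simp
    \<comment> \<open>The n diagonal copies of \<open>min_energy + c\<close> missing from
      \<open>B\<close> are nonnegative and may be dropped.\<close>
    have "B - real n * (real n - 1) * kern_shift A \<le> (real n)\<^sup>2 * (min_energy + c - kern_shift A) + real n * K"
    proof -
      have "0 \<le> real n * (min_energy + c)" using c min_energy_nonneg by simp
      thus ?thesis unfolding B_def K_def by (simp add: power2_eq_square algebra_simps)
    qed
    from mult_left_mono[OF this, of "\<beta> / 2"] b
    have "?L
      \<le> exp (\<beta> / 2 * (real n * (real n - 1) * kern_shift A)) * exp (- (\<beta> / 2) * B)"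
      unfolding exp_add[symmetric] by (simp add: algebra_simps)
    hence "?sf * ?L * \<delta> ^ n
      \<le> ?sf * (exp (\<beta> / 2 * (real n * (real n - 1) * kern_shift A)) * exp (- (\<beta> / 2) * B)) * \<delta> ^ n"
      using \<delta> scale_factor_pos[OF elim(3), of \<beta> "m n"] by (intro mult_right_mono mult_left_mono) auto
    also have "\<dots> = \<delta> ^ n * (S * exp (- (\<beta> / 2) * B))" by (simp add: S_def mult_ac)
    finally have "ennreal (?sf * ?L * \<delta> ^ n)
      \<le> ennreal (\<delta> ^ n * (S * exp (- (\<beta> / 2) * B)))" by (rule ennreal_leI)
    also have "\<dots> = ennreal (\<delta> ^ n) * ennreal (S * exp (- (\<beta> / 2) * B))"
      using \<delta> S0 by (intro ennreal_mult) auto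
    finally show ?case using main by (rule order_trans)
  qed
  thus ?thesis by (rule that[OF \<delta>])
qed

end

section \<open>Concentration and convergence\<close>

lemma gaussian_factor_tendsto_0:
  fixes \<kappa> l C :: real
  assumes "\<kappa> > 0"
  shows "(\<lambda>n. exp (real n * (- \<kappa> * real n + l * ln (real n) + C))) \<longlonglongrightarrow> 0"
  using assms by real_asymp

text \<open>The normalisation in \<open>gge_law\<close> is a Bochner integral, which is 0 by
  convention for a non-integrable function. A finite and positive partition function identifies it
  with \<open>Z\<close>.\<close>

lemma gge_law_prob:
  assumes Z: "(\<integral>\<^sup>+ x. ennreal (gge_dens \<beta> m \<sigma> n x) \<partial>Leb_n n) = ennreal Z" "Z > 0"
  shows "prob_space (gge_law \<beta> m \<sigma> n)"
    and "S \<in> sets (Leb_n n) \<Longrightarrow> emeasure (gge_law \<beta> m \<sigma> n) S = (\<integral>\<^sup>+ x. ennreal (gge_dens \<beta> m \<sigma> n x) * indicator S x \<partial>Leb_n n) / ennreal Z"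
proof -
  let ?I = "\<lambda>S. \<integral>\<^sup>+ x. ennreal (gge_dens \<beta> m \<sigma> n x) * indicator S x \<partial>Leb_n n"
  have int: "(\<integral>y. gge_dens \<beta> m \<sigma> n y \<partial>Leb_n n) = Z"
    using Z by (subst integral_eq_nn_integral) (auto simp: gge_dens_nonneg)
  have law: "gge_law \<beta> m \<sigma> n = density (Leb_n n) (\<lambda>x. ennreal (gge_dens \<beta> m \<sigma> n x) / ennreal Z)"
    unfolding gge_law_def int using Z(2) by (simp add: divide_ennreal gge_dens_nonneg)
  show em: "emeasure (gge_law \<beta> m \<sigma> n) S = ?I S / ennreal Z"
    if [measurable]: "S \<in> sets (Leb_n n)" for S
  proof -
    have "emeasure (gge_law \<beta> m \<sigma> n) S = (\<integral>\<^sup>+ x. ennreal (gge_dens \<beta> m \<sigma> n x) / ennreal Z * indicator S x \<partial>Leb_n n)"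
      unfolding law by (rule emeasure_density) measurable
    also have "\<dots> = (\<integral>\<^sup>+ x. ennreal (gge_dens \<beta> m \<sigma> n x) * indicator S x / ennreal Z \<partial>Leb_n n)"
      by (intro nn_integral_cong) (auto simp: indicator_def)
    also have "\<dots> = ?I S / ennreal Z"
      by (rule nn_integral_divide) measurable
    finally show ?thesis .
  qed
  show "prob_space (gge_law \<beta> m \<sigma> n)"
  proof
    have "space (gge_law \<beta> m \<sigma> n) = space (Leb_n n)" by (simp add: law)
    hence "emeasure (gge_law \<beta> m \<sigma> n) (space (gge_law \<beta> m \<sigma> n))
      = ?I (space (Leb_n n)) / ennreal Z"
      by (simp add: em)
    also have "?I (space (Leb_n n)) = ennreal Z"
      unfolding Z(1)[symmetric] by (intro nn_integral_cong) auto
    finally show "emeasure (gge_law \<beta> m \<sigma> n) (space (gge_law \<beta> m \<sigma> n)) = 1"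
      using Z(2) by (simp add: divide_ennreal)
  qed
qed

context gas_minimizer
begin

text \<open>Outside the deviating configurations the average of \<open>\<phi>\<close> is within r/2
  of the limit; on them it is off by at most 2 B, and their probability is bounded by the quotient
  of \<open>gge_upper\<close> and \<open>gge_lower\<close>.\<close>

lemma emp_int_tendsto:
  assumes m: "\<And>n. m n > 0" "(\<lambda>n. m n / real n) \<longlonglongrightarrow> \<alpha>" "\<And>n. m n / real n \<le> A" and b: "\<beta> > 0"
    and phi: "continuous_on UNIV \<phi>" "bounded (range \<phi>)"
  shows "(\<lambda>n. emp_int \<beta> (m n) \<sigma> n \<phi>) \<longlonglongrightarrow> (\<integral>x. \<phi> x \<partial>\<nu>)"
proof (rule metric_LIMSEQ_I)
  fix r :: real assume r: "r > 0"
  define I where "I = (\<integral>x. \<phi> x \<partial>\<nu>)"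
  have [measurable]: "\<phi> \<in> borel_measurable borel" by (rule borel_measurable_continuous_onI[OF phi(1)])
  obtain B where B: "\<And>x. \<bar>\<phi> x\<bar> \<le> B" using phi(2) by (auto simp: bounded_iff)
  have B0: "B \<ge> 0" using abs_ge_zero B by (rule order_trans)
  have IB: "\<bar>I\<bar> \<le> B"
  proof -
    have "\<bar>I\<bar> \<le> (\<integral>x. \<bar>\<phi> x\<bar> \<partial>\<nu>)" unfolding I_def by (rule integral_abs_bound)
    also have "\<dots> \<le> (\<integral>x. B \<partial>\<nu>)"
      using B B0 by (intro integral_mono nu.integrable_const_bound[where B = B]) auto
    also have "\<dots> = B" using nu.prob_space by simp
    finally show ?thesis .
  qed
  define a where "a n = m n / real n" for n
  have a: "a \<longlonglongrightarrow> \<alpha>" "a n \<ge> 0" "a n \<le> A" for n using m less_imp_le[OF m(1)] by (auto simp: a_def[abs_def])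
  have r2: "r / 2 > 0" using r by simp
  obtain c N where c: "c > 0" and N: "N \<ge> 2"
    and gap: "\<And>n u. n \<ge> N \<Longrightarrow> (\<And>i. i < n \<Longrightarrow> \<sigma> \<le> u i) \<Longrightarrow> r / 2 \<le> \<bar>(\<Sum>i<n. \<phi> (u i)) / real n - I\<bar> \<Longrightarrow>
       (real n)\<^sup>2 * (min_energy + c) \<le> (\<Sum>i<n. \<Sum>j<n. rkern A (1 / real n) (a n) (1 - 1 / real n) (u i) (u j))"
    using discrete_gap[OF a phi(1) B r2] unfolding I_def by blast
  \<comment> \<open>The lower bound spends half of the gap, so the quotient keeps a factor
    \<open>exp (- \<beta> * c * n^2 / 4)\<close>.\<close>
  have c2: "c / 2 > 0" using c by simp
  obtain \<delta> K where \<delta>: "\<delta> > 0" and lower: "\<forall>\<^sub>F n in sequentially. ennreal (scale_factor \<beta> (m n) n *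
        exp (- (\<beta> / 2) * ((real n)\<^sup>2 * (min_energy + c / 2 - kern_shift A) + real n * K)) * \<delta> ^ n)
      \<le> (\<integral>\<^sup>+ x. ennreal (gge_dens \<beta> (m n) \<sigma> n x) \<partial>Leb_n n)"
    using gge_lower[OF m b c2] by blast
  \<comment> \<open>The exponent divided by n: \<open>\<beta> / 2\<close> times \<open>ln n\<close>
    comes from the diagonal at scale 1/n, another half from the width of the Gaussians, and
    \<open>C\<close> collects the constants. The linear term with \<open>c\<close> beats them
    all.\<close>
  define C where "C = \<beta> * K / 2 + \<beta> * pot_shift A / 2 + ln (4 * pi / \<beta>) / 2 - ln \<delta>"
  define p' where "p' n = exp (real n * (- (\<beta> * c / 4) * real n + (\<beta> / 2 + 1 / 2) * ln (real n) + C))" for n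
  have "p' \<longlonglongrightarrow> 0" unfolding p'_def by (rule gaussian_factor_tendsto_0) (use b c in simp)
  hence "(\<lambda>n. 2 * B * p' n) \<longlonglongrightarrow> 2 * B * 0" by (intro tendsto_intros)
  hence small: "\<forall>\<^sub>F n in sequentially. 2 * B * p' n < r / 2" using r by (intro order_tendstoD) auto
  have "\<forall>\<^sub>F n in sequentially. dist (emp_int \<beta> (m n) \<sigma> n \<phi>) I < r"
    using lower small eventually_ge_at_top[of N]
  proof eventually_elim
    case (elim n)
    let ?Z = "(\<integral>\<^sup>+ x. ennreal (gge_dens \<beta> (m n) \<sigma> n x) \<partial>Leb_n n)"
    let ?sf = "scale_factor \<beta> (m n) n"
    let ?D = "exp (real n * (\<beta> * pot_shift A / 2 + (ln (4 * pi / \<beta>) / 2 + ln (real n) / 2)))"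
    let ?E = "exp (- (\<beta> / 2) * ((real n)\<^sup>2 * ((min_energy + c) - kern_shift A) - real n * ln (real n)))"
    let ?F = "exp (- (\<beta> / 2) * ((real n)\<^sup>2 * (min_energy + c / 2 - kern_shift A) + real n * K))"
    have n: "n \<ge> 2" "n > 0" "real n > 0" using elim(3) N by auto
    define s where "s = sqrt (real n)"
    define avg where "avg x = (1 / real n) * (\<Sum>i<n. \<phi> (x i / s))" for x
    have [measurable]: "(\<lambda>x. x i) \<in> borel_measurable (Leb_n n)" if "i < n" for i
      using that measurable_component_singleton[of i "{..<n}" "\<lambda>_. lborel"] unfolding Leb_n_def by simp
    have [measurable]: "avg \<in> borel_measurable (Leb_n n)" unfolding avg_def by measurable
    define S where "S = {x \<in> space (Leb_n n). r / 2 \<le> \<bar>avg x - I\<bar>}"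
    have [measurable]: "S \<in> sets (Leb_n n)" unfolding S_def by measurable
    define L where "L = ?sf *
        ?F * \<delta> ^ n"
    define D where "D = exp (\<beta> * pot_shift A / 2) * sqrt (pi / (\<beta> / (4 * real n)))"
    define U where "U = ?sf * ?E * D ^ n"
    have sf: "?sf > 0" by (rule scale_factor_pos[OF n(2)])
    have L0: "L > 0" unfolding L_def using sf \<delta> by simp
    have U0: "U \<ge> 0" unfolding U_def D_def using sf b by simp
    have upper: "(\<integral>\<^sup>+ x. ennreal (gge_dens \<beta> (m n) \<sigma> n x) * indicator S x \<partial>Leb_n n) \<le> ennreal U"
      unfolding U_def D_def
    proof (rule gge_upper[OF n(1) b less_imp_le[OF m(1)] m(3)])
      fix x assume x: "x \<in> S" "\<And>i. i < n \<Longrightarrow> \<sigma> \<le> x i / sqrt (real n)"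
      show "(real n)\<^sup>2 * (min_energy + c)
         \<le> (\<Sum>i<n. \<Sum>j<n. rkern A (1 / real n) (m n / real n) (1 - 1 / real n) (x i / sqrt (real n)) (x j / sqrt (real n)))"
        using gap[OF elim(3), of "\<lambda>i. x i / sqrt (real n)"] x by (simp add: S_def avg_def s_def a_def)
    qed
    \<comment> \<open>The crude energy bound 0, valid for every configuration, is enough for
      finiteness.\<close>
    have fin: "?Z < \<infinity>"
    proof -
      have "(\<integral>\<^sup>+ x. ennreal (gge_dens \<beta> (m n) \<sigma> n x) * indicator UNIV x \<partial>Leb_n n)
        \<le> ennreal (?sf * exp (- (\<beta> / 2) * ((real n)\<^sup>2 * (0 - kern_shift A) - real n * ln (real n)))
        * (exp (\<beta> * pot_shift A / 2) * sqrt (pi / (\<beta> / (4 * real n)))) ^ n)"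
      proof (rule gge_upper[OF n(1) b less_imp_le[OF m(1)] m(3)])
        fix x :: "nat \<Rightarrow> real"
        have "0 \<le> rkern A (1 / real n) (m n / real n) (1 - 1 / real n) y z" for y z
          using n less_imp_le[OF m(1)[of n]] m(3)[of n] by (intro rkern_nonneg) (auto simp: field_simps)
        thus "(real n)\<^sup>2 * 0 \<le> (\<Sum>i<n. \<Sum>j<n. rkern A (1 / real n) (m n / real n) (1 - 1 / real n) (x i / sqrt (real n)) (x j / sqrt (real n)))"
          by (simp add: sum_nonneg)
      qed
      thus ?thesis by (auto intro: order_le_less_trans)
    qed
    then obtain Z where Z: "?Z = ennreal Z" "Z \<ge> 0"
      by (cases "?Z" rule: ennreal_cases) auto
    have ZL: "L \<le> Z" using elim(1) Z unfolding L_def[symmetric] by simp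
    hence Z0: "Z > 0" using L0 by simp
    define P where "P = gge_law \<beta> (m n) \<sigma> n"
    interpret P: prob_space P unfolding P_def by (rule gge_law_prob(1)[OF Z(1) Z0])
    have sP [measurable_cong]: "sets P = sets (Leb_n n)" by (simp add: P_def gge_law_def)
    have "emeasure P S \<le> ennreal U / ennreal Z"
      unfolding P_def by (subst gge_law_prob(2)[OF Z(1) Z0]) (auto intro!: divide_right_mono_ennreal upper)
    also have "\<dots> = ennreal (U / Z)" using U0 Z0 by (rule divide_ennreal)
    finally have "P.prob S \<le> U / Z" using U0 Z0 by (simp add: P.emeasure_eq_measure)
    also have "\<dots> \<le> U / L" using U0 L0 ZL by (intro divide_left_mono mult_pos_pos) auto
    also have "\<dots> = p' n"
    proof -
      have "sqrt (pi / (\<beta> / (4 * real n))) = exp (ln (4 * pi / \<beta>) / 2 + ln (real n) / 2)"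
      proof -
        have "sqrt (pi / (\<beta> / (4 * real n))) = sqrt (4 * pi / \<beta> * real n)" by (simp add: mult_ac)
        also have "\<dots> = exp (ln (4 * pi / \<beta> * real n) / 2)"
          using b n by (subst powr_half_sqrt[symmetric]) (auto simp: powr_def)
        also have "ln (4 * pi / \<beta> * real n) = ln (4 * pi / \<beta>) + ln (real n)"
          using b n by (intro ln_mult_pos) auto
        finally show ?thesis by (simp add: add_divide_distrib)
      qed
      hence "D = exp (\<beta> * pot_shift A / 2 + (ln (4 * pi / \<beta>) / 2 + ln (real n) / 2))" unfolding D_def by (simp only: exp_add)
      hence Dn: "D ^ n = ?D"
        by (simp only: exp_of_nat_mult)
      have "\<delta> = exp (ln \<delta>)" using \<delta> by simp
      hence dn: "\<delta> ^ n = exp (real n * ln \<delta>)" by (metis exp_of_nat_mult)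
      have "U / L = ?E
          * ?D
          / (?F * exp (real n * ln \<delta>))"
        unfolding U_def L_def Dn dn using sf by simp
      also have "\<dots> = p' n"
        unfolding p'_def C_def exp_add[symmetric] exp_diff[symmetric]
        by (rule arg_cong[where f = exp]) (simp add: power2_eq_square field_simps)
      finally show ?thesis .
    qed
    finally have prob: "P.prob S \<le> p' n" .
    have avgB: "\<bar>avg x\<bar> \<le> B" for x
    proof -
      have "\<bar>\<Sum>i<n. \<phi> (x i / s)\<bar> \<le> (\<Sum>i<n. B)" by (rule order_trans[OF sum_abs]) (intro sum_mono B)
      hence "\<bar>\<Sum>i<n. \<phi> (x i / s)\<bar> \<le> real n * B" by simp
      thus ?thesis using n by (simp add: avg_def abs_mult field_simps)
    qed
    have intavg: "integrable P avg" by (rule P.integrable_const_bound[where B = B]) (auto simp: avgB)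
    have "emp_int \<beta> (m n) \<sigma> n \<phi> - I = (\<integral>x. avg x - I \<partial>P)"
    proof -
      have "emp_int \<beta> (m n) \<sigma> n \<phi> = (\<integral>x. avg x \<partial>P)"
        unfolding emp_int_def P_def avg_def s_def ..
      thus ?thesis using intavg P.prob_space by simp
    qed
    hence "\<bar>emp_int \<beta> (m n) \<sigma> n \<phi> - I\<bar> \<le> (\<integral>x. \<bar>avg x - I\<bar> \<partial>P)" by (simp add: integral_abs_bound)
    also have "\<dots> \<le> (\<integral>x. r / 2 + 2 * B * indicator S x \<partial>P)"
    proof (rule integral_mono)
      show "integrable P (\<lambda>x. \<bar>avg x - I\<bar>)" using intavg by simp
      show "integrable P (\<lambda>x. r / 2 + 2 * B * indicator S x)" by (simp add: P.emeasure_eq_measure)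
      fix x assume "x \<in> space P"
      hence "x \<in> space (Leb_n n)" using sets_eq_imp_space_eq[OF sP] by simp
      moreover have "\<bar>avg x - I\<bar> \<le> 2 * B" using avgB[of x] IB by linarith
      ultimately show "\<bar>avg x - I\<bar> \<le> r / 2 + 2 * B * indicator S x"
        using r by (cases "x \<in> S") (auto simp: S_def not_le)
    qed
    also have "\<dots> = r / 2 + 2 * B * P.prob S"
      using P.prob_space by (subst Bochner_Integration.integral_add) (auto simp: P.emeasure_eq_measure)
    also have "\<dots> \<le> r / 2 + 2 * B * p' n" using prob B0 by (intro add_left_mono mult_left_mono) auto
    also have "\<dots> < r" using elim(2) by simp
    finally show ?case by (simp add: dist_real_def)
  qed
  thus "\<exists>no. \<forall>n\<ge>no. dist (emp_int \<beta> (m n) \<sigma> n \<phi>) (\<integral>x. \<phi> x \<partial>\<nu>) < r"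
    unfolding I_def eventually_sequentially .
qed

end

theorem theorem5p1:
  fixes \<beta> \<alpha> \<sigma> :: real and \<mu> :: "nat \<Rightarrow> real"
  assumes "\<beta> \<in> {1, 2, 4}"
    and "\<alpha> \<ge> 0"
    and "\<alpha> > 0 \<longrightarrow> \<sigma> > 0"
    and "\<And>n. \<mu> n > 0"
    and "(\<lambda>n. \<mu> n / real n) \<longlonglongrightarrow> \<alpha>"
  shows "\<exists>\<nu>. is_equilibrium_measure \<sigma> \<alpha> \<nu>
           \<and> (\<exists>!ab. \<sigma> \<le> fst ab \<and> fst ab < snd ab \<and> msupport \<nu> = {fst ab..snd ab})
           \<and> (\<forall>\<phi>. continuous_on UNIV \<phi> \<and> bounded (range \<phi>) \<longrightarrow>
                 (\<lambda>n. emp_int \<beta> (\<mu> n) \<sigma> n \<phi>) \<longlonglongrightarrow> (\<integral>x. \<phi> x \<partial>\<nu>))"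
proof -
  \<comment> \<open>Convergence bounds all exponents at once; the index 0 does no harm, since
    division by 0 yields 0.\<close>
  have "Bseq (\<lambda>n. \<mu> n / real n)" using assms(5) by (auto intro: convergent_imp_Bseq convergentI)
  then obtain A0 where A0: "\<And>n. \<bar>\<mu> n / real n\<bar> \<le> A0" by (auto simp: Bseq_def)
  define A where "A = max A0 \<alpha>"
  have A: "\<mu> n / real n \<le> A" for n using abs_le_D1[OF A0[of n]] unfolding A_def by (rule max.coboundedI1)
  interpret gas \<sigma> \<alpha> A by standard (use assms in \<open>auto simp: A_def\<close>)
  obtain \<nu> where minim: "prob_on \<sigma> \<nu>" "\<And>\<mu>. prob_on \<sigma> \<mu> \<Longrightarrow> energy A \<alpha> \<nu> \<le> energy A \<alpha> \<mu>" "energy A \<alpha> \<nu> < \<infinity>"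
    by (rule minimizer_exists) blast
  interpret gas_minimizer \<sigma> \<alpha> A \<nu> by standard (use minim in auto)
  obtain a b where ab: "\<sigma> \<le> a" "a < b" "msupport \<nu> = {a..b}" by (rule msupport_interval)
  have "\<exists>!ab. \<sigma> \<le> fst ab \<and> fst ab < snd ab \<and> msupport \<nu> = {fst ab..snd ab}"
    by (rule ex1I[of _ "(a, b)"]) (use ab in \<open>auto simp: Icc_eq_Icc prod_eq_iff\<close>)
  moreover have "is_equilibrium_measure \<sigma> \<alpha> \<nu>" by (rule is_equilibrium_measureI[OF minim(1,2)])
  moreover have "\<beta> > 0" using assms(1) by auto
  ultimately show ?thesis
    using emp_int_tendsto[OF assms(4,5) A] by blast
qed

end
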